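(* Let $\Sigma_n(P_1,P_0,\mathcal H,\widetilde W_B,\widetilde W_C)$ be a hyperbolic boundary control system (hBCS) satisfying the standing assumptions (1)–(5), the diagonalisability assumption, and $P_0^D(\xi)=0$ for all $\xi\in[a,b]$. Let $\Sigma_n(P_1^D,0,\mathcal H^D,\widetilde W_B^D,\widetilde W_C^D)$ be its diagonalised form, and let $M\in\mathbb K^{n\times n}$ and $\mathbf U(s)$ be the matrices associated with this diagonalised form. Suppose that at least one of the following conditions is satisfied: 1. $\|M\|_{\ell^\infty\to\ell^\infty}<1$; 2. the series $\sum_{k=0}^\infty (M_{|\cdot|})^k$ converges, where $M_{|\cdot|}$ is the matrix with entries $(M_{|\cdot|})_{ij}=|M_{ij}|$ (this is in particular the case if $\|M_{|\cdot|}\|<1$ in some submultiplicative matrix norm); 3. there exists an integer $k_0>0$ such that $\sum_{r=1}^n\left\|\left((M\mathbf U(s))^{k_0}\right)_{p,r}\right\|_{\mathcal M}<1$ for all $1\le p\le n$. Then for all $1\le p,q\le n$ $$\sum_{k=0}^\infty\left\|\left((M\mathbf U(s))^k\right)_{p,q}\right\|_{\mathcal M}<\infty,$$ and hence the system is BIBO stable.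
   Context: Let $\mathbb K\in\{\mathbb R,\mathbb C\}$, $a<b$, $n\ge1$, and let $\mathbb 1_k$ be the $k\times k$ identity matrix. **hBCS.** $\Sigma_n(P_1,P_0,\mathcal H,\widetilde W_B,\widetilde W_C)$ denotes the system on $[a,b]\times[0,\infty)$ with state $x(\xi,t)\in\mathbb K^n$, input $u(t)\in U=\mathbb K^n$, output $y(t)\in Y=\mathbb K^n$: $$\tfrac{\partial x}{\partial t}(\xi,t)=P_1\tfrac{\partial}{\partial\xi}(\mathcal H(\xi)x(\xi,t))+P_0(\xi)\mathcal H(\xi)x(\xi,t),\quad x(\xi,0)=x_0(\xi),$$ $$u(t)=\widetilde W_B\begin{bmatrix}(\mathcal Hx)(b,t)\\(\mathcal Hx)(a,t)\end{bmatrix},\qquad y(t)=\widetilde W_C\begin{bmatrix}(\mathcal Hx)(b,t)\\(\mathcal Hx)(a,t)\end{bmatrix}.$$ **Standing assumptions.** (1) $P_1\in\mathbb K^{n\times n}$ is invertible and self-adjoint. (2) $P_0\in L^\infty([a,b],\mathbb K^{n\times n})$. (3) $\mathcal H\in L^\infty([a,b],\mathbb K^{n\times n})$, $\mathcal H(\xi)$ is self-adjoint and $m_0\mathbb 1_n\le\mathcal H(\xi)\le M_0\mathbb 1_n$ for a.e. $\xi$, for some constants $m_0,M_0>0$. (4) $\widetilde W_B\in\mathbb K^{n\times2n}$ and $\begin{bmatrix}\widetilde W_B\\\widetilde W_C\end{bmatrix}\in\mathbb K^{2n\times2n}$ have full rank. (5) The operator $Ax_0=P_1\frac{\partial}{\partial\xi}(\mathcal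 Hx_0)+P_0\mathcal Hx_0$ with domain $\{x_0\in X:\mathcal Hx_0\in H^1([a,b],\mathbb K^n),\ \widetilde W_B\begin{bmatrix}(\mathcal Hx_0)(b)\\(\mathcal Hx_0)(a)\end{bmatrix}=0\}$ generates a $C_0$-semigroup on $X=L^2([a,b],\mathbb K^n)$ with inner product $\langle f,g\rangle_X=\frac12\int_a^bg^*\mathcal Hf\,d\xi$. **BIBO stability.** A classical solution is a triple $(u,x,y)$ with $u\in C([0,\infty),U)$, $x\in C^1([0,\infty),X)$, $y\in C([0,\infty),Y)$ solving the system equations. The hBCS is BIBO stable if there is $c>0$ such that for every classical solution with $u\in C_c^\infty([0,\infty),U)$ and $x(0)=0$, and all $t>0$, $\|y\|_{L^\infty([0,t],Y)}\le c\|u\|_{L^\infty([0,t],U)}$. **Diagonalisability assumption.** There exist $S,\mathcal H^D\in C^1([a,b],\mathbb K^{n\times n})$ with $S$ pointwise invertible, $\mathcal H^D$ diagonal and positive, such that $P_1\mathcal H=S^{-1}P_1^D\mathcal H^DS$, where $P_1^D=\begin{pmatrix}\mathbb 1_m&0\\0&-\mathbb 1_{n-m}\end{pmatrix}$ for some $0\le m\le n$. **Diagonalised form.** The state transformation $\widetilde x=Sx$ yields the hBCS $\Sigma_n(P_1^D,P_0^D,\mathcal H^D,\widetilde W_B^D,\widetilde W_C^D)$, with the same inputs and outputs, where $P_0^D(\xi)=S(\xi)\left[\frac{dS^{-1}}{d\xi}(\xi)+P_0(\xi)P_1^{-1}S^{-1}(\xi)\right]P_1^D$ and, for $\bullet\in\{B,C\}$,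 $\widetilde W_\bullet^D=\widetilde W_\bullet\begin{bmatrix}P_1^{-1}S^{-1}(b)P_1^D&0\\0&P_1^{-1}S^{-1}(a)P_1^D\end{bmatrix}$. **The matrices $M$ and $\mathbf U(s)$.** Let $Q_+^D=\begin{bmatrix}\mathbb 1_m&0\\0&0\end{bmatrix}$, $Q_-^D=\begin{bmatrix}0&0\\0&\mathbb 1_{n-m}\end{bmatrix}$. Whenever the hBCS $\Sigma_n(P_1,P_0,\mathcal H,\widetilde W_B,\widetilde W_C)$ satisfies the standing assumptions (1)–(5) and the diagonalisability assumption, there are unique $K,M\in\mathbb K^{n\times n}$ with $K$ invertible such that $\widetilde W_B^D=K\begin{pmatrix}Q_+^D-MQ_-^D&Q_-^D-MQ_+^D\end{pmatrix}$. Further, $\mathbf U(s)=\mathrm{diag}(e^{-s\lambda_1},\dots,e^{-s\lambda_n})$ with $\lambda_k=\int_a^b\frac{1}{(\mathcal H^D(\xi))_{kk}}\,d\xi>0$. **Norms.** $\|\cdot\|_{\ell^\infty\to\ell^\infty}$ is the matrix norm induced by the $\ell^\infty$-norm on $\mathbb K^n$. For a matrix-valued function $F$ of $s$, $\|F_{p,q}(s)\|_{\mathcal M}$ denotes the total variation of the inverse Laplace transform of the $(p,q)$-entry of $F$, i.e. of the Borel measure $\mu$ on $[0,\infty)$ whose Laplace transform agrees with $F_{p,q}$ on some right half-plane. (E.g. the inverse Laplace transform of $\sum_i\alpha_ie^{-s\mu_i}$, with finitely many pairwise different $\mu_i\ge0$, is $\sum_i\alpha_i\delta_{\mu_i}$,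 with total variation $\sum_i|\alpha_i|$.) *)

theory Defs
  imports "HOL-Analysis.Analysis" "HOL-Probability.Essential_Supremum"
begin

section \<open>The scalar field\<close>

text \<open>
  The class captures exactly the scalar fields \<open>\<real>\<close> and \<open>\<complex>\<close>: by \<open>range_to_complex\<close>
  every instance is isometrically isomorphic, via \<open>to_complex\<close>, to one of the two.
  The embedding is needed because Laplace transforms are complex-valued even for real systems.
\<close>

class rc_field = real_normed_field + euclidean_space +
  fixes to_complex :: "'a \<Rightarrow> complex"
    and kcnj :: "'a \<Rightarrow> 'a"
  assumes to_complex_add: "to_complex (x + y) = to_complex x + to_complex y"
    and to_complex_mult: "to_complex (x * y) = to_complex x * to_complex y"
    and to_complex_one: "to_complex 1 = 1"
    and to_complex_scaleR: "to_complex (r *\<^sub>R x) = r *\<^sub>R to_complex x"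
    and norm_to_complex: "norm (to_complex x) = norm x"
    and to_complex_kcnj: "to_complex (kcnj x) = cnj (to_complex x)"

instantiation real :: rc_field
begin
definition to_complex_real :: "real \<Rightarrow> complex" where "to_complex_real x = complex_of_real x"
definition kcnj_real :: "real \<Rightarrow> real" where "kcnj_real x = x"
instance by standard (simp_all add: to_complex_real_def kcnj_real_def scaleR_conv_of_real)
end

instantiation complex :: rc_field
begin
definition to_complex_complex :: "complex \<Rightarrow> complex" where "to_complex_complex x = x"
definition kcnj_complex :: "complex \<Rightarrow> complex" where "kcnj_complex x = cnj x"
instance by standard (simp_all add: to_complex_complex_def kcnj_complex_def)
end

lemma to_complex_of_real: "to_complex (of_real r :: 'k::rc_field) = of_real r"
  by (simp add: of_real_def to_complex_scaleR to_complex_one)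

lemma range_to_complex:
  "range (to_complex :: 'k::rc_field \<Rightarrow> complex) = \<real> \<or> range (to_complex :: 'k \<Rightarrow> complex) = UNIV"
proof (cases "range (to_complex :: 'k \<Rightarrow> complex) \<subseteq> \<real>")
  case True
  have "\<real> \<subseteq> range (to_complex :: 'k \<Rightarrow> complex)"
    by (metis Reals_cases rangeI subsetI to_complex_of_real)
  with True show ?thesis by blast
next
  case False
  then obtain x :: 'k where "to_complex x \<notin> \<real>" by blast
  then have im: "Im (to_complex x) \<noteq> 0" by (simp add: complex_is_Real_iff)
  have "z \<in> range (to_complex :: 'k \<Rightarrow> complex)" for z
  proof -
    define r where "r = Im z / Im (to_complex x)"
    define q where "q = Re z - r * Re (to_complex x)"
    have "to_complex (of_real r * x + of_real q :: 'k) = z"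
      unfolding to_complex_add to_complex_mult to_complex_of_real
      by (rule complex_eqI) (use im in \<open>simp_all add: r_def q_def\<close>)
    then show ?thesis by (metis rangeI)
  qed
  then show ?thesis by blast
qed

definition kre :: "'k::rc_field \<Rightarrow> real" where
  "kre x = Re (to_complex x)"


section \<open>Matrices\<close>

type_synonym ('k, 'n) sq_matrix = "(('k, 'n) vec, 'n) vec"
type_synonym ('k, 'n) n_2n_matrix = "(('k, 'n + 'n) vec, 'n) vec"

definition self_adjoint :: "'k::rc_field^'n^'n \<Rightarrow> bool" where
  "self_adjoint A \<longleftrightarrow> (\<forall>i j. A $ i $ j = kcnj (A $ j $ i))"

text \<open>\<open>kdot f g\<close> is \<open>g\<^sup>* f\<close>.\<close>

definition kdot :: "'k::rc_field^'n \<Rightarrow> 'k^'n \<Rightarrow> 'k" where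
  "kdot f g = (\<Sum>i\<in>UNIV. kcnj (g $ i) * f $ i)"

definition loewner_le :: "'k::rc_field^'n^'n \<Rightarrow> 'k^'n^'n \<Rightarrow> bool" where
  "loewner_le A B \<longleftrightarrow> (\<forall>v. 0 \<le> kre (kdot ((B - A) *v v) v))"

text \<open>Type \<open>'n + 'n\<close> indexes the \<open>2n\<close> rows or columns of block matrices, \<open>Inl\<close> first.\<close>

definition vstack :: "'k^'n \<Rightarrow> 'k^'n \<Rightarrow> 'k^('n + 'n)" where
  "vstack v w = (\<chi> j. case j of Inl l \<Rightarrow> v $ l | Inr l \<Rightarrow> w $ l)"

definition hcat :: "'k^'n^'n \<Rightarrow> 'k^'n^'n \<Rightarrow> 'k^('n + 'n)^'n" where
  "hcat A B = (\<chi> i. vstack (A $ i) (B $ i))"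

definition vcat :: "'k^('n + 'n)^'n \<Rightarrow> 'k^('n + 'n)^'n \<Rightarrow> 'k^('n + 'n)^('n + 'n)" where
  "vcat A B = (\<chi> i. case i of Inl l \<Rightarrow> A $ l | Inr l \<Rightarrow> B $ l)"

definition block_diag :: "'k::zero^'n^'n \<Rightarrow> 'k^'n^'n \<Rightarrow> 'k^('n + 'n)^('n + 'n)" where
  "block_diag A B = vcat (hcat A 0) (hcat 0 B)"

text \<open>The class \<open>power\<close> on vectors of vectors is componentwise, hence a separate matrix power.\<close>

primrec mat_pow :: "'k::semiring_1^'n^'n \<Rightarrow> nat \<Rightarrow> 'k^'n^'n" where
  "mat_pow A 0 = mat 1"
| "mat_pow A (Suc k) = A ** mat_pow A k"

definition diag_mat :: "('n \<Rightarrow> 'k::zero) \<Rightarrow> 'k^'n^'n" where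
  "diag_mat d = (\<chi> i j. if i = j then d i else 0)"

text \<open>The index type is linearly ordered; \<open>i\<close> is among the first \<open>m\<close> indices iff fewer than
  \<open>m\<close> indices precede it.\<close>

definition among_first :: "nat \<Rightarrow> 'n::{finite,linorder} \<Rightarrow> bool" where
  "among_first m i \<longleftrightarrow> card {l. l < i} < m"

definition P1D :: "nat \<Rightarrow> ('k::rc_field, 'n::{finite,linorder}) sq_matrix" where
  "P1D m = diag_mat (\<lambda>i. if among_first m i then 1 else - 1)"

definition QplusD :: "nat \<Rightarrow> ('k::rc_field, 'n::{finite,linorder}) sq_matrix" where
  "QplusD m = diag_mat (\<lambda>i. if among_first m i then 1 else 0)"

definition QminusD :: "nat \<Rightarrow> ('k::rc_field, 'n::{finite,linorder}) sq_matrix" where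
  "QminusD m = diag_mat (\<lambda>i. if among_first m i then 0 else 1)"

definition linf_norm :: "'k::rc_field^'n \<Rightarrow> real" where
  "linf_norm v = Max (range (\<lambda>i. norm (v $ i)))"

definition linf_matrix_norm :: "'k::rc_field^'n^'n \<Rightarrow> real" where
  "linf_matrix_norm A = (SUP v. linf_norm (A *v v) / linf_norm v)"

definition abs_matrix :: "'k::rc_field^'n^'n \<Rightarrow> real^'n^'n" where
  "abs_matrix A = (\<chi> i j. norm (A $ i $ j))"

definition submultiplicative_matrix_norm :: "(real^'n^'n \<Rightarrow> real) \<Rightarrow> bool" where
  "submultiplicative_matrix_norm N \<longleftrightarrow>
     (\<forall>A. 0 \<le> N A) \<and> (\<forall>A. N A = 0 \<longleftrightarrow> A = 0) \<and>
     (\<forall>c A. N (c *\<^sub>R A) = \<bar>c\<bar> * N A) \<and>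
     (\<forall>A B. N (A + B) \<le> N A + N B) \<and>
     (\<forall>A B. N (A ** B) \<le> N A * N B)"


section \<open>Function spaces on \<open>[a,b]\<close>\<close>

text \<open>Elements of Lebesgue spaces are represented by functions; equality is
  almost-everywhere equality on \<open>[a,b]\<close>.\<close>

definition ae_eq :: "real \<Rightarrow> real \<Rightarrow> (real \<Rightarrow> 'v) \<Rightarrow> (real \<Rightarrow> 'v) \<Rightarrow> bool" where
  "ae_eq a b f g \<longleftrightarrow> (AE \<xi> in lebesgue_on {a..b}. f \<xi> = g \<xi>)"

definition Linf :: "real \<Rightarrow> real \<Rightarrow> (real \<Rightarrow> 'v::euclidean_space) set" where
  "Linf a b = {f \<in> borel_measurable (lebesgue_on {a..b}).
     \<exists>C. AE \<xi> in lebesgue_on {a..b}. norm (f \<xi>) \<le> C}"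

definition L2 :: "real \<Rightarrow> real \<Rightarrow> (real \<Rightarrow> 'v::euclidean_space) set" where
  "L2 a b = {f \<in> borel_measurable (lebesgue_on {a..b}).
     integrable (lebesgue_on {a..b}) (\<lambda>\<xi>. (norm (f \<xi>))\<^sup>2)}"

text \<open>\<open>H1_rep a b f w v\<close>: the class of \<open>f\<close> lies in \<open>H\<^sup>1([a,b])\<close>, with absolutely continuous
  representative \<open>w\<close> (whose endpoint values are the traces) and derivative \<open>v\<close>.\<close>

definition H1_rep ::
  "real \<Rightarrow> real \<Rightarrow> (real \<Rightarrow> 'v::euclidean_space) \<Rightarrow> (real \<Rightarrow> 'v) \<Rightarrow> (real \<Rightarrow> 'v) \<Rightarrow> bool" where
  "H1_rep a b f w v \<longleftrightarrow>
     v \<in> L2 a b \<and> (\<forall>\<xi>\<in>{a..b}. (v has_integral (w \<xi> - w a)) {a..\<xi>}) \<and> ae_eq a b f w"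

text \<open>Unlike \<open>C1_differentiable_on\<close>, this uses one-sided derivatives at the end points.\<close>

definition C1_interval :: "real \<Rightarrow> real \<Rightarrow> (real \<Rightarrow> 'v::real_normed_vector) \<Rightarrow> bool" where
  "C1_interval a b f \<longleftrightarrow>
     (\<exists>f'. (\<forall>\<xi>\<in>{a..b}. (f has_vector_derivative f' \<xi>) (at \<xi> within {a..b})) \<and>
           continuous_on {a..b} f')"

definition X_inner ::
  "real \<Rightarrow> real \<Rightarrow> (real \<Rightarrow> 'k::rc_field^'n^'n) \<Rightarrow> (real \<Rightarrow> 'k^'n) \<Rightarrow> (real \<Rightarrow> 'k^'n) \<Rightarrow> 'k" where
  "X_inner a b H f g = (1 / 2) * (LINT \<xi>|lebesgue_on {a..b}. kdot (H \<xi> *v f \<xi>) (g \<xi>))"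

definition X_norm :: "real \<Rightarrow> real \<Rightarrow> (real \<Rightarrow> 'k::rc_field^'n^'n) \<Rightarrow> (real \<Rightarrow> 'k^'n) \<Rightarrow> real" where
  "X_norm a b H f = sqrt (kre (X_inner a b H f f))"


section \<open>Strongly continuous semigroups on \<open>X\<close>\<close>

definition C0_semigroup ::
  "real \<Rightarrow> real \<Rightarrow> (real \<Rightarrow> 'k::rc_field^'n^'n) \<Rightarrow>
   (real \<Rightarrow> (real \<Rightarrow> 'k^'n) \<Rightarrow> (real \<Rightarrow> 'k^'n)) \<Rightarrow> bool" where
  "C0_semigroup a b H T \<longleftrightarrow>
     (\<forall>t\<ge>0. \<forall>f\<in>L2 a b. T t f \<in> L2 a b) \<and>
     (\<forall>t\<ge>0. \<forall>f\<in>L2 a b. \<forall>g\<in>L2 a b. \<forall>c d.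
        ae_eq a b (T t (\<lambda>\<xi>. c *s f \<xi> + d *s g \<xi>)) (\<lambda>\<xi>. c *s T t f \<xi> + d *s T t g \<xi>)) \<and>
     (\<forall>t\<ge>0. \<exists>C. \<forall>f\<in>L2 a b. X_norm a b H (T t f) \<le> C * X_norm a b H f) \<and>
     (\<forall>f\<in>L2 a b. ae_eq a b (T 0 f) f) \<and>
     (\<forall>s\<ge>0. \<forall>t\<ge>0. \<forall>f\<in>L2 a b. ae_eq a b (T (s + t) f) (T s (T t f))) \<and>
     (\<forall>f\<in>L2 a b. ((\<lambda>h. X_norm a b H (\<lambda>\<xi>. T h f \<xi> - f \<xi>)) \<longlongrightarrow> 0) (at_right 0))"

text \<open>An operator is given by its graph \<open>G\<close>, i.e. \<open>G f g\<close> means that \<open>f\<close> lies in the domain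
  and is mapped to \<open>g\<close>.\<close>

definition generates_C0_semigroup ::
  "real \<Rightarrow> real \<Rightarrow> (real \<Rightarrow> 'k::rc_field^'n^'n) \<Rightarrow>
   ((real \<Rightarrow> 'k^'n) \<Rightarrow> (real \<Rightarrow> 'k^'n) \<Rightarrow> bool) \<Rightarrow> bool" where
  "generates_C0_semigroup a b H G \<longleftrightarrow>
     (\<exists>T. C0_semigroup a b H T \<and>
       (\<forall>f\<in>L2 a b. \<forall>g\<in>L2 a b. G f g \<longleftrightarrow>
          ((\<lambda>h. X_norm a b H (\<lambda>\<xi>. (1 / h) *\<^sub>R (T h f \<xi> - f \<xi>) - g \<xi>)) \<longlongrightarrow> 0) (at_right 0)))"


section \<open>Hyperbolic boundary control systems\<close>

definition hbcs_operator ::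
  "real \<Rightarrow> real \<Rightarrow> 'k::rc_field^'n^'n \<Rightarrow> (real \<Rightarrow> 'k^'n^'n) \<Rightarrow> (real \<Rightarrow> 'k^'n^'n) \<Rightarrow>
   'k^('n + 'n)^'n \<Rightarrow> (real \<Rightarrow> 'k^'n) \<Rightarrow> (real \<Rightarrow> 'k^'n) \<Rightarrow> bool" where
  "hbcs_operator a b P1 P0 H WB x0 z \<longleftrightarrow>
     x0 \<in> L2 a b \<and>
     (\<exists>w v. H1_rep a b (\<lambda>\<xi>. H \<xi> *v x0 \<xi>) w v \<and>
            WB *v vstack (w b) (w a) = 0 \<and>
            ae_eq a b z (\<lambda>\<xi>. P1 *v v \<xi> + P0 \<xi> *v (H \<xi> *v x0 \<xi>)))"

definition standing_assumptions ::
  "real \<Rightarrow> real \<Rightarrow> 'k::rc_field^'n^'n \<Rightarrow> (real \<Rightarrow> 'k^'n^'n) \<Rightarrow> (real \<Rightarrow> 'k^'n^'n) \<Rightarrow>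
   'k^('n + 'n)^'n \<Rightarrow> 'k^('n + 'n)^'n \<Rightarrow> bool" where
  "standing_assumptions a b P1 P0 H WB WC \<longleftrightarrow>
     invertible P1 \<and> self_adjoint P1 \<and>
     P0 \<in> Linf a b \<and>
     H \<in> Linf a b \<and>
     (\<exists>m0>0. \<exists>M0>0. AE \<xi> in lebesgue_on {a..b}.
        self_adjoint (H \<xi>) \<and>
        loewner_le (mat (of_real m0)) (H \<xi>) \<and> loewner_le (H \<xi>) (mat (of_real M0))) \<and>
     rank WB = CARD('n) \<and> rank (vcat WB WC) = 2 * CARD('n) \<and>
     generates_C0_semigroup a b H (hbcs_operator a b P1 P0 H WB)"

definition classical_solution ::
  "real \<Rightarrow> real \<Rightarrow> 'k::rc_field^'n^'n \<Rightarrow> (real \<Rightarrow> 'k^'n^'n) \<Rightarrow> (real \<Rightarrow> 'k^'n^'n) \<Rightarrow>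
   'k^('n + 'n)^'n \<Rightarrow> 'k^('n + 'n)^'n \<Rightarrow> (real \<Rightarrow> 'k^'n) \<Rightarrow>
   (real \<Rightarrow> 'k^'n) \<Rightarrow> (real \<Rightarrow> real \<Rightarrow> 'k^'n) \<Rightarrow> (real \<Rightarrow> 'k^'n) \<Rightarrow> bool" where
  "classical_solution a b P1 P0 H WB WC x0 u x y \<longleftrightarrow>
     continuous_on {0..} u \<and> continuous_on {0..} y \<and>
     ae_eq a b (x 0) x0 \<and>
     (\<exists>dx.
       (\<forall>t\<ge>0. x t \<in> L2 a b \<and> dx t \<in> L2 a b) \<and>
       (\<forall>t\<ge>0. ((\<lambda>s. X_norm a b H (\<lambda>\<xi>. (1 / (s - t)) *\<^sub>R (x s \<xi> - x t \<xi>) - dx t \<xi>)) \<longlongrightarrow> 0)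
                 (at t within {0..})) \<and>
       (\<forall>t\<ge>0. ((\<lambda>s. X_norm a b H (\<lambda>\<xi>. dx s \<xi> - dx t \<xi>)) \<longlongrightarrow> 0) (at t within {0..})) \<and>
       (\<forall>t\<ge>0. \<exists>w v. H1_rep a b (\<lambda>\<xi>. H \<xi> *v x t \<xi>) w v \<and>
                 ae_eq a b (dx t) (\<lambda>\<xi>. P1 *v v \<xi> + P0 \<xi> *v (H \<xi> *v x t \<xi>)) \<and>
                 u t = WB *v vstack (w b) (w a) \<and>
                 y t = WC *v vstack (w b) (w a)))"

text \<open>\<open>C\<^sub>c\<^sup>\<infinity>([0,\<infinity>))\<close>: smooth up to \<open>0\<close> (one-sided derivatives there), vanishing for large times.\<close>

definition test_function :: "(real \<Rightarrow> 'v::real_normed_vector) \<Rightarrow> bool" where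
  "test_function u \<longleftrightarrow>
     (\<exists>D. (\<forall>t\<ge>0. D 0 t = u t) \<and>
        (\<forall>k. \<forall>t\<ge>0. (D k has_vector_derivative D (Suc k) t) (at t within {0..}))) \<and>
     (\<exists>R. \<forall>t\<ge>R. u t = 0)"

definition Linf_norm :: "real \<Rightarrow> (real \<Rightarrow> 'v::real_normed_vector) \<Rightarrow> ennreal" where
  "Linf_norm t f = esssup (lebesgue_on {0..t}) (\<lambda>s. ennreal (norm (f s)))"

definition BIBO_stable ::
  "real \<Rightarrow> real \<Rightarrow> 'k::rc_field^'n^'n \<Rightarrow> (real \<Rightarrow> 'k^'n^'n) \<Rightarrow> (real \<Rightarrow> 'k^'n^'n) \<Rightarrow>
   'k^('n + 'n)^'n \<Rightarrow> 'k^('n + 'n)^'n \<Rightarrow> bool" where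
  "BIBO_stable a b P1 P0 H WB WC \<longleftrightarrow>
     (\<exists>c>0. \<forall>u x y. classical_solution a b P1 P0 H WB WC (\<lambda>_. 0) u x y \<and> test_function u \<longrightarrow>
        (\<forall>t>0. Linf_norm t y \<le> ennreal c * Linf_norm t u))"


section \<open>Diagonalisation\<close>

text \<open>\<open>H\<close> is only defined almost everywhere, so the factorisation of \<open>P\<^sub>1 H\<close> is an identity
  almost everywhere.\<close>

definition diagonalisation ::
  "real \<Rightarrow> real \<Rightarrow> ('k::rc_field, 'n::{finite,linorder}) sq_matrix \<Rightarrow> (real \<Rightarrow> ('k, 'n) sq_matrix) \<Rightarrow>
   nat \<Rightarrow> (real \<Rightarrow> ('k, 'n) sq_matrix) \<Rightarrow> (real \<Rightarrow> ('k, 'n) sq_matrix) \<Rightarrow> bool" where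
  "diagonalisation a b P1 H m S HD \<longleftrightarrow>
     m \<le> CARD('n) \<and> C1_interval a b S \<and> C1_interval a b HD \<and>
     (\<forall>\<xi>\<in>{a..b}. invertible (S \<xi>)) \<and>
     (\<forall>\<xi>\<in>{a..b}. \<exists>d. (\<forall>i. 0 < d i) \<and> HD \<xi> = diag_mat (\<lambda>i. of_real (d i))) \<and>
     ae_eq a b (\<lambda>\<xi>. P1 ** H \<xi>) (\<lambda>\<xi>. matrix_inv (S \<xi>) ** P1D m ** HD \<xi> ** S \<xi>)"

definition P0D ::
  "real \<Rightarrow> real \<Rightarrow> ('k::rc_field, 'n::{finite,linorder}) sq_matrix \<Rightarrow> (real \<Rightarrow> ('k, 'n) sq_matrix) \<Rightarrow>
   nat \<Rightarrow> (real \<Rightarrow> ('k, 'n) sq_matrix) \<Rightarrow> real \<Rightarrow> ('k, 'n) sq_matrix" where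
  "P0D a b P1 P0 m S \<xi> =
     S \<xi> ** (vector_derivative (\<lambda>\<eta>. matrix_inv (S \<eta>)) (at \<xi> within {a..b})
             + P0 \<xi> ** matrix_inv P1 ** matrix_inv (S \<xi>)) ** P1D m"

definition WD ::
  "real \<Rightarrow> real \<Rightarrow> ('k::rc_field, 'n::{finite,linorder}) sq_matrix \<Rightarrow> nat \<Rightarrow> (real \<Rightarrow> ('k, 'n) sq_matrix) \<Rightarrow>
   ('k, 'n) n_2n_matrix \<Rightarrow> ('k, 'n) n_2n_matrix" where
  "WD a b P1 m S W =
     W ** block_diag (matrix_inv P1 ** matrix_inv (S b) ** P1D m)
                     (matrix_inv P1 ** matrix_inv (S a) ** P1D m)"

definition travel_time :: "real \<Rightarrow> real \<Rightarrow> (real \<Rightarrow> 'k::rc_field^'n^'n) \<Rightarrow> 'n \<Rightarrow> real" where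
  "travel_time a b HD k = integral {a..b} (\<lambda>\<xi>. 1 / kre (HD \<xi> $ k $ k))"

definition U_mat :: "real \<Rightarrow> real \<Rightarrow> (real \<Rightarrow> 'k::rc_field^'n^'n) \<Rightarrow> complex \<Rightarrow> complex^'n^'n" where
  "U_mat a b HD s = diag_mat (\<lambda>k. exp (- s * of_real (travel_time a b HD k)))"

definition MU :: "real \<Rightarrow> real \<Rightarrow> (real \<Rightarrow> 'k::rc_field^'n^'n) \<Rightarrow> 'k^'n^'n \<Rightarrow> complex \<Rightarrow> complex^'n^'n" where
  "MU a b HD M s = (\<chi> i j. to_complex (M $ i $ j)) ** U_mat a b HD s"


section \<open>Total variation of inverse Laplace transforms\<close>

abbreviation halfline_borel :: "real measure" where
  "halfline_borel \<equiv> restrict_space borel {0..}"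

text \<open>Complex Borel measures on \<open>[0,\<infinity>)\<close> are set functions, set to \<open>0\<close> off the Borel sets so that
  equal measures are equal functions.\<close>

definition complex_borel_measure :: "(real set \<Rightarrow> complex) \<Rightarrow> bool" where
  "complex_borel_measure \<mu> \<longleftrightarrow>
     (\<forall>E. E \<notin> sets halfline_borel \<longrightarrow> \<mu> E = 0) \<and>
     (\<forall>A :: nat \<Rightarrow> real set. range A \<subseteq> sets halfline_borel \<and> disjoint_family A \<longrightarrow>
        (\<lambda>i. \<mu> (A i)) sums \<mu> (\<Union>i. A i))"

definition total_variation :: "(real set \<Rightarrow> complex) \<Rightarrow> ennreal" where
  "total_variation \<mu> =
     (SUP P\<in>{P. finite P \<and> P \<subseteq> sets halfline_borel \<and> partition_on {0..} P}.
        \<Sum>E\<in>P. ennreal (norm (\<mu> E)))"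

text \<open>Integration against a complex measure \<open>\<mu>\<close> is expressed through a density \<open>h\<close> of \<open>\<mu>\<close> with
  respect to some finite positive measure \<open>\<nu>\<close> (e.g. the polar decomposition with \<open>\<nu> = |\<mu>|\<close>):
  \<open>\<integral> f d\<mu> = \<integral> f h d\<nu>\<close>.\<close>

definition inverse_laplace :: "(complex \<Rightarrow> complex) \<Rightarrow> (real set \<Rightarrow> complex) \<Rightarrow> bool" where
  "inverse_laplace F \<mu> \<longleftrightarrow>
     complex_borel_measure \<mu> \<and>
     (\<exists>\<nu> h. finite_measure \<nu> \<and> sets \<nu> = sets halfline_borel \<and> integrable \<nu> h \<and>
        (\<forall>E\<in>sets halfline_borel. \<mu> E = (LINT t:E|\<nu>. h t)) \<and>
        (\<exists>\<sigma>. \<forall>s. \<sigma> < Re s \<longrightarrow> F s = (LINT t|\<nu>. exp (- s * of_real t) * h t)))"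

text \<open>A complex measure as above has finite total variation; if \<open>F\<close> is not the Laplace transform
  of one, the norm is infinite.\<close>

definition M_norm :: "(complex \<Rightarrow> complex) \<Rightarrow> ennreal" where
  "M_norm F = (if \<exists>\<mu>. inverse_laplace F \<mu> then total_variation (THE \<mu>. inverse_laplace F \<mu>) else \<infinity>)"

end

theory Submission
  imports Defs "HOL-Library.Poly_Mapping"
begin

text \<open>
  The entries of \<open>(M U(s))\<^sup>k\<close> are exponential polynomials \<open>\<Sum>\<^sub>\<tau> c\<^sub>\<tau> exp (- s \<tau>)\<close>. They form a
  convolution algebra in which the norm \<open>\<Sum>\<^sub>\<tau> |c\<^sub>\<tau>|\<close> is submultiplicative and, by uniqueness of
  the Laplace transform, equals the total variation norm. Each of the three conditions makes
  these norms summable over \<open>k\<close>, the third by a geometric series in blocks of length \<open>k\<^sub>0\<close>.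

  Since \<open>P\<^sub>0\<^sup>D = 0\<close>, the diagonalised system consists of decoupled transport equations: the trace
  of the \<open>k\<close>-th component at the outflow end is the trace at the inflow end delayed by
  \<open>\<lambda>\<^sub>k\<close>. The boundary condition thus becomes the delay equation
  \<open>f (t) = K\<^sup>-\<^sup>1 u (t) + \<Sum>\<^sub>q M\<^sub>q f\<^sub>q (t - \<lambda>\<^sub>q)\<close> for the inflow traces \<open>f\<close>. As all delays are
  positive, its iteration terminates and gives \<open>f = \<Sum>\<^sub>k (M U)\<^sup>k K\<^sup>-\<^sup>1 u\<close>, whence the sup norm of
  \<open>f\<close>, and then that of the output, is bounded by that of \<open>u\<close>.
\<close>

\<comment> \<open>Formally, \<open>P0D = 0\<close> makes \<open>g = HD z\<close> constant along
  characteristics, but a classical solution is differentiable in time only in the norm of X, and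
  \<open>g t\<close> is merely absolutely continuous in space, so it cannot simply be followed along
  a curve. Instead the equation is integrated against a weight that is constant along
  characteristics, which leaves boundary terms only. Extracting pointwise values from the resulting
  integral identities requires traces continuous in time; the definition of a classical solution
  does not grant this, and it is recovered by inverting the full-rank matrix
  \<open>vcat WB WC\<close>. On the algebraic side the delays are kept as formal exponents. One and
  the same ring element is evaluated at s by \<open>pm_laplace\<close>, acts on signals by
  \<open>delay_apply\<close>, and has a norm that reads off its coefficients. \<open>M_norm\<close>
  speaks of the inverse Laplace transform by a definite description, so no norm can be computed
  before uniqueness is known. Terms with equal total delay may cancel, so the powers of
  \<open>abs_matrix M\<close> only dominate the true norms.\<close>
text \<open>\<open>Poly_Mapping\<close> reuses the notation of infinite sums for sums over finitely supported functions.\<close>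

no_syntax
  "_Sum_any" :: "pttrn \<Rightarrow> 'a \<Rightarrow> 'a::comm_monoid_add"
    (\<open>(\<open>indent=2 notation=\<open>binder \<Sum>\<close>\<close>\<Sum>_. _)\<close> [0, 10] 10)


section \<open>Exponential polynomials\<close>

text \<open>The finitely supported function \<open>p\<close> stands for \<open>\<Sum>\<^sub>\<tau> p\<^sub>\<tau> exp (- s \<tau>)\<close> as well as for the
  measure \<open>\<Sum>\<^sub>\<tau> p\<^sub>\<tau> \<delta>\<^sub>\<tau>\<close>; the ring multiplication of the library type is convolution.\<close>

definition pm_sum :: "(real \<Rightarrow> 'k \<Rightarrow> 'b::comm_monoid_add) \<Rightarrow> (real \<Rightarrow>\<^sub>0 'k::rc_field) \<Rightarrow> 'b" where
  "pm_sum \<phi> p = (\<Sum>\<tau>\<in>Poly_Mapping.keys p. \<phi> \<tau> (Poly_Mapping.lookup p \<tau>))"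

text \<open>Addition may cancel coefficients and so shrink the keys; a common larger index set is
  harmless because the summand vanishes at coefficient 0.\<close>

lemma pm_sum_superset:
  assumes "finite A" "Poly_Mapping.keys p \<subseteq> A" "\<And>\<tau>. \<phi> \<tau> 0 = 0"
  shows "pm_sum \<phi> p = (\<Sum>\<tau>\<in>A. \<phi> \<tau> (Poly_Mapping.lookup p \<tau>))"
  unfolding pm_sum_def
  by (rule sum.mono_neutral_left) (use assms in \<open>auto simp: in_keys_iff\<close>)

lemma pm_sum_add:
  assumes "\<And>\<tau> c d. \<phi> \<tau> (c + d) = \<phi> \<tau> c + \<phi> \<tau> d" "\<And>\<tau>. \<phi> \<tau> 0 = 0"
  shows "pm_sum \<phi> (p + q) = pm_sum \<phi> p + pm_sum \<phi> q"
proof -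
  let ?A = "Poly_Mapping.keys p \<union> Poly_Mapping.keys q"
  have "pm_sum \<phi> r = (\<Sum>\<tau>\<in>?A. \<phi> \<tau> (Poly_Mapping.lookup r \<tau>))" if "Poly_Mapping.keys r \<subseteq> ?A" for r
    by (rule pm_sum_superset) (use that assms in auto)
  then show ?thesis
    using Poly_Mapping.keys_add[of p q]
    by (simp add: lookup_add assms sum.distrib)
qed

lemma pm_sum_zero [simp]: "pm_sum \<phi> 0 = 0"
  by (simp add: pm_sum_def)

lemma pm_sum_sum:
  assumes "\<And>\<tau> c d. \<phi> \<tau> (c + d) = \<phi> \<tau> c + \<phi> \<tau> d" "\<And>\<tau>. \<phi> \<tau> 0 = 0"
  shows "pm_sum \<phi> (\<Sum>i\<in>I. f i) = (\<Sum>i\<in>I. pm_sum \<phi> (f i))"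
  by (induction I rule: infinite_finite_induct) (simp_all add: pm_sum_add[of \<phi>, OF assms])

lemma pm_sum_single [simp]: "\<phi> \<tau> 0 = 0 \<Longrightarrow> pm_sum \<phi> (Poly_Mapping.single \<tau> c) = \<phi> \<tau> c"
  by (simp add: pm_sum_def)

lemma poly_mapping_sum_singles:
  "p = (\<Sum>\<tau>\<in>Poly_Mapping.keys p. Poly_Mapping.single \<tau> (Poly_Mapping.lookup p \<tau>))"
proof (rule poly_mapping_eqI)
  fix t
  show "Poly_Mapping.lookup p t =
    Poly_Mapping.lookup (\<Sum>\<tau>\<in>Poly_Mapping.keys p. Poly_Mapping.single \<tau> (Poly_Mapping.lookup p \<tau>)) t"
    by (auto simp: lookup_sum lookup_single when_def sum.delta' in_keys_iff)
qed

lemma poly_mapping_mult_singles: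
  "p * q = (\<Sum>\<tau>\<in>Poly_Mapping.keys p. \<Sum>\<sigma>\<in>Poly_Mapping.keys q.
     Poly_Mapping.single (\<tau> + \<sigma>) (Poly_Mapping.lookup p \<tau> * Poly_Mapping.lookup q \<sigma>))"
proof -
  have "p * q =
    (\<Sum>\<tau>\<in>Poly_Mapping.keys p. Poly_Mapping.single \<tau> (Poly_Mapping.lookup p \<tau>)) *
    (\<Sum>\<sigma>\<in>Poly_Mapping.keys q. Poly_Mapping.single \<sigma> (Poly_Mapping.lookup q \<sigma>))"
    by (simp only: poly_mapping_sum_singles[symmetric])
  then show ?thesis
    by (simp add: sum_product mult_single)
qed

lemma pm_sum_mult:
  assumes "\<And>\<tau> c d. \<phi> \<tau> (c + d) = \<phi> \<tau> c + \<phi> \<tau> d" "\<And>\<tau>. \<phi> \<tau> 0 = 0"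
  shows "pm_sum \<phi> (p * q) = (\<Sum>\<tau>\<in>Poly_Mapping.keys p. \<Sum>\<sigma>\<in>Poly_Mapping.keys q.
     \<phi> (\<tau> + \<sigma>) (Poly_Mapping.lookup p \<tau> * Poly_Mapping.lookup q \<sigma>))"
  by (subst poly_mapping_mult_singles) (simp add: pm_sum_sum[of \<phi>, OF assms] assms)

section \<open>Norm, Laplace transform and action on signals\<close>

definition pm_norm :: "(real \<Rightarrow>\<^sub>0 'k::rc_field) \<Rightarrow> real" where
  "pm_norm = pm_sum (\<lambda>\<tau> c. norm c)"

lemma pm_norm_nonneg [simp]: "0 \<le> pm_norm p"
  by (simp add: pm_norm_def pm_sum_def sum_nonneg)

lemma pm_norm_single [simp]: "pm_norm (Poly_Mapping.single \<tau> c) = norm c"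
  by (simp add: pm_norm_def)

lemma pm_norm_zero [simp]: "pm_norm 0 = 0"
  by (simp add: pm_norm_def)

lemma pm_norm_add_le: "pm_norm (p + q) \<le> pm_norm p + pm_norm q"
proof -
  let ?A = "Poly_Mapping.keys p \<union> Poly_Mapping.keys q"
  have eq: "pm_norm r = (\<Sum>\<tau>\<in>?A. norm (Poly_Mapping.lookup r \<tau>))" if "Poly_Mapping.keys r \<subseteq> ?A" for r
    unfolding pm_norm_def by (rule pm_sum_superset) (use that in auto)
  have "pm_norm (p + q) = (\<Sum>\<tau>\<in>?A. norm (Poly_Mapping.lookup (p + q) \<tau>))"
    by (rule eq) (rule Poly_Mapping.keys_add)
  also have "\<dots> \<le> (\<Sum>\<tau>\<in>?A. norm (Poly_Mapping.lookup p \<tau>) + norm (Poly_Mapping.lookup q \<tau>))"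
    by (rule sum_mono) (simp add: lookup_add norm_triangle_ineq)
  finally show ?thesis
    by (simp add: sum.distrib eq)
qed

lemma pm_norm_sum_le: "pm_norm (\<Sum>i\<in>I. f i) \<le> (\<Sum>i\<in>I. pm_norm (f i))"
  by (induction I rule: infinite_finite_induct)
     (auto intro: order_trans[OF pm_norm_add_le])

text \<open>Reduces to products of single exponentials, where delays add and coefficients multiply;
  the inequality is strict when terms with the same delay cancel.\<close>

lemma pm_norm_mult_le: "pm_norm (p * q) \<le> pm_norm p * pm_norm q"
proof -
  have "pm_norm (p * q) \<le> (\<Sum>\<tau>\<in>Poly_Mapping.keys p. pm_norm (\<Sum>\<sigma>\<in>Poly_Mapping.keys q.
     Poly_Mapping.single (\<tau> + \<sigma>) (Poly_Mapping.lookup p \<tau> * Poly_Mapping.lookup q \<sigma>)))"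
    by (subst poly_mapping_mult_singles) (rule pm_norm_sum_le)
  also have "\<dots> \<le> (\<Sum>\<tau>\<in>Poly_Mapping.keys p. \<Sum>\<sigma>\<in>Poly_Mapping.keys q.
     norm (Poly_Mapping.lookup p \<tau>) * norm (Poly_Mapping.lookup q \<sigma>))"
    by (intro sum_mono order_trans[OF pm_norm_sum_le]) (simp add: norm_mult)
  also have "\<dots> = pm_norm p * pm_norm q"
    by (simp add: pm_norm_def pm_sum_def sum_product)
  finally show ?thesis .
qed

lemma to_complex_zero [simp]: "to_complex (0::'k::rc_field) = 0"
  using to_complex_of_real[of 0, where 'k='k] by simp

definition pm_laplace :: "complex \<Rightarrow> (real \<Rightarrow>\<^sub>0 'k::rc_field) \<Rightarrow> complex" where
  "pm_laplace s = pm_sum (\<lambda>\<tau> c. exp (- s * of_real \<tau>) * to_complex c)"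

lemma pm_laplace_single [simp]:
  "pm_laplace s (Poly_Mapping.single \<tau> c) = exp (- s * of_real \<tau>) * to_complex c"
  by (simp add: pm_laplace_def)

lemma pm_laplace_zero [simp]: "pm_laplace s 0 = 0"
  by (simp add: pm_laplace_def)

lemma pm_laplace_one [simp]: "pm_laplace s 1 = 1"
  using pm_laplace_single[of s 0 1] by (simp add: to_complex_one del: pm_laplace_single)

lemma pm_laplace_sum: "pm_laplace s (\<Sum>i\<in>I. f i) = (\<Sum>i\<in>I. pm_laplace s (f i))"
  unfolding pm_laplace_def by (rule pm_sum_sum) (simp_all add: to_complex_add distrib_left)

lemma pm_laplace_mult: "pm_laplace s (p * q) = pm_laplace s p * pm_laplace s q"
  unfolding pm_laplace_def
  by (subst pm_sum_mult)
     (simp_all add: to_complex_add to_complex_mult distrib_left pm_sum_def sum_product exp_add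
       exp_diff exp_minus field_simps)

text \<open>\<open>delay_apply p f\<close> is the convolution of \<open>f\<close> with the measure \<open>\<Sum>\<tau>. p \<tau> \<delta>\<^sub>\<tau>\<close>.\<close>

definition delay_apply :: "(real \<Rightarrow>\<^sub>0 'k::rc_field) \<Rightarrow> (real \<Rightarrow> 'k) \<Rightarrow> real \<Rightarrow> 'k" where
  "delay_apply p f t = pm_sum (\<lambda>\<tau> c. c * f (t - \<tau>)) p"

lemma delay_apply_single [simp]: "delay_apply (Poly_Mapping.single \<tau> c) f t = c * f (t - \<tau>)"
  by (simp add: delay_apply_def)

lemma delay_apply_zero [simp]: "delay_apply 0 f t = 0"
  by (simp add: delay_apply_def)

lemma delay_apply_one [simp]: "delay_apply 1 f t = f t"
  using delay_apply_single[of 0 1 f t] by (simp del: delay_apply_single)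

lemma delay_apply_sum: "delay_apply (\<Sum>i\<in>I. p i) f t = (\<Sum>i\<in>I. delay_apply (p i) f t)"
  unfolding delay_apply_def by (rule pm_sum_sum) (simp_all add: distrib_right)

text \<open>Makes \<open>delay_apply\<close> an action of the convolution ring, so that substituting
  the delay equation into itself becomes multiplication of matrices over that ring.\<close>

lemma delay_apply_mult: "delay_apply (p * q) f t = delay_apply p (delay_apply q f) t"
  unfolding delay_apply_def
  by (subst pm_sum_mult)
     (simp_all add: distrib_right pm_sum_def sum_distrib_left diff_diff_eq mult.assoc)

lemma delay_apply_add_fun: "delay_apply p (\<lambda>t. f t + g t) t = delay_apply p f t + delay_apply p g t"
  by (simp add: delay_apply_def pm_sum_def sum.distrib distrib_left)

lemma delay_apply_sum_fun: "delay_apply p (\<lambda>t. \<Sum>i\<in>I. f i t) t = (\<Sum>i\<in>I. delay_apply p (f i) t)"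
  by (simp add: delay_apply_def pm_sum_def sum_distrib_left sum.swap[of _ I])

lemma norm_delay_apply_le:
  assumes "\<And>\<tau>. \<tau> \<in> Poly_Mapping.keys p \<Longrightarrow> norm (f (t - \<tau>)) \<le> B"
  shows "norm (delay_apply p f t) \<le> pm_norm p * B"
  unfolding delay_apply_def pm_norm_def pm_sum_def sum_distrib_right
  by (intro order_trans[OF norm_sum] sum_mono) (simp add: norm_mult assms mult_left_mono)

lemma delay_apply_eq_0:
  assumes "\<And>\<tau>. \<tau> \<in> Poly_Mapping.keys p \<Longrightarrow> f (t - \<tau>) = 0"
  shows "delay_apply p f t = 0"
  unfolding delay_apply_def pm_sum_def using assms by simp

section \<open>Powers of the delay matrix\<close>

text \<open>This is \<open>M U(s)\<close> with formal exponentials. The delay depends on the column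
  because \<open>U_mat\<close> multiplies from the right.\<close>

definition delay_matrix :: "('n::finite \<Rightarrow> real) \<Rightarrow> 'k::rc_field^'n^'n \<Rightarrow> (real \<Rightarrow>\<^sub>0 'k)^'n^'n" where
  "delay_matrix l M = (\<chi> i j. Poly_Mapping.single (l j) (M $ i $ j))"

text \<open>\<open>pm_laplace s\<close> is a ring homomorphism that maps \<open>delay_matrix\<close>
  entrywise to \<open>MU\<close>, hence it commutes with matrix powers.\<close>

lemma mat_pow_MU_eq_laplace:
  "mat_pow (MU a b HD M s) k $ p $ q =
     pm_laplace s (mat_pow (delay_matrix (travel_time a b HD) M) k $ p $ q)"
proof (induction k arbitrary: p q)
  case 0
  then show ?case by (simp add: mat_def)
next
  case (Suc k)
  have "MU a b HD M s $ p $ r = pm_laplace s (delay_matrix (travel_time a b HD) M $ p $ r)" for r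
    by (simp add: MU_def U_mat_def delay_matrix_def matrix_matrix_mult_def diag_mat_def
        if_distrib[of "\<lambda>x. _ * x"] sum.delta cong: if_cong)
  then show ?case
    by (simp add: matrix_matrix_mult_def pm_laplace_sum pm_laplace_mult Suc.IH)
qed

lemma mat_pow_add:
  fixes A :: "'a::semiring_1^'n^'n"
  shows "mat_pow A (k + l) = mat_pow A k ** mat_pow A l"
  by (induction k) (simp_all add: matrix_mul_assoc)

lemma keys_sum_subset: "Poly_Mapping.keys (\<Sum>i\<in>I. f i) \<subseteq> (\<Union>i\<in>I. Poly_Mapping.keys (f i))"
proof (induction I rule: infinite_finite_induct)
  case (insert i I)
  then show ?case using Poly_Mapping.keys_add[of "f i" "\<Sum>i\<in>I. f i"] by auto
qed auto

text \<open>Each term of an entry of the k-th power is a product of \<open>k\<close> single delays.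
  With \<open>l0 = 0\<close> this places the measures on the half-line and makes the action causal;
  with \<open>l0 > 0\<close> the delays outgrow any given time.\<close>

lemma keys_mat_pow_delay_matrix_ge:
  assumes l: "\<And>j. l0 \<le> l j" and "\<tau> \<in> Poly_Mapping.keys (mat_pow (delay_matrix l M) k $ p $ q)"
  shows "real k * l0 \<le> \<tau>"
  using assms(2)
proof (induction k arbitrary: p q \<tau>)
  case 0
  then show ?case by (auto simp: mat_def split: if_splits)
next
  case (Suc k)
  then obtain r where
    "\<tau> \<in> Poly_Mapping.keys (delay_matrix l M $ p $ r * mat_pow (delay_matrix l M) k $ r $ q)"
    using keys_sum_subset[of "\<lambda>r. delay_matrix l M $ p $ r * mat_pow (delay_matrix l M) k $ r $ q" UNIV]
    by (auto simp: matrix_matrix_mult_def)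
  then obtain \<tau>1 \<tau>2 where "\<tau> = \<tau>1 + \<tau>2" "\<tau>1 \<in> Poly_Mapping.keys (delay_matrix l M $ p $ r)"
    "\<tau>2 \<in> Poly_Mapping.keys (mat_pow (delay_matrix l M) k $ r $ q)"
    using keys_mult[of "delay_matrix l M $ p $ r" "mat_pow (delay_matrix l M) k $ r $ q"] by auto
  with Suc.IH[of \<tau>2 r q] l[of r] show ?case
    by (auto simp: delay_matrix_def distrib_right split: if_splits)
qed

lemma pm_norm_mat_pow_add_le:
  "pm_norm (mat_pow A (k + l) $ p $ q) \<le> (\<Sum>r\<in>UNIV. pm_norm (mat_pow A k $ p $ r) * pm_norm (mat_pow A l $ r $ q))"
  unfolding mat_pow_add matrix_matrix_mult_def
  by (simp add: order_trans[OF pm_norm_sum_le] sum_mono pm_norm_mult_le)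

section \<open>Summability under each of the three conditions\<close>

text \<open>The maximal row sum of the entry norms is submultiplicative. Writing the exponent as
  \<open>j * k0 + i\<close> with \<open>i < k0\<close> gives decay like \<open>\<theta> ^ j\<close>,
  up to the finitely many powers below \<open>k0\<close>.\<close>

lemma summable_pm_norm_of_row_sums:
  fixes A :: "(real \<Rightarrow>\<^sub>0 'k::rc_field)^'n^'n"
  assumes k0: "k0 > 0" and less: "\<And>p. (\<Sum>r\<in>UNIV. pm_norm (mat_pow A k0 $ p $ r)) < 1"
  shows "summable (\<lambda>k. pm_norm (mat_pow A k $ p $ q))"
proof -
  \<comment> \<open>There are finitely many rows, so the strict row bounds are uniform.\<close>
  define \<theta> where "\<theta> = Max (range (\<lambda>p. \<Sum>r\<in>UNIV. pm_norm (mat_pow A k0 $ p $ r)))"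
  have \<theta>: "(\<Sum>r\<in>UNIV. pm_norm (mat_pow A k0 $ p $ r)) \<le> \<theta>" for p
    unfolding \<theta>_def by (rule Max_ge) auto
  have \<theta>1: "\<theta> < 1" unfolding \<theta>_def using less by (subst Max_less_iff) auto
  have \<theta>0: "0 \<le> \<theta>" using \<theta>[of undefined] by (meson order_trans pm_norm_nonneg sum_nonneg)
  \<comment> \<open>A crude common bound for all entries of the powers below \<open>k0\<close>, the
    possible remainders of the exponent.\<close>
  define C where "C = (\<Sum>i<k0. \<Sum>p\<in>UNIV. \<Sum>q\<in>UNIV. pm_norm (mat_pow A i $ p $ q))"
  have C: "pm_norm (mat_pow A i $ p $ q) \<le> C" if "i < k0" for i p q
  proof -
    have "pm_norm (mat_pow A i $ p $ q) \<le> (\<Sum>q\<in>UNIV. pm_norm (mat_pow A i $ p $ q))"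
      by (rule member_le_sum) auto
    also have "\<dots> \<le> (\<Sum>p\<in>UNIV. \<Sum>q\<in>UNIV. pm_norm (mat_pow A i $ p $ q))"
      by (rule member_le_sum[of p UNIV "\<lambda>p. \<Sum>q\<in>UNIV. pm_norm (mat_pow A i $ p $ q)"]) (auto intro: sum_nonneg)
    also have "\<dots> \<le> C" unfolding C_def
      by (rule member_le_sum[of i "{..<k0}" "\<lambda>i. \<Sum>p\<in>UNIV. \<Sum>q\<in>UNIV. pm_norm (mat_pow A i $ p $ q)"])
        (auto intro!: sum_nonneg that)
    finally show ?thesis .
  qed
  have C0: "0 \<le> C" unfolding C_def by (intro sum_nonneg) auto
  have bound: "pm_norm (mat_pow A (j * k0 + i) $ p $ q) \<le> \<theta> ^ j * C" if i: "i < k0" for i j p q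
  proof (induction j arbitrary: p)
    case 0
    then show ?case using C[OF i] by simp
  next
    case (Suc j)
    have "pm_norm (mat_pow A (Suc j * k0 + i) $ p $ q)
      \<le> (\<Sum>r\<in>UNIV. pm_norm (mat_pow A k0 $ p $ r) * pm_norm (mat_pow A (j * k0 + i) $ r $ q))"
      using pm_norm_mat_pow_add_le[of A k0 "j * k0 + i"] by (simp add: add.assoc)
    also have "\<dots> \<le> (\<Sum>r\<in>UNIV. pm_norm (mat_pow A k0 $ p $ r) * (\<theta> ^ j * C))"
      by (intro sum_mono mult_left_mono Suc.IH) auto
    also have "\<dots> \<le> \<theta> * (\<theta> ^ j * C)"
      unfolding sum_distrib_right[symmetric] using \<theta>[of p] \<theta>0 C0 by (intro mult_right_mono) auto
    finally show ?case by (simp add: mult.assoc)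
  qed
  have le: "pm_norm (mat_pow A k $ p $ q) \<le> \<theta> ^ (k div k0) * C" for k p q
    using bound[of "k mod k0" "k div k0"] k0 by simp
  \<comment> \<open>Padding to \<open>N * k0\<close> terms fills whole blocks of length
    \<open>k0\<close>, each of which costs one term of the geometric series \<open>k0\<close>
    times.\<close>
  have "(\<Sum>k<N. pm_norm (mat_pow A k $ p $ q)) \<le> real k0 * C / (1 - \<theta>)" for N
  proof -
    have "(\<Sum>k<N. pm_norm (mat_pow A k $ p $ q)) \<le> (\<Sum>k<N * k0. pm_norm (mat_pow A k $ p $ q))"
      by (rule sum_mono2) (use k0 in \<open>auto intro: less_le_trans\<close>)
    also have "\<dots> = (\<Sum>j<N. \<Sum>k = j * k0..<j * k0 + k0. pm_norm (mat_pow A k $ p $ q))"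
      by (rule sum.nat_group[symmetric])
    also have "\<dots> \<le> (\<Sum>j<N. \<Sum>k = j * k0..<j * k0 + k0. \<theta> ^ j * C)"
    proof (intro sum_mono)
      fix j k assume "k \<in> {j * k0..<j * k0 + k0}"
      then have "k div k0 = j" by (intro div_nat_eqI) (auto simp: mult.commute)
      with le[of k p q] show "pm_norm (mat_pow A k $ p $ q) \<le> \<theta> ^ j * C" by simp
    qed
    also have "\<dots> = (\<Sum>j<N. \<theta> ^ j) * (real k0 * C)"
      by (simp add: sum_distrib_left sum_distrib_right mult_ac)
    also have "\<dots> \<le> (1 / (1 - \<theta>)) * (real k0 * C)"
      using \<theta>0 \<theta>1 C0 sum_le_suminf[of "\<lambda>j. \<theta> ^ j" "{..<N}"]
      by (intro mult_right_mono) (auto simp: suminf_geometric)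
    finally show ?thesis by simp
  qed
  then show ?thesis
    by (intro bounded_imp_summable[of _ "real k0 * C / (1 - \<theta>)"])
      (simp_all add: lessThan_Suc_atMost[symmetric] del: sum.lessThan_Suc)
qed

text \<open>An entry of the delay matrix has norm \<open>norm (M $ i $ j)\<close> whatever its
  delay; submultiplicativity carries this to the powers.\<close>

lemma pm_norm_mat_pow_delay_matrix_le:
  "pm_norm (mat_pow (delay_matrix l M) k $ p $ q) \<le> mat_pow (abs_matrix M) k $ p $ q"
proof (induction k arbitrary: p q)
  case 0
  then show ?case by (simp add: mat_def pm_norm_single[of 0 1, simplified])
next
  case (Suc k)
  have "pm_norm (mat_pow (delay_matrix l M) (Suc k) $ p $ q) \<le>
    (\<Sum>r\<in>UNIV. pm_norm (delay_matrix l M $ p $ r) * pm_norm (mat_pow (delay_matrix l M) k $ r $ q))"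
    unfolding mat_pow.simps matrix_matrix_mult_def
    by (simp add: order_trans[OF pm_norm_sum_le] sum_mono pm_norm_mult_le)
  also have "\<dots> \<le> (\<Sum>r\<in>UNIV. abs_matrix M $ p $ r * mat_pow (abs_matrix M) k $ r $ q)"
    by (intro sum_mono mult_mono Suc.IH) (simp_all add: delay_matrix_def abs_matrix_def)
  finally show ?case by (simp add: matrix_matrix_mult_def)
qed

lemma summable_pm_norm_of_summable_abs:
  assumes "summable (mat_pow (abs_matrix M))"
  shows "summable (\<lambda>k. pm_norm (mat_pow (delay_matrix l M) k $ p $ q))"
proof -
  have "summable (\<lambda>k. mat_pow (abs_matrix M) k $ p $ q)"
    using assms bounded_linear.summable[OF bounded_linear_compose[OF bounded_linear_vec_nth bounded_linear_vec_nth]]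
    by blast
  then show ?thesis
    by (rule summable_comparison_test'[where N = 0]) (simp add: pm_norm_mat_pow_delay_matrix_le)
qed

lemma linf_norm_nonneg [simp]: "0 \<le> linf_norm v"
  unfolding linf_norm_def by (rule Max_ge_iff[THEN iffD2]) auto

lemma norm_le_linf_norm: "norm (v $ i) \<le> linf_norm v"
  unfolding linf_norm_def by (rule Max_ge) auto

lemma linf_norm_le: "(\<And>i. norm (v $ i) \<le> B) \<Longrightarrow> linf_norm v \<le> B"
  unfolding linf_norm_def by (subst Max_le_iff) auto

lemma row_sum_le_linf_matrix_norm:
  fixes M :: "'k::rc_field^'n^'n"
  shows "(\<Sum>r\<in>UNIV. norm (M $ p $ r)) \<le> linf_matrix_norm M"
proof -
  \<comment> \<open>A supremum of reals is informative only for a bounded set. At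
    \<open>v = 0\<close> the quotient is \<open>0 / 0 = 0\<close>.\<close>
  have bdd: "bdd_above (range (\<lambda>v. linf_norm (M *v v) / linf_norm v))"
  proof (rule bdd_aboveI2)
    fix v
    define C where "C = (\<Sum>i\<in>UNIV. \<Sum>j\<in>UNIV. norm (M $ i $ j))"
    have "norm ((M *v v) $ i) \<le> C * linf_norm v" for i
    proof -
      have "norm ((M *v v) $ i) \<le> (\<Sum>j\<in>UNIV. norm (M $ i $ j) * linf_norm v)"
        unfolding matrix_vector_mult_def
        by (auto intro!: order_trans[OF norm_sum] sum_mono mult_left_mono norm_le_linf_norm simp: norm_mult)
      also have "\<dots> \<le> C * linf_norm v"
        unfolding sum_distrib_right[symmetric] C_def
        by (intro mult_right_mono member_le_sum[of i UNIV "\<lambda>i. \<Sum>j\<in>UNIV. norm (M $ i $ j)"]) (auto intro: sum_nonneg)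
      finally show ?thesis .
    qed
    then have "linf_norm (M *v v) \<le> C * linf_norm v" by (rule linf_norm_le)
    moreover have "0 \<le> C" by (auto simp: C_def intro!: sum_nonneg)
    ultimately show "linf_norm (M *v v) / linf_norm v \<le> C"
      by (cases "linf_norm v = 0") (auto simp: divide_le_eq less_le)
  qed
  \<comment> \<open>The phases undo those of row \<open>p\<close>, so that \<open>M *v v\<close> has
    the row sum as its \<open>p\<close>-th component. The value 1 at zero entries keeps all
    components of modulus 1.\<close>
  define v :: "'k^'n" where
    "v = (\<chi> r. if M $ p $ r = 0 then 1 else of_real (norm (M $ p $ r)) / M $ p $ r)"
  have v1: "norm (v $ i) = 1" for i by (simp add: v_def norm_divide)
  then have "linf_norm v = 1"
    by (intro antisym linf_norm_le) (use norm_le_linf_norm[of v undefined] in auto)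
  moreover have "(M *v v) $ p = of_real (\<Sum>r\<in>UNIV. norm (M $ p $ r))"
    by (auto simp: matrix_vector_mult_def v_def intro!: sum.cong)
  then have "(\<Sum>r\<in>UNIV. norm (M $ p $ r)) \<le> linf_norm (M *v v)"
    using norm_le_linf_norm[of "M *v v" p] by (simp del: of_real_sum)
  ultimately show ?thesis
    unfolding linf_matrix_norm_def
    by (intro cSUP_upper2[OF bdd, of v]) auto
qed

text \<open>The case \<open>k0 = 1\<close> of the block criterion.\<close>

lemma summable_pm_norm_of_linf_matrix_norm:
  fixes M :: "'k::rc_field^'n^'n"
  assumes "linf_matrix_norm M < 1"
  shows "summable (\<lambda>k. pm_norm (mat_pow (delay_matrix l M) k $ p $ q))"
  by (rule summable_pm_norm_of_row_sums[of 1])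
     (use row_sum_le_linf_matrix_norm[of M] assms in \<open>auto simp: delay_matrix_def intro: le_less_trans\<close>)

text \<open>One half of the equivalence of norms in finite dimension: \<open>c\<close> is the
  minimum of \<open>N\<close> on the compact Euclidean unit sphere, positive by
  definiteness.\<close>

lemma submultiplicative_norm_equiv:
  fixes N :: "real^'n^'n \<Rightarrow> real"
  assumes N: "submultiplicative_matrix_norm N"
  obtains c where "c > 0" "\<And>A. c * norm A \<le> N A"
proof -
  have nonneg: "0 \<le> N A" and zero: "N A = 0 \<longleftrightarrow> A = 0" and scale: "N (r *\<^sub>R A) = \<bar>r\<bar> * N A"
    and tri: "N (A + B) \<le> N A + N B" for A B r
    using N by (auto simp: submultiplicative_matrix_norm_def)
  have diff: "\<bar>N A - N B\<bar> \<le> N (A - B)" for A B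
  proof -
    have "N (B - A) = N (A - B)" using scale[of "-1" "A - B"] by simp
    then show ?thesis using tri[of "A - B" B] tri[of "B - A" A] by simp
  qed
  \<comment> \<open>A Lipschitz constant of \<open>N\<close> for the Euclidean norm, from expansion
    in the standard basis; the resulting continuity lets \<open>N\<close> attain its
    minimum.\<close>
  define C where "C = (\<Sum>e\<in>Basis. N (e :: real^'n^'n))"
  have le: "N A \<le> C * norm A" for A
  proof -
    have sum_le: "N (\<Sum>e\<in>I. f e) \<le> (\<Sum>e\<in>I. N (f e))" for I and f :: "real^'n^'n \<Rightarrow> real^'n^'n"
    proof (induction I rule: infinite_finite_induct)
      case (insert e I)
      then show ?case using tri[of "f e" "\<Sum>e\<in>I. f e"] by simp
    qed (use zero[of 0] in simp_all)
    have "N A \<le> (\<Sum>e\<in>Basis. N ((A \<bullet> e) *\<^sub>R e))"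
      using sum_le[of "\<lambda>e. (A \<bullet> e) *\<^sub>R e" Basis] by (simp add: euclidean_representation)
    also have "\<dots> \<le> (\<Sum>e\<in>Basis. N e * norm A)"
      by (rule sum_mono) (simp add: scale mult.commute nonneg Basis_le_norm mult_left_mono)
    finally show ?thesis by (simp add: C_def sum_distrib_right)
  qed
  have cont: "continuous_on UNIV N"
  proof -
    have "\<bar>N A - N B\<bar> \<le> C * norm (A - B)" for A B using diff le order_trans by blast
    then have "C-lipschitz_on UNIV N"
      by (intro lipschitz_onI) (auto simp: dist_norm C_def intro: sum_nonneg nonneg)
    then show ?thesis by (rule lipschitz_on_continuous_on)
  qed
  have "sphere (0::real^'n^'n) 1 \<noteq> {}" by simp
  then obtain A0 where A0: "A0 \<in> sphere 0 1" "\<And>A. A \<in> sphere 0 1 \<Longrightarrow> N A0 \<le> N A"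
    using continuous_attains_inf[of "sphere 0 1" N] compact_sphere cont continuous_on_subset by blast
  have "N A0 > 0" using A0(1) nonneg[of A0] zero[of A0] by (auto simp: less_le)
  moreover have "N A0 * norm A \<le> N A" for A
  proof (cases "A = 0")
    case True
    then show ?thesis using nonneg by simp
  next
    case False
    then have "N A0 \<le> N ((1 / norm A) *\<^sub>R A)" by (intro A0(2)) simp
    then show ?thesis using False by (simp add: scale field_simps)
  qed
  ultimately show ?thesis using that by blast
qed

text \<open>\<open>summable\<close> refers to the Euclidean norm, hence the passage through norm
  equivalence. The factor \<open>N (mat 1)\<close> remains because a submultiplicative norm need not
  be 1 at the identity.\<close>

lemma summable_mat_pow_of_submultiplicative_norm:
  assumes N: "submultiplicative_matrix_norm N" and less: "N A < 1"
  shows "summable (mat_pow A)"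
proof -
  obtain c where c: "c > 0" "\<And>A. c * norm A \<le> N A"
    using submultiplicative_norm_equiv[OF N] by blast
  have nonneg: "0 \<le> N B" and mult: "N (B ** D) \<le> N B * N D" for B D
    using N by (auto simp: submultiplicative_matrix_norm_def)
  have pow: "N (mat_pow A k) \<le> N A ^ k * N (mat 1)" for k
  proof (induction k)
    case (Suc k)
    have "N (mat_pow A (Suc k)) \<le> N A * N (mat_pow A k)" using mult by simp
    also have "\<dots> \<le> N A * (N A ^ k * N (mat 1))" using Suc nonneg by (intro mult_left_mono) auto
    finally show ?case by simp
  qed simp
  have "norm (mat_pow A k) \<le> N A ^ k * (N (mat 1) / c)" for k
    using order_trans[OF c(2) pow, of k] c(1) by (simp add: field_simps)
  moreover have "summable (\<lambda>k. N A ^ k * (N (mat 1) / c))"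
    using less nonneg by (intro summable_mult2 summable_geometric) auto
  ultimately show ?thesis
    by (auto intro: summable_comparison_test'[where N = 0 and g = "\<lambda>k. N A ^ k * (N (mat 1) / c)"])
qed

section \<open>The delay equation\<close>

text \<open>Substituting the equation into itself \<open>N\<close> times yields a truncated Neumann
  series and a remainder.\<close>

lemma delay_iteration:
  fixes f v :: "'n::finite \<Rightarrow> real \<Rightarrow> 'k::rc_field"
  assumes eq: "\<And>p t. f p t = v p t + (\<Sum>q\<in>UNIV. delay_apply (A $ p $ q) (f q) t)"
  shows "f p t = (\<Sum>k<N. \<Sum>q\<in>UNIV. delay_apply (mat_pow A k $ p $ q) (v q) t)
    + (\<Sum>q\<in>UNIV. delay_apply (mat_pow A N $ p $ q) (f q) t)"
proof (induction N)
  case 0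
  have "delay_apply (mat 1 $ p $ q) (f q) t = (if q = p then f q t else 0)" for q
    by (simp add: mat_def)
  then show ?case by simp
next
  case (Suc N)
  \<comment> \<open>\<open>mat_pow\<close> adds factors on the left, whereas substitution into the
    remainder adds them on the right.\<close>
  have comm: "mat_pow A (Suc N) = mat_pow A N ** A"
    using mat_pow_add[of A N 1] by simp
  have "(\<Sum>q\<in>UNIV. delay_apply (mat_pow A N $ p $ q) (f q) t) =
    (\<Sum>q\<in>UNIV. delay_apply (mat_pow A N $ p $ q) (\<lambda>t. v q t + (\<Sum>r\<in>UNIV. delay_apply (A $ q $ r) (f r) t)) t)"
    by (intro sum.cong refl arg_cong[where f = "\<lambda>g. delay_apply _ g t"] ext eq)
  also have "\<dots> = (\<Sum>q\<in>UNIV. delay_apply (mat_pow A N $ p $ q) (v q) t) +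
     (\<Sum>r\<in>UNIV. \<Sum>q\<in>UNIV. delay_apply (mat_pow A N $ p $ q * A $ q $ r) (f r) t)"
    unfolding delay_apply_add_fun delay_apply_sum_fun delay_apply_mult sum.distrib
    by (rule arg_cong2[where f = "(+)", OF refl sum.swap])
  also have "(\<Sum>r\<in>UNIV. \<Sum>q\<in>UNIV. delay_apply (mat_pow A N $ p $ q * A $ q $ r) (f r) t) =
    (\<Sum>r\<in>UNIV. delay_apply (mat_pow A (Suc N) $ p $ r) (f r) t)"
    unfolding comm by (simp add: matrix_matrix_mult_def delay_apply_sum)
  finally show ?case using Suc.IH by simp
qed

text \<open>The remainder samples \<open>f\<close> at times \<open>t - \<tau>\<close> with
  \<open>\<tau> \<ge> N * l0\<close>, where \<open>f\<close> vanishes once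
  \<open>N * l0 > t\<close>. This \<open>N\<close> depends on \<open>t\<close>, but the partial sums
  stay below the full series, so the constant does not.\<close>

lemma delay_system_bound:
  fixes f v :: "'n::finite \<Rightarrow> real \<Rightarrow> 'k::rc_field"
  assumes l: "\<And>q. 0 < l q"
    and eq: "\<And>p t. f p t = v p t + (\<Sum>q\<in>UNIV. M $ p $ q * f q (t - l q))"
    and neg: "\<And>p t. t < 0 \<Longrightarrow> f p t = 0"
    and sum: "\<And>p q. summable (\<lambda>k. pm_norm (mat_pow (delay_matrix l M) k $ p $ q))"
    and v: "\<And>q s. s \<le> t \<Longrightarrow> norm (v q s) \<le> B"
  shows "norm (f p t) \<le> (\<Sum>q\<in>UNIV. \<Sum>k. pm_norm (mat_pow (delay_matrix l M) k $ p $ q)) * B"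
proof -
  let ?A = "delay_matrix l M"
  define l0 where "l0 = Min (range l)"
  have l0: "0 < l0" "\<And>q. l0 \<le> l q" using l by (auto simp: l0_def)
  obtain N :: nat where N: "real N * l0 > t" using reals_Archimedean3[OF l0(1)] by blast
  have B0: "0 \<le> B" using v[of t undefined] norm_ge_zero order_trans by blast
  have "f p t = v p t + (\<Sum>q\<in>UNIV. delay_apply (?A $ p $ q) (f q) t)" for p t
    by (subst eq) (simp add: delay_matrix_def)
  from delay_iteration[of f v ?A, OF this, of p t N]
  have "f p t = (\<Sum>k<N. \<Sum>q\<in>UNIV. delay_apply (mat_pow ?A k $ p $ q) (v q) t)
    + (\<Sum>q\<in>UNIV. delay_apply (mat_pow ?A N $ p $ q) (f q) t)" .
  also have "(\<Sum>q\<in>UNIV. delay_apply (mat_pow ?A N $ p $ q) (f q) t) = 0"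
  proof (rule sum.neutral, rule ballI, rule delay_apply_eq_0)
    fix q \<tau> assume "\<tau> \<in> Poly_Mapping.keys (mat_pow ?A N $ p $ q)"
    then have "real N * l0 \<le> \<tau>" by (rule keys_mat_pow_delay_matrix_ge[OF l0(2)])
    then show "f q (t - \<tau>) = 0" using N by (intro neg) auto
  qed
  finally have "norm (f p t) \<le> (\<Sum>k<N. \<Sum>q\<in>UNIV. norm (delay_apply (mat_pow ?A k $ p $ q) (v q) t))"
    by (auto intro!: order_trans[OF norm_sum] sum_mono norm_sum)
  also have "\<dots> \<le> (\<Sum>k<N. \<Sum>q\<in>UNIV. pm_norm (mat_pow ?A k $ p $ q) * B)"
  proof (intro sum_mono norm_delay_apply_le v)
    \<comment> \<open>Causality: delays are nonnegative, so only values of \<open>v\<close> up to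
      time \<open>t\<close> enter.\<close>
    fix k q \<tau> assume "\<tau> \<in> Poly_Mapping.keys (mat_pow ?A k $ p $ q)"
    then have "real k * 0 \<le> \<tau>" by (rule keys_mat_pow_delay_matrix_ge[rotated]) (use l less_imp_le in blast)
    then show "t - \<tau> \<le> t" by simp
  qed
  also have "\<dots> = (\<Sum>q\<in>UNIV. \<Sum>k<N. pm_norm (mat_pow ?A k $ p $ q)) * B"
    by (subst sum.swap) (simp add: sum_distrib_right)
  also have "\<dots> \<le> (\<Sum>q\<in>UNIV. \<Sum>k. pm_norm (mat_pow ?A k $ p $ q)) * B"
    by (intro mult_right_mono sum_mono sum_le_suminf sum B0) auto
  finally show ?thesis .
qed


section \<open>Total variation norms of exponential polynomials\<close>

lemma tendsto_integral_bounded_mult: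
  fixes h :: "real \<Rightarrow> complex" and f :: "nat \<Rightarrow> real \<Rightarrow> real"
  assumes h: "integrable \<nu> h" and [measurable]: "\<And>j. f j \<in> borel_measurable \<nu>" "g \<in> borel_measurable \<nu>"
    and lim: "\<And>t. t \<in> space \<nu> \<Longrightarrow> (\<lambda>j. f j t) \<longlonglongrightarrow> g t"
    and bound: "\<And>j t. t \<in> space \<nu> \<Longrightarrow> \<bar>f j t\<bar> \<le> B"
  shows "(\<lambda>j. LINT t|\<nu>. of_real (f j t) * h t) \<longlonglongrightarrow> (LINT t|\<nu>. of_real (g t) * h t)"
proof (rule integral_dominated_convergence[where w = "\<lambda>t. B * norm (h t)"])
  have [measurable]: "h \<in> borel_measurable \<nu>" using h by auto
  show "(\<lambda>t. complex_of_real (g t) * h t) \<in> borel_measurable \<nu>" by simp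
  show "(\<lambda>t. complex_of_real (f j t) * h t) \<in> borel_measurable \<nu>" for j by simp
  show "integrable \<nu> (\<lambda>t. B * norm (h t))" using h by auto
  show "AE t in \<nu>. (\<lambda>j. complex_of_real (f j t) * h t) \<longlonglongrightarrow> complex_of_real (g t) * h t"
    by (intro AE_I2 tendsto_intros lim)
  show "AE t in \<nu>. norm (complex_of_real (f j t) * h t) \<le> B * norm (h t)" for j
    by (intro AE_I2) (auto simp: norm_mult bound intro!: mult_right_mono)
qed

lemma integrable_bounded_mult:
  fixes h :: "real \<Rightarrow> complex"
  assumes h: "integrable \<nu> h" and [measurable]: "f \<in> borel_measurable \<nu>"
    and bound: "\<And>t. t \<in> space \<nu> \<Longrightarrow> \<bar>f t\<bar> \<le> B"
  shows "integrable \<nu> (\<lambda>t. of_real (f t) * h t)"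
proof (rule Bochner_Integration.integrable_bound[of _ "\<lambda>t. B * norm (h t)"])
  have [measurable]: "h \<in> borel_measurable \<nu>" using h by auto
  show "(\<lambda>t. complex_of_real (f t) * h t) \<in> borel_measurable \<nu>" by simp
  show "integrable \<nu> (\<lambda>t. B * norm (h t))" using h by auto
  show "AE t in \<nu>. norm (complex_of_real (f t) * h t) \<le> norm (B * norm (h t))"
  proof (intro AE_I2)
    fix t assume "t \<in> space \<nu>"
    then have "\<bar>f t\<bar> \<le> \<bar>B\<bar>" using bound by force
    then show "norm (complex_of_real (f t) * h t) \<le> norm (B * norm (h t))"
      by (auto simp: norm_mult abs_mult intro!: mult_right_mono)
  qed
qed

text \<open>Substituting \<open>x = exp (-t)\<close>, equality of the Laplace transforms at large integers is equality of
  the moments of order at least \<open>N\<close> of two measures on \<open>[0,1]\<close>, so Weierstrass approximation applies.\<close>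

lemma laplace_moments_continuous:
  fixes h1 h2 :: "real \<Rightarrow> complex"
  assumes sets1: "sets \<nu>1 = sets halfline_borel" and h1: "integrable \<nu>1 h1"
    and sets2: "sets \<nu>2 = sets halfline_borel" and h2: "integrable \<nu>2 h2"
    and eq: "\<And>n. n \<ge> N \<Longrightarrow>
      (LINT t|\<nu>1. of_real (exp (- t) ^ n) * h1 t) = (LINT t|\<nu>2. of_real (exp (- t) ^ n) * h2 t)"
    and g: "continuous_on {0..1} (g :: real \<Rightarrow> real)"
  shows "(LINT t|\<nu>1. of_real (exp (- t) ^ N * g (exp (- t))) * h1 t) =
         (LINT t|\<nu>2. of_real (exp (- t) ^ N * g (exp (- t))) * h2 t)"
proof -
  have space: "space \<nu>1 = {0..}" "space \<nu>2 = {0..}"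
    using sets_eq_imp_space_eq[OF sets1] sets_eq_imp_space_eq[OF sets2] by (simp_all add: space_restrict_space)
  have meas: "f \<in> borel_measurable \<nu>1" "f \<in> borel_measurable \<nu>2" if "continuous_on {0..} f" for f :: "real \<Rightarrow> real"
    using borel_measurable_continuous_on_restrict[OF that]
    by (simp_all add: measurable_cong_sets[OF sets1] measurable_cong_sets[OF sets2])
  have exp01: "exp (- t) \<in> {0..1}" if "t \<ge> 0" for t :: real using that by simp
  have cont: "continuous_on {0..} (\<lambda>t. exp (- t) ^ N * f (exp (- t)))" if "continuous_on {0..1} f" for f :: "real \<Rightarrow> real"
    by (intro continuous_intros continuous_on_compose2[OF that]) (use exp01 in auto)
  have bounded: "\<exists>B. \<forall>t\<ge>0. \<bar>exp (- t) ^ N * f (exp (- t))\<bar> \<le> B" if "continuous_on {0..1} f" for f :: "real \<Rightarrow> real"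
  proof -
    obtain B where B: "\<forall>x\<in>{0..1}. \<bar>f x\<bar> \<le> B"
      using compact_continuous_image[OF \<open>continuous_on {0..1} f\<close>]
      by (auto dest!: compact_imp_bounded simp: bounded_iff)
    have "\<bar>exp (- t) ^ N * f (exp (- t))\<bar> \<le> 1 * B" if "t \<ge> 0" for t
      unfolding abs_mult using B exp01[OF that]
      by (intro mult_mono) (auto intro: power_le_one)
    then show ?thesis by auto
  qed
  have int: "integrable \<nu>1 (\<lambda>t. of_real (exp (- t) ^ N * f (exp (- t))) * h1 t)"
    "integrable \<nu>2 (\<lambda>t. of_real (exp (- t) ^ N * f (exp (- t))) * h2 t)" if f: "continuous_on {0..1} f" for f
  proof -
    obtain B where "\<forall>t\<ge>0. \<bar>exp (- t) ^ N * f (exp (- t))\<bar> \<le> B" using bounded[OF f] by blast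
    then have B: "\<bar>exp (- t) ^ N * f (exp (- t))\<bar> \<le> B" if "t \<in> {0..}" for t using that by blast
    show "integrable \<nu>1 (\<lambda>t. of_real (exp (- t) ^ N * f (exp (- t))) * h1 t)"
      by (rule integrable_bounded_mult[OF h1 meas(1)[OF cont[OF f]] B]) (simp add: space)
    show "integrable \<nu>2 (\<lambda>t. of_real (exp (- t) ^ N * f (exp (- t))) * h2 t)"
      by (rule integrable_bounded_mult[OF h2 meas(2)[OF cont[OF f]] B]) (simp add: space)
  qed
  \<comment> \<open>Linear on continuous functions, zero on polynomials, and bounded by the sup norm
    times the total mass \<open>C\<close>; hence zero by density.\<close>
  define D where "D f = (LINT t|\<nu>1. of_real (exp (- t) ^ N * f (exp (- t))) * h1 t) -
      (LINT t|\<nu>2. of_real (exp (- t) ^ N * f (exp (- t))) * h2 t)" for f :: "real \<Rightarrow> real"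
  have poly: "D f = 0" if poly_f: "real_polynomial_function f" for f
  proof -
    obtain c n where f: "f = (\<lambda>x. \<Sum>i\<le>n. c i * x ^ i)"
      using poly_f real_polynomial_function_iff_sum by blast
    have expand: "complex_of_real (exp (- t) ^ N * f (exp (- t))) * z =
        (\<Sum>i\<le>n. of_real (c i) * (of_real (exp (- t) ^ (N + i)) * z))" for t z
      by (simp add: f sum_distrib_left sum_distrib_right power_add mult_ac)
    have "continuous_on {0..1} (\<lambda>x::real. x ^ i)" for i by (intro continuous_intros)
    then have "integrable \<nu>1 (\<lambda>t. of_real (exp (- t) ^ (N + i)) * h1 t)"
      "integrable \<nu>2 (\<lambda>t. of_real (exp (- t) ^ (N + i)) * h2 t)" for i
      using int[of "\<lambda>x. x ^ i"] by (simp_all add: power_add)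
    then show ?thesis
      unfolding D_def expand
      by (subst (1 2) Bochner_Integration.integral_sum) (auto simp del: of_real_power simp: eq)
  qed
  define C where "C = (LINT t|\<nu>1. norm (h1 t)) + (LINT t|\<nu>2. norm (h2 t))"
  have C0: "0 \<le> C" by (auto simp: C_def)
  have "norm (D g) \<le> e" if "e > 0" for e
  proof -
    \<comment> \<open>The \<open>+ 1\<close> avoids division by zero.\<close>
    define e' where "e' = e / (C + 1)"
    have e': "e' > 0" using that C0 by (simp add: e'_def)
    obtain f where f: "real_polynomial_function f" "\<And>x. x \<in> {0..1} \<Longrightarrow> \<bar>g x - f x\<bar> < e'"
      using Stone_Weierstrass_real_polynomial_function[OF compact_Icc g e'] by blast
    have fc: "continuous_on {0..1} f"
      using f(1) unfolding real_polynomial_function_iff_sum by (auto intro!: continuous_intros)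
    have b: "\<bar>exp (- t) ^ N * (g (exp (- t)) - f (exp (- t)))\<bar> \<le> e'" if "t \<ge> 0" for t
    proof -
      have "\<bar>exp (- t) ^ N * (g (exp (- t)) - f (exp (- t)))\<bar> \<le> 1 * e'"
        unfolding abs_mult using f(2)[OF exp01[OF that]] that
        by (intro mult_mono) (auto intro: power_le_one)
      then show ?thesis by simp
    qed
    have gf: "continuous_on {0..1} (\<lambda>x. g x - f x)" by (intro continuous_intros g fc)
    have n1: "norm (LINT t|\<nu>1. of_real (exp (- t) ^ N * (g (exp (- t)) - f (exp (- t)))) * h1 t) \<le> (LINT t|\<nu>1. e' * norm (h1 t))"
      by (intro Bochner_Integration.integral_norm_bound_integral int(1)[OF gf])
        (use h1 b space in \<open>auto simp: norm_mult simp del: of_real_mult intro!: mult_right_mono\<close>)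
    have n2: "norm (LINT t|\<nu>2. of_real (exp (- t) ^ N * (g (exp (- t)) - f (exp (- t)))) * h2 t) \<le> (LINT t|\<nu>2. e' * norm (h2 t))"
      by (intro Bochner_Integration.integral_norm_bound_integral int(2)[OF gf])
        (use h2 b space in \<open>auto simp: norm_mult simp del: of_real_mult intro!: mult_right_mono\<close>)
    have "D g = D g - D f" using poly[OF f(1)] by simp
    also have "\<dots> = D (\<lambda>x. g x - f x)"
      using int[OF g] int[OF fc] by (simp add: D_def algebra_simps)
    finally have "norm (D g) \<le> e' * C"
      using norm_triangle_ineq4[of "LINT t|\<nu>1. of_real (exp (- t) ^ N * (g (exp (- t)) - f (exp (- t)))) * h1 t"
         "LINT t|\<nu>2. of_real (exp (- t) ^ N * (g (exp (- t)) - f (exp (- t)))) * h2 t"] n1 n2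
      by (simp add: D_def C_def distrib_left)
    also have "\<dots> \<le> e" using that C0 by (simp add: e'_def field_simps)
    finally show ?thesis .
  qed
  then have "norm (D g) \<le> 0" by (rule field_le_epsilon[where y = 0, simplified]) 
  then show ?thesis by (simp add: D_def)
qed

text \<open>Since \<open>t \<le> c\<close> iff \<open>exp (- t) \<ge> exp (- c)\<close>, the
  indicator is a bounded pointwise limit of continuous functions of \<open>exp (- t)\<close> that
  carry the weight \<open>exp (- t) ^ N\<close>; dominated convergence transfers the
  equality.\<close>

lemma laplace_unique_Icc:
  fixes h1 h2 :: "real \<Rightarrow> complex"
  assumes sets1: "sets \<nu>1 = sets halfline_borel" and h1: "integrable \<nu>1 h1"
    and sets2: "sets \<nu>2 = sets halfline_borel" and h2: "integrable \<nu>2 h2"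
    and eq: "\<And>n. n \<ge> N \<Longrightarrow>
      (LINT t|\<nu>1. of_real (exp (- t) ^ n) * h1 t) = (LINT t|\<nu>2. of_real (exp (- t) ^ n) * h2 t)"
  shows "(LINT t|\<nu>1. of_real (indicator {..c} t) * h1 t) = (LINT t|\<nu>2. of_real (indicator {..c} t) * h2 t)"
proof -
  define d where "d = exp (- c)"
  have d: "d > 0" by (simp add: d_def)
  \<comment> \<open>A ramp that is 1 for \<open>x \<ge> d\<close> and eventually 0 for
    \<open>x < d\<close>, divided by the weight. Using \<open>max x d\<close> in the denominator
    removes the singularity at 0 and agrees with \<open>x\<close> where the ramp survives in the
    limit.\<close>
  define g where "g j x = max 0 (min 1 (1 + real j * (x - d))) / (max x d) ^ N" for j and x :: real
  define f where "f j t = exp (- t) ^ N * g j (exp (- t))" for j t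
  have cont: "continuous_on A (g j)" for j A
    unfolding g_def by (intro continuous_intros) (use d in auto)
  have fm: "f j \<in> borel_measurable borel" for j
    unfolding f_def by (intro borel_measurable_continuous_onI continuous_intros continuous_on_compose2[OF cont]) auto
  then have fm: "f j \<in> borel_measurable \<nu>1" "f j \<in> borel_measurable \<nu>2" for j
    by (simp_all add: measurable_cong_sets[OF sets1] measurable_cong_sets[OF sets2] measurable_restrict_space1)
  have im: "indicator {..c} \<in> borel_measurable \<nu>1" "indicator {..c} \<in> borel_measurable \<nu>2"
    by (simp_all add: measurable_cong_sets[OF sets1] measurable_cong_sets[OF sets2] measurable_restrict_space1)
  have b: "\<bar>f j t\<bar> \<le> 1" for j t
  proof -
    have "exp (- t) ^ N \<le> max (exp (- t)) d ^ N" by (intro power_mono) auto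
    moreover have "0 < max (exp (- t)) d ^ N" using d by (intro zero_less_power) auto
    ultimately have "\<bar>exp (- t) ^ N / max (exp (- t)) d ^ N\<bar> \<le> 1"
      by (subst abs_of_nonneg) (auto simp: divide_le_eq intro!: divide_nonneg_pos)
    then have "\<bar>exp (- t) ^ N / max (exp (- t)) d ^ N\<bar> * \<bar>max 0 (min 1 (1 + real j * (exp (- t) - d)))\<bar> \<le> 1 * 1"
      by (intro mult_mono) auto
    then show ?thesis by (simp add: f_def g_def abs_mult[symmetric])
  qed
  have lim: "(\<lambda>j. f j t) \<longlonglongrightarrow> indicator {..c} t" for t
  proof (cases "t \<le> c")
    case True
    then have "exp (- t) \<ge> d" by (simp add: d_def)
    then have "f j t = 1" for j by (simp add: f_def g_def max_def min_def)
    then show ?thesis using True by simp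
  next
    case False
    then have less: "exp (- t) < d" by (simp add: d_def)
    obtain J :: nat where J: "real J * (d - exp (- t)) > 1"
      using reals_Archimedean3[of "d - exp (- t)"] less by auto
    have "f j t = 0" if "j \<ge> J" for j
    proof -
      have "real J * (d - exp (- t)) \<le> real j * (d - exp (- t))"
        using that less by (intro mult_right_mono) auto
      then have "1 + real j * (exp (- t) - d) \<le> 0" using J by (simp add: algebra_simps)
      then show ?thesis by (simp add: f_def g_def max_def min_def)
    qed
    then have "eventually (\<lambda>j. f j t = indicator {..c} t) sequentially"
      using False by (auto simp: eventually_sequentially indicator_def)
    then show ?thesis by (rule tendsto_eventually)
  qed
  have "(LINT t|\<nu>1. of_real (f j t) * h1 t) = (LINT t|\<nu>2. of_real (f j t) * h2 t)" for j
    unfolding f_def by (rule laplace_moments_continuous[OF sets1 h1 sets2 h2 eq cont])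
  moreover have "(\<lambda>j. LINT t|\<nu>1. of_real (f j t) * h1 t) \<longlonglongrightarrow> (LINT t|\<nu>1. of_real (indicator {..c} t) * h1 t)"
    by (intro tendsto_integral_bounded_mult[where B = 1] h1 fm im lim b)
  moreover have "(\<lambda>j. LINT t|\<nu>2. of_real (f j t) * h2 t) \<longlonglongrightarrow> (LINT t|\<nu>2. of_real (indicator {..c} t) * h2 t)"
    by (intro tendsto_integral_bounded_mult[where B = 1] h2 fm im lim b)
  ultimately show ?thesis using LIMSEQ_unique by simp
qed

text \<open>Makes the \<open>THE\<close> in \<open>M_norm\<close> meaningful. The transforms at
  large integers determine the values on the sets \<open>{..c}\<close>, which form a generator of
  the Borel sets stable under intersection; as the measures are complex, the Dynkin argument is run
  directly on countable additivity.\<close>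

lemma inverse_laplace_unique:
  assumes "inverse_laplace F \<mu>1" "inverse_laplace F \<mu>2"
  shows "\<mu>1 = \<mu>2"
proof -
  obtain \<nu>1 h1 \<sigma>1 where 1: "complex_borel_measure \<mu>1" "sets \<nu>1 = sets halfline_borel" "integrable \<nu>1 h1"
    "\<And>E. E \<in> sets halfline_borel \<Longrightarrow> \<mu>1 E = (LINT t:E|\<nu>1. h1 t)"
    "\<And>s. \<sigma>1 < Re s \<Longrightarrow> F s = (LINT t|\<nu>1. exp (- s * of_real t) * h1 t)"
    using assms(1) unfolding inverse_laplace_def by blast
  obtain \<nu>2 h2 \<sigma>2 where 2: "complex_borel_measure \<mu>2" "sets \<nu>2 = sets halfline_borel" "integrable \<nu>2 h2"
    "\<And>E. E \<in> sets halfline_borel \<Longrightarrow> \<mu>2 E = (LINT t:E|\<nu>2. h2 t)"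
    "\<And>s. \<sigma>2 < Re s \<Longrightarrow> F s = (LINT t|\<nu>2. exp (- s * of_real t) * h2 t)"
    using assms(2) unfolding inverse_laplace_def by blast
  have space: "space \<nu>1 = {0..}" "space \<nu>2 = {0..}"
    using sets_eq_imp_space_eq[OF 1(2)] sets_eq_imp_space_eq[OF 2(2)] by (simp_all add: space_restrict_space)
  \<comment> \<open>Both integral representations are available only to the right of both
    abscissae.\<close>
  obtain N :: nat where N: "real N > max \<sigma>1 \<sigma>2" using reals_Archimedean2 by blast
  have exp: "exp (- complex_of_real (real n) * complex_of_real t) = of_real (exp (- t) ^ n)" for n t
    by (simp add: exp_of_nat_mult[symmetric] exp_of_real[symmetric])
  have mom: "(LINT t|\<nu>1. of_real (exp (- t) ^ n) * h1 t) = (LINT t|\<nu>2. of_real (exp (- t) ^ n) * h2 t)" if "n \<ge> N" for n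
  proof -
    have "real n > max \<sigma>1 \<sigma>2" using N that by linarith
    then show ?thesis
      using 1(5)[of "of_real (real n)"] 2(5)[of "of_real (real n)"] unfolding exp by simp
  qed
  note Icc = laplace_unique_Icc[OF 1(2,3) 2(2,3) mom]
  have mu: "\<mu>1 (E \<inter> {0..}) = (LINT t|\<nu>1. of_real (indicator E t) * h1 t)"
    "\<mu>2 (E \<inter> {0..}) = (LINT t|\<nu>2. of_real (indicator E t) * h2 t)" if "E \<in> sets borel" for E
  proof -
    have E: "E \<inter> {0..} \<in> sets halfline_borel" using that by (auto simp: sets_restrict_space)
    show "\<mu>1 (E \<inter> {0..}) = (LINT t|\<nu>1. of_real (indicator E t) * h1 t)"
      unfolding 1(4)[OF E] set_lebesgue_integral_def
      by (intro Bochner_Integration.integral_cong) (auto simp: space indicator_def)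
    show "\<mu>2 (E \<inter> {0..}) = (LINT t|\<nu>2. of_real (indicator E t) * h2 t)"
      unfolding 2(4)[OF E] set_lebesgue_integral_def
      by (intro Bochner_Integration.integral_cong) (auto simp: space indicator_def)
  qed
  \<comment> \<open>Exhausting the half-line gives equal total mass, which the step for complements
    requires.\<close>
  have lim: "(\<lambda>j. indicator {..real j} t) \<longlonglongrightarrow> (1::real)" for t
  proof (rule tendsto_eventually)
    obtain J :: nat where "t \<le> real J" using real_arch_simple by blast
    then show "\<forall>\<^sub>F j in sequentially. indicator {..real j} t = (1::real)"
      unfolding eventually_sequentially by (intro exI[of _ J]) (auto simp: indicator_def)
  qed
  have im: "indicator {..real j} \<in> borel_measurable \<nu>1" "indicator {..real j} \<in> borel_measurable \<nu>2" for j
    by (simp_all add: measurable_cong_sets[OF 1(2)] measurable_cong_sets[OF 2(2)] measurable_restrict_space1)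
  have l1: "(\<lambda>j. LINT t|\<nu>1. of_real (indicator {..real j} t) * h1 t) \<longlonglongrightarrow> (LINT t|\<nu>1. of_real 1 * h1 t)"
    by (intro tendsto_integral_bounded_mult[where B = 1] 1(3) im lim) (auto simp: indicator_def)
  have l2: "(\<lambda>j. LINT t|\<nu>2. of_real (indicator {..real j} t) * h2 t) \<longlonglongrightarrow> (LINT t|\<nu>2. of_real 1 * h2 t)"
    by (intro tendsto_integral_bounded_mult[where B = 1] 2(3) im lim) (auto simp: indicator_def)
  have total: "\<mu>1 {0..} = \<mu>2 {0..}"
    using mu[of UNIV] LIMSEQ_unique[OF l1, of "LINT t|\<nu>2. of_real 1 * h2 t"] l2 Icc by simp
  have sums1: "(\<lambda>i. \<mu>1 (A i \<inter> {0..})) sums \<mu>1 ((\<Union>i. A i) \<inter> {0..})"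
    and sums2: "(\<lambda>i. \<mu>2 (A i \<inter> {0..})) sums \<mu>2 ((\<Union>i. A i) \<inter> {0..})"
    if "range A \<subseteq> sets borel" "disjoint_family A" for A :: "nat \<Rightarrow> real set"
  proof -
    have "range (\<lambda>i. A i \<inter> {0..}) \<subseteq> sets halfline_borel" using that by (auto simp: sets_restrict_space)
    moreover have "disjoint_family (\<lambda>i. A i \<inter> {0..})" using that(2) by (auto simp: disjoint_family_on_def)
    ultimately have "(\<lambda>i. \<mu>1 (A i \<inter> {0..})) sums \<mu>1 (\<Union>i. A i \<inter> {0..})"
      "(\<lambda>i. \<mu>2 (A i \<inter> {0..})) sums \<mu>2 (\<Union>i. A i \<inter> {0..})"
      using 1(1) 2(1) unfolding complex_borel_measure_def by blast+
    then show "(\<lambda>i. \<mu>1 (A i \<inter> {0..})) sums \<mu>1 ((\<Union>i. A i) \<inter> {0..})"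
      "(\<lambda>i. \<mu>2 (A i \<inter> {0..})) sums \<mu>2 ((\<Union>i. A i) \<inter> {0..})"
      by simp_all
  qed
  have borel: "sets borel = sigma_sets UNIV (range (atMost :: real \<Rightarrow> real set))"
    by (subst borel_eq_atMost) (simp add: sets_measure_of)
  have on_borel: "\<mu>1 (E \<inter> {0..}) = \<mu>2 (E \<inter> {0..})" if "E \<in> sets borel" for E
  proof -
    have "Int_stable (range (atMost :: real \<Rightarrow> real set))"
      by (auto simp: Int_stable_def Int_atMost)
    moreover have "range atMost \<subseteq> Pow (UNIV :: real set)" by simp
    moreover have "E \<in> sigma_sets UNIV (range atMost)" using that borel by simp
    ultimately show ?thesis
    proof (induction rule: sigma_sets_induct_disjoint)
      case (basic A)
      then show ?case using mu Icc by auto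
    next
      case empty
      then show ?case using mu[of "{}"] by simp
    next
      case (compl A)
      have A: "A \<in> sets borel" using compl borel by simp
      \<comment> \<open>Additivity for a set and its complement is read off countable additivity by
        padding with empty sets.\<close>
      define B where "B i = (if i = 0 then A else if i = 1 then - A else {})" for i :: nat
      have B: "range B \<subseteq> sets borel" "disjoint_family B" "(\<Union>i. B i) = UNIV"
        using A by (auto simp: B_def disjoint_family_on_def split: if_splits)
      have fin: "(\<lambda>i. \<mu> (B i \<inter> {0..})) sums (\<mu> (A \<inter> {0..}) + \<mu> (- A \<inter> {0..}))" if "\<mu> {} = (0::complex)" for \<mu>
        using sums_finite[of "{0, 1}" "\<lambda>i. \<mu> (B i \<inter> {0..})"] that by (auto simp: B_def)
      have "\<mu>1 {} = 0" "\<mu>2 {} = 0" using mu[of "{}"] by simp_all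
      then have "\<mu>1 {0..} = \<mu>1 (A \<inter> {0..}) + \<mu>1 (- A \<inter> {0..})" "\<mu>2 {0..} = \<mu>2 (A \<inter> {0..}) + \<mu>2 (- A \<inter> {0..})"
        using sums_unique2[OF sums1[OF B(1,2)] fin] sums_unique2[OF sums2[OF B(1,2)] fin] B(3) by simp_all
      then show ?case using compl total by (simp add: Compl_eq_Diff_UNIV[symmetric])
    next
      case (union A)
      then have "range A \<subseteq> sets borel" using borel by blast
      then show ?case
        using sums_unique2[OF sums1, of A] sums2[of A] union by simp
    qed
  qed
  show ?thesis
  proof
    fix E
    show "\<mu>1 E = \<mu>2 E"
    proof (cases "E \<in> sets halfline_borel")
      case True
      then have "E \<in> sets borel" "E \<subseteq> {0..}" by (auto simp: sets_restrict_space)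
      then show ?thesis using on_borel[of E] by (simp add: Int_absorb2)
    next
      case False
      then show ?thesis using 1(1) 2(1) by (simp add: complex_borel_measure_def)
    qed
  qed
qed

section \<open>Finitely supported measures and their total variation\<close>

definition atomic_measure :: "(real \<Rightarrow>\<^sub>0 'k::rc_field) \<Rightarrow> real set \<Rightarrow> complex" where
  "atomic_measure p E = (if E \<in> sets halfline_borel
     then \<Sum>\<tau>\<in>Poly_Mapping.keys p. indicator E \<tau> * to_complex (Poly_Mapping.lookup p \<tau>) else 0)"

lemma complex_borel_measure_atomic: "complex_borel_measure (atomic_measure p)"
  unfolding complex_borel_measure_def
proof (intro conjI allI impI)
  fix A :: "nat \<Rightarrow> real set"
  assume A: "range A \<subseteq> sets halfline_borel \<and> disjoint_family A"
  have ind: "(\<lambda>i. indicator (A i) \<tau>) sums (indicator (\<Union>i. A i) \<tau> :: complex)" for \<tau>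
  proof (cases "\<exists>i. \<tau> \<in> A i")
    case True
    then obtain i where i: "\<tau> \<in> A i" by blast
    then have "\<tau> \<notin> A j" if "j \<noteq> i" for j using A that by (auto simp: disjoint_family_on_def)
    then show ?thesis
      using sums_finite[of "{i}" "\<lambda>i. indicator (A i) \<tau> :: complex"] i by (auto simp: indicator_def)
  next
    case False
    then show ?thesis by simp
  qed
  have "(\<Union>i. A i) \<in> sets halfline_borel" using A by (intro sets.countable_UN) auto
  moreover have "A i \<in> sets halfline_borel" for i using A by auto
  ultimately show "(\<lambda>i. atomic_measure p (A i)) sums atomic_measure p (\<Union>i. A i)"
    unfolding atomic_measure_def by (simp only: if_True) (intro sums_sum sums_mult2 ind)
qed (simp add: atomic_measure_def)

text \<open>The positive measure \<open>\<nu>\<close> counts the keys on the half-line, and the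
  coefficients are the density with respect to it.\<close>

lemma inverse_laplace_atomic:
  fixes p :: "real \<Rightarrow>\<^sub>0 'k::rc_field"
  assumes keys: "Poly_Mapping.keys p \<subseteq> {0..}"
  shows "inverse_laplace (\<lambda>s. pm_laplace s p) (atomic_measure p)"
proof -
  let ?K = "Poly_Mapping.keys p"
  define \<nu> where "\<nu> = distr (count_space ?K) halfline_borel (\<lambda>x. x)"
  define h where "h \<tau> = to_complex (Poly_Mapping.lookup p \<tau>)" for \<tau>
  have id: "(\<lambda>x. x) \<in> measurable (count_space ?K) halfline_borel"
    using keys by (auto simp: space_restrict_space)
  have sets: "sets \<nu> = sets halfline_borel" by (simp add: \<nu>_def)
  have "finite_measure (count_space ?K)" by (simp add: finite_measure_count_space)
  then have fin: "finite_measure \<nu>" unfolding \<nu>_def by (rule finite_measure.finite_measure_distr[OF _ id])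
  \<comment> \<open>A finite combination of indicators of points, which exhibits \<open>h\<close> as
    measurable.\<close>
  have h_eq: "h = (\<lambda>t. \<Sum>\<tau>\<in>?K. indicator {\<tau>} t * h \<tau>)"
  proof
    fix t
    show "h t = (\<Sum>\<tau>\<in>?K. indicator {\<tau>} t * h \<tau>)"
      by (cases "t \<in> ?K") (auto simp: h_def indicator_def of_bool_def in_keys_iff if_distrib[of "\<lambda>x. x * _"] sum.delta cong: if_cong)
  qed
  have "(\<lambda>t. \<Sum>\<tau>\<in>?K. indicator {\<tau>} t * h \<tau>) \<in> borel_measurable borel" by measurable
  then have hm: "h \<in> borel_measurable halfline_borel" by (subst h_eq) (rule measurable_restrict_space1)
  have int: "(LINT t|\<nu>. f t * h t) = (\<Sum>\<tau>\<in>?K. f \<tau> * h \<tau>)" if "f \<in> borel_measurable halfline_borel" for f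
    unfolding \<nu>_def by (subst integral_distr[OF id]) (use that hm in \<open>auto simp: lebesgue_integral_count_space_finite\<close>)
  show ?thesis unfolding inverse_laplace_def
  proof (intro conjI exI ballI allI impI)
    show "complex_borel_measure (atomic_measure p)" by (rule complex_borel_measure_atomic)
    show "finite_measure \<nu>" by (rule fin)
    show "sets \<nu> = sets halfline_borel" by (rule sets)
    show "integrable \<nu> h" unfolding \<nu>_def
      by (subst integrable_distr_eq[OF id hm]) (simp add: integrable_count_space)
    fix E assume E: "E \<in> sets halfline_borel"
    then have "indicator E \<in> borel_measurable halfline_borel" by simp
    then show "atomic_measure p E = (LINT t:E|\<nu>. h t)"
      using int[of "indicator E"] E
      by (simp add: atomic_measure_def set_lebesgue_integral_def scaleR_conv_of_real h_def of_real_indicator)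
  next
    fix s :: complex assume "0 < Re s"
    have "(\<lambda>t. exp (- s * complex_of_real t)) \<in> borel_measurable halfline_borel"
      by (rule measurable_restrict_space1) measurable
    from int[OF this] show "pm_laplace s p = (LINT t|\<nu>. exp (- s * complex_of_real t) * h t)"
      by (simp add: pm_laplace_def pm_sum_def h_def)
  qed
qed

text \<open>The upper bound is the triangle inequality within each block, as every atom lies in
  exactly one block; the partition into the single atoms and the rest attains it.\<close>

lemma total_variation_atomic:
  fixes p :: "real \<Rightarrow>\<^sub>0 'k::rc_field"
  assumes keys: "Poly_Mapping.keys p \<subseteq> {0..}"
  shows "total_variation (atomic_measure p) = ennreal (pm_norm p)"
proof (rule antisym)
  let ?K = "Poly_Mapping.keys p" and ?c = "\<lambda>\<tau>. norm (Poly_Mapping.lookup p \<tau>)"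
  show "total_variation (atomic_measure p) \<le> ennreal (pm_norm p)"
    unfolding total_variation_def
  proof (rule SUP_least)
    fix P assume "P \<in> {P. finite P \<and> P \<subseteq> sets halfline_borel \<and> partition_on {0..} P}"
    then have P: "finite P" "P \<subseteq> sets halfline_borel" "partition_on {0..} P" by blast+
    have one: "(\<Sum>E\<in>P. indicator E \<tau>) = (1::real)" if "\<tau> \<in> ?K" for \<tau>
    proof -
      have "\<tau> \<in> \<Union> P" using that keys partition_onD1[OF P(3)] by auto
      then obtain E where E: "E \<in> P" "\<tau> \<in> E" by blast
      have "indicator E' \<tau> = (if E' = E then 1 else 0 :: real)" if "E' \<in> P" for E'
        using partition_onD2[OF P(3)] that E by (cases "E' = E") (auto simp: disjoint_def indicator_def)
      then show ?thesis using E P(1) by simp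
    qed
    have "(\<Sum>E\<in>P. norm (atomic_measure p E)) \<le> (\<Sum>E\<in>P. \<Sum>\<tau>\<in>?K. indicator E \<tau> * ?c \<tau>)"
    proof (rule sum_mono)
      fix E assume "E \<in> P"
      then have "E \<in> sets halfline_borel" using P by auto
      then show "norm (atomic_measure p E) \<le> (\<Sum>\<tau>\<in>?K. indicator E \<tau> * ?c \<tau>)"
        unfolding atomic_measure_def
        by (auto intro!: order_trans[OF norm_sum] sum_mono simp: norm_mult norm_to_complex indicator_def)
    qed
    also have "\<dots> = (\<Sum>\<tau>\<in>?K. (\<Sum>E\<in>P. indicator E \<tau>) * ?c \<tau>)"
      by (subst sum.swap) (simp add: sum_distrib_right)
    also have "\<dots> = pm_norm p" using one by (simp add: pm_norm_def pm_sum_def)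
    finally show "(\<Sum>E\<in>P. ennreal (norm (atomic_measure p E))) \<le> ennreal (pm_norm p)"
      by (simp add: sum_ennreal ennreal_leI)
  qed
  \<comment> \<open>\<open>partition_on\<close> forbids empty blocks, so the rest must be nonempty;
    it is, since the half-line is infinite.\<close>
  define R where "R = {0..} - ?K"
  define P where "P = insert R ((\<lambda>\<tau>. {\<tau>}) ` ?K)"
  have "infinite ({0..} :: real set)" by (rule infinite_Ici)
  then have "infinite R" unfolding R_def by (intro Diff_infinite_finite) auto
  then have R: "R \<noteq> {}" by auto
  have "finite P" by (simp add: P_def)
  moreover have "P \<subseteq> sets halfline_borel"
  proof -
    have "?K \<in> sets borel" by (intro borel_closed finite_imp_closed) simp
    then show ?thesis using keys by (auto simp: P_def R_def sets_restrict_space_iff)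
  qed
  moreover have "partition_on {0..} P"
    using keys R by (auto simp: P_def R_def partition_on_def disjoint_def)
  ultimately have "(\<Sum>E\<in>P. ennreal (norm (atomic_measure p E))) \<le> total_variation (atomic_measure p)"
    unfolding total_variation_def by (intro SUP_upper) auto
  moreover have "(\<Sum>E\<in>(\<lambda>\<tau>. {\<tau>}) ` ?K. ennreal (norm (atomic_measure p E))) \<le> (\<Sum>E\<in>P. ennreal (norm (atomic_measure p E)))"
    by (rule sum_mono2) (auto simp: P_def)
  moreover have "(\<Sum>E\<in>(\<lambda>\<tau>. {\<tau>}) ` ?K. ennreal (norm (atomic_measure p E))) = ennreal (pm_norm p)"
  proof -
    have "{\<tau>} \<in> sets halfline_borel" if "\<tau> \<in> ?K" for \<tau> using that keys by (auto simp: sets_restrict_space_iff)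
    then have "norm (atomic_measure p {\<tau>}) = ?c \<tau>" if "\<tau> \<in> ?K" for \<tau>
      using that by (simp add: atomic_measure_def indicator_def of_bool_def if_distrib[of "\<lambda>x. x * _"] norm_to_complex sum.delta cong: if_cong)
    then show ?thesis
      by (simp add: sum.reindex pm_norm_def pm_sum_def sum_ennreal)
  qed
  ultimately show "ennreal (pm_norm p) \<le> total_variation (atomic_measure p)" by auto
qed

lemma M_norm_pm_laplace:
  assumes "Poly_Mapping.keys p \<subseteq> {0..}"
  shows "M_norm (\<lambda>s. pm_laplace s p) = ennreal (pm_norm p)"
proof -
  have "(THE \<mu>. inverse_laplace (\<lambda>s. pm_laplace s p) \<mu>) = atomic_measure p"
    using inverse_laplace_atomic[OF assms] inverse_laplace_unique by blast
  then show ?thesis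
    using inverse_laplace_atomic[OF assms] total_variation_atomic[OF assms] by (auto simp: M_norm_def)
qed

lemma M_norm_mat_pow_MU:
  assumes "\<And>k. 0 \<le> travel_time a b HD k"
  shows "M_norm (\<lambda>s. mat_pow (MU a b HD M s) k $ p $ q) =
    ennreal (pm_norm (mat_pow (delay_matrix (travel_time a b HD) M) k $ p $ q))"
  unfolding mat_pow_MU_eq_laplace
  by (rule M_norm_pm_laplace) (use keys_mat_pow_delay_matrix_ge[where ?l0.0 = 0, OF assms] in force)


section \<open>The transport equation\<close>

text \<open>Bridges the gauge integral, in which traces and travel times are stated, and the
  Lebesgue integral, in which Fubini and the norm of X are stated.\<close>

lemma integral_lebesgue_on_eq:
  fixes f :: "real \<Rightarrow> 'a::euclidean_space"
  assumes "integrable (lebesgue_on {a..b}) f" "(f has_integral I) {a..b}"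
  shows "(LINT \<xi>|lebesgue_on {a..b}. f \<xi>) = I"
  using has_integral_integral_lebesgue_on[OF assms(1)] assms(2)
  by (intro has_integral_unique[where f = f and i = "{a..b}"]) auto

lemma integrable_bounded_bilinear_continuous:
  fixes prod :: "'a::euclidean_space \<Rightarrow> 'b::euclidean_space \<Rightarrow> 'c::euclidean_space"
  assumes bb: "bounded_bilinear prod"
    and \<phi>: "continuous_on {a..b::real} \<phi>" and v: "integrable (lebesgue_on {a..b}) v"
  shows "integrable (lebesgue_on {a..b}) (\<lambda>\<xi>. prod (\<phi> \<xi>) (v \<xi>))"
proof -
  interpret bounded_bilinear prod by (rule bb)
  obtain K where K: "K > 0" "\<And>x y. norm (prod x y) \<le> norm x * norm y * K" using pos_bounded by blast
  obtain B where B: "\<And>\<xi>. \<xi> \<in> {a..b} \<Longrightarrow> norm (\<phi> \<xi>) \<le> B"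
    using compact_imp_bounded[OF compact_continuous_image[OF \<phi> compact_Icc]] unfolding bounded_iff by blast
  have \<phi>m: "\<phi> \<in> borel_measurable (lebesgue_on {a..b})"
    by (intro continuous_imp_measurable_on_sets_lebesgue \<phi>) auto
  have "(\<lambda>\<xi>. prod (\<phi> \<xi>) (v \<xi>)) \<in> borel_measurable (lebesgue_on {a..b})"
    by (rule borel_measurable_continuous_Pair[OF \<phi>m borel_measurable_integrable[OF v]])
      (intro continuous_on continuous_on_fst continuous_on_snd continuous_on_id)
  then show ?thesis
  proof (rule measurable_bounded_by_integrable_imp_lebesgue_integrable)
    show "integrable (lebesgue_on {a..b}) (\<lambda>\<xi>. (B * K) * norm (v \<xi>))" using v by auto
    show "norm (prod (\<phi> \<xi>) (v \<xi>)) \<le> (B * K) * norm (v \<xi>)" if "\<xi> \<in> {a..b}" for \<xi>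
    proof -
      have "norm (\<phi> \<xi>) * (norm (v \<xi>) * K) \<le> B * (norm (v \<xi>) * K)"
        using B[OF that] K(1) by (intro mult_right_mono) auto
      then show ?thesis using K(2)[of "\<phi> \<xi>" "v \<xi>"] by (simp add: mult_ac)
    qed
  qed auto
qed

text \<open>The function \<open>g\<close> is only absolutely continuous. The identity is Fubini's theorem for
  \<open>prod (\<phi>' \<eta>) (v \<xi>)\<close> on the triangle \<open>a \<le> \<xi> \<le> \<eta> \<le> b\<close>.\<close>

lemma integration_by_parts_absolutely_continuous:
  fixes prod :: "'a::euclidean_space \<Rightarrow> 'b::euclidean_space \<Rightarrow> 'c::euclidean_space"
  assumes bb: "bounded_bilinear prod" and ab: "a \<le> b"
    and \<phi>: "\<And>\<xi>. \<xi> \<in> {a..b} \<Longrightarrow> (\<phi> has_vector_derivative \<phi>' \<xi>) (at \<xi> within {a..b})"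
    and \<phi>': "continuous_on {a..b} \<phi>'"
    and v: "integrable (lebesgue_on {a..b}) v"
    and g: "\<And>\<xi>. \<xi> \<in> {a..b} \<Longrightarrow> (v has_integral (g \<xi> - g a)) {a..\<xi>}"
  shows "((\<lambda>\<xi>. prod (\<phi>' \<xi>) (g \<xi>) + prod (\<phi> \<xi>) (v \<xi>)) has_integral
           (prod (\<phi> b) (g b) - prod (\<phi> a) (g a))) {a..b}"
proof -
  let ?M = "lebesgue_on {a..b}"
  interpret bounded_bilinear prod by (rule bb)
  interpret M: finite_measure ?M by (rule finite_measure_lebesgue_on) auto
  interpret pair_sigma_finite ?M ?M ..
  have \<phi>c: "continuous_on {a..b} \<phi>"
    using \<phi> by (meson continuous_on_eq_continuous_within has_vector_derivative_continuous)
  have gc: "continuous_on {a..b} g"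
  proof -
    have "v integrable_on {a..b}" using g[of b] ab by auto
    then have "continuous_on {a..b} (\<lambda>x. g a + integral {a..x} v)"
      by (intro continuous_intros indefinite_integral_continuous_1)
    moreover have "g a + integral {a..x} v = g x" if "x \<in> {a..b}" for x
      using integral_unique[OF g[OF that]] by simp
    ultimately show ?thesis by (rule continuous_on_eq)
  qed
  have \<phi>'i: "integrable ?M \<phi>'" using \<phi>' by (rule continuous_imp_integrable_real)
  have gi: "integrable ?M g" using gc by (rule continuous_imp_integrable_real)
  \<comment> \<open>Extended by zero from the triangle to the square, so that the product measure
    applies.\<close>
  define f where "f \<xi> \<eta> = (if \<xi> \<le> \<eta> then prod (\<phi>' \<eta>) (v \<xi>) else 0)" for \<xi> \<eta>
  have m[measurable]: "\<phi>' \<in> borel_measurable ?M" "v \<in> borel_measurable ?M"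
    using \<phi>'i v by auto
  have m_id: "(\<lambda>x. x) \<in> borel_measurable ?M"
    by (intro continuous_imp_measurable_on_sets_lebesgue continuous_on_id) auto
  have pm: "(\<lambda>x. prod (\<phi>' (snd x)) (v (fst x))) \<in> borel_measurable (?M \<Otimes>\<^sub>M ?M)"
    by (rule borel_measurable_continuous_Pair[OF measurable_compose[OF measurable_snd m(1)]
            measurable_compose[OF measurable_fst m(2)]])
      (intro continuous_on continuous_on_fst continuous_on_snd continuous_on_id)
  have le: "Measurable.pred (?M \<Otimes>\<^sub>M ?M) (\<lambda>x. fst x \<le> snd x)"

    unfolding not_less[symmetric]
    by (intro pred_intros_logic borel_measurable_pred_less measurable_compose[OF measurable_fst m_id]
        measurable_compose[OF measurable_snd m_id])
  have fm: "case_prod f \<in> borel_measurable (?M \<Otimes>\<^sub>M ?M)"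
    unfolding f_def split_beta using pm le by (intro measurable_If) auto
  have pred_ge: "{\<eta> \<in> space ?M. \<xi> \<le> \<eta>} \<in> sets ?M" and pred_le: "{\<eta> \<in> space ?M. \<eta> \<le> \<xi>} \<in> sets ?M" for \<xi>
    unfolding not_less[symmetric] Measurable.pred_def[symmetric]
    by (intro pred_intros_logic borel_measurable_pred_less m_id measurable_const; simp)+
  obtain K where K: "K > 0" "\<And>x y. norm (prod x y) \<le> norm x * norm y * K" using pos_bounded by blast
  obtain B where B: "\<And>\<xi>. \<xi> \<in> {a..b} \<Longrightarrow> norm (\<phi>' \<xi>) \<le> B"
    using compact_imp_bounded[OF compact_continuous_image[OF \<phi>' compact_Icc]] unfolding bounded_iff by blast
  have B0: "0 \<le> B" using B[of a] ab norm_ge_zero[of "\<phi>' a"] by (meson atLeastAtMost_iff order_refl order_trans)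
  \<comment> \<open>A bound constant in \<open>\<eta>\<close> and integrable in
    \<open>\<xi>\<close>: all that is known of \<open>v\<close> is integrability.\<close>
  have fb: "norm (f \<xi> \<eta>) \<le> B * K * norm (v \<xi>)" if "\<eta> \<in> {a..b}" for \<xi> \<eta>
  proof -
    have "norm (\<phi>' \<eta>) * (norm (v \<xi>) * K) \<le> B * (norm (v \<xi>) * K)"
      using B[OF that] K(1) by (intro mult_right_mono) auto
    then have "norm (prod (\<phi>' \<eta>) (v \<xi>)) \<le> B * K * norm (v \<xi>)"
      using K(2)[of "\<phi>' \<eta>" "v \<xi>"] by (simp add: mult_ac del: mult_le_cancel_left_pos mult_le_cancel_right_pos)
    moreover have "0 \<le> B * K * norm (v \<xi>)" using K(1) B0 by simp
    ultimately show ?thesis by (simp add: f_def)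
  qed
  have f_\<eta>: "integrable ?M (\<lambda>\<eta>. f \<xi> \<eta>)" if "\<xi> \<in> {a..b}" for \<xi>
  proof (rule M.integrable_const_bound[where B = "B * K * norm (v \<xi>)"])
    show "AE \<eta> in ?M. norm (f \<xi> \<eta>) \<le> B * K * norm (v \<xi>)" using fb by (intro AE_I2) auto
    show "f \<xi> \<in> borel_measurable ?M"
      using measurable_Pair2[OF fm] that by simp
  qed
  have int: "integrable (?M \<Otimes>\<^sub>M ?M) (case_prod f)"
  proof (rule Fubini_integrable[OF fm])
    show "AE \<xi> in ?M. integrable ?M (\<lambda>\<eta>. case_prod f (\<xi>, \<eta>))"
      using f_\<eta> by (intro AE_I2) simp
    show "integrable ?M (\<lambda>\<xi>. LINT \<eta>|?M. norm (case_prod f (\<xi>, \<eta>)))"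
    proof (rule Bochner_Integration.integrable_bound[where f = "\<lambda>\<xi>. (B * K * measure ?M {a..b}) * norm (v \<xi>)"])
      show "integrable ?M (\<lambda>\<xi>. (B * K * measure ?M {a..b}) * norm (v \<xi>))" using v by auto
      show "(\<lambda>\<xi>. LINT \<eta>|?M. norm (case_prod f (\<xi>, \<eta>))) \<in> borel_measurable ?M"
        using fm by measurable
      show "AE \<xi> in ?M. norm (LINT \<eta>|?M. norm (case_prod f (\<xi>, \<eta>))) \<le> norm ((B * K * measure ?M {a..b}) * norm (v \<xi>))"
      proof (intro AE_I2)
        fix \<xi> assume "\<xi> \<in> space ?M"
        then have \<xi>: "\<xi> \<in> {a..b}" by simp
        have "(LINT \<eta>|?M. norm (f \<xi> \<eta>)) \<le> (LINT \<eta>|?M. B * K * norm (v \<xi>))"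
          by (intro integral_mono integrable_norm f_\<eta> \<xi>) (use fb in auto)
        then show "norm (LINT \<eta>|?M. norm (case_prod f (\<xi>, \<eta>))) \<le> norm ((B * K * measure ?M {a..b}) * norm (v \<xi>))"
          using K(1) B0 by (simp add: abs_mult mult_ac)
      qed
    qed
  qed
  have in_\<eta>: "(LINT \<eta>|?M. f \<xi> \<eta>) = prod (\<phi> b - \<phi> \<xi>) (v \<xi>)" if \<xi>: "\<xi> \<in> {a..b}" for \<xi>
  proof -
    have "integrable ?M (\<lambda>\<eta>. if \<xi> \<le> \<eta> then \<phi>' \<eta> else 0)"
      by (rule Bochner_Integration.integrable_bound[OF \<phi>'i]) (auto intro!: AE_I2 measurable_If m pred_ge)
    note i = this
    have "(\<phi>' has_integral (\<phi> b - \<phi> \<xi>)) {\<xi>..b}"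
      by (rule fundamental_theorem_of_calculus) (use \<xi> in \<open>auto intro: has_vector_derivative_within_subset[OF \<phi>]\<close>)
    then have "((\<lambda>\<eta>. if \<eta> \<in> {\<xi>..b} then \<phi>' \<eta> else 0) has_integral (\<phi> b - \<phi> \<xi>)) {a..b}"
      by (subst has_integral_restrict) (use \<xi> in auto)
    then have "((\<lambda>\<eta>. if \<xi> \<le> \<eta> then \<phi>' \<eta> else 0) has_integral (\<phi> b - \<phi> \<xi>)) {a..b}"
      by (rule has_integral_eq[rotated]) auto
    then have "(LINT \<eta>|?M. (if \<xi> \<le> \<eta> then \<phi>' \<eta> else 0)) = \<phi> b - \<phi> \<xi>"
      by (rule integral_lebesgue_on_eq[OF i])
    moreover have "(LINT \<eta>|?M. f \<xi> \<eta>) = prod (LINT \<eta>|?M. (if \<xi> \<le> \<eta> then \<phi>' \<eta> else 0)) (v \<xi>)"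
      by (subst integral_bounded_linear[OF bounded_linear_left i, symmetric])
        (auto simp: f_def zero_left intro!: Bochner_Integration.integral_cong)
    ultimately show ?thesis by simp
  qed
  have in_\<xi>: "(LINT \<xi>|?M. f \<xi> \<eta>) = prod (\<phi>' \<eta>) (g \<eta> - g a)" if \<eta>: "\<eta> \<in> {a..b}" for \<eta>
  proof -
    have "integrable ?M (\<lambda>\<xi>. if \<xi> \<le> \<eta> then v \<xi> else 0)"
      by (rule Bochner_Integration.integrable_bound[OF v]) (auto intro!: AE_I2 measurable_If m pred_le)
    note i = this
    have "((\<lambda>\<xi>. if \<xi> \<in> {a..\<eta>} then v \<xi> else 0) has_integral (g \<eta> - g a)) {a..b}"
      by (subst has_integral_restrict) (use \<eta> g in auto)
    then have "((\<lambda>\<xi>. if \<xi> \<le> \<eta> then v \<xi> else 0) has_integral (g \<eta> - g a)) {a..b}"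
      by (rule has_integral_eq[rotated]) auto
    then have "(LINT \<xi>|?M. (if \<xi> \<le> \<eta> then v \<xi> else 0)) = g \<eta> - g a"
      by (rule integral_lebesgue_on_eq[OF i])
    moreover have "(LINT \<xi>|?M. f \<xi> \<eta>) = prod (\<phi>' \<eta>) (LINT \<xi>|?M. (if \<xi> \<le> \<eta> then v \<xi> else 0))"
      by (subst integral_bounded_linear[OF bounded_linear_right i, symmetric])
        (auto simp: f_def zero_right intro!: Bochner_Integration.integral_cong)
    ultimately show ?thesis by simp
  qed
  \<comment> \<open>Integrating over \<open>\<eta>\<close> first leaves
    \<open>\<phi> b - \<phi> \<xi>\<close>, over \<open>\<xi>\<close> first leaves
    \<open>g \<eta> - g a\<close>.\<close>
  have Fub: "(LINT \<eta>|?M. prod (\<phi>' \<eta>) (g \<eta> - g a)) = (LINT \<xi>|?M. prod (\<phi> b - \<phi> \<xi>) (v \<xi>))"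
  proof -
    have "(LINT \<eta>|?M. prod (\<phi>' \<eta>) (g \<eta> - g a)) = (LINT \<eta>|?M. LINT \<xi>|?M. f \<xi> \<eta>)"
      by (intro Bochner_Integration.integral_cong) (simp_all add: in_\<xi>)
    also have "\<dots> = (LINT \<xi>|?M. LINT \<eta>|?M. f \<xi> \<eta>)" by (rule Fubini_integral[OF int])
    also have "\<dots> = (LINT \<xi>|?M. prod (\<phi> b - \<phi> \<xi>) (v \<xi>))"
      by (intro Bochner_Integration.integral_cong) (simp_all add: in_\<eta>)
    finally show ?thesis .
  qed
  have i1: "integrable ?M (\<lambda>\<eta>. prod (\<phi>' \<eta>) (g \<eta>))" by (rule integrable_bounded_bilinear_continuous[OF bb \<phi>' gi])
  have i2: "integrable ?M (\<lambda>\<eta>. prod (\<phi> \<eta>) (v \<eta>))" by (rule integrable_bounded_bilinear_continuous[OF bb \<phi>c v])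
  have i3: "integrable ?M (\<lambda>\<eta>. prod (\<phi>' \<eta>) (g a))" by (rule integrable_bounded_linear[OF bounded_linear_left \<phi>'i])
  have i4: "integrable ?M (\<lambda>\<eta>. prod (\<phi> b) (v \<eta>))" by (rule integrable_bounded_linear[OF bounded_linear_right v])
  have v_int: "(LINT \<xi>|?M. v \<xi>) = g b - g a"
    using g[of b] ab by (intro integral_lebesgue_on_eq[OF v]) auto
  have "(\<phi>' has_integral (\<phi> b - \<phi> a)) {a..b}"
    by (rule fundamental_theorem_of_calculus[OF ab \<phi>])
  then have \<phi>'_int: "(LINT \<xi>|?M. \<phi>' \<xi>) = \<phi> b - \<phi> a"
    by (rule integral_lebesgue_on_eq[OF \<phi>'i])
  have "(LINT \<eta>|?M. prod (\<phi>' \<eta>) (g \<eta>)) - prod (\<phi> b - \<phi> a) (g a) = (LINT \<eta>|?M. prod (\<phi>' \<eta>) (g \<eta> - g a))"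
    using i1 i3 integral_bounded_linear[OF bounded_linear_left \<phi>'i, of "g a"] \<phi>'_int
    by (simp add: diff_right)
  also have "\<dots> = prod (\<phi> b) (g b - g a) - (LINT \<eta>|?M. prod (\<phi> \<eta>) (v \<eta>))"
    unfolding Fub using i2 i4 integral_bounded_linear[OF bounded_linear_right v, of "\<phi> b"] v_int
    by (simp add: diff_left)
  finally have "(LINT \<eta>|?M. prod (\<phi>' \<eta>) (g \<eta>) + prod (\<phi> \<eta>) (v \<eta>)) = prod (\<phi> b) (g b) - prod (\<phi> a) (g a)"
    using i1 i2 by (simp add: diff_left diff_right algebra_simps)
  then show ?thesis
    using has_integral_integral_lebesgue_on[OF Bochner_Integration.integrable_add[OF i1 i2]] by simp
qed

section \<open>Testing the transport equation\<close>

lemma has_vector_derivative_boundI: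
  assumes le: "\<And>s. s \<in> S \<Longrightarrow> norm (f s - f t - (s - t) *\<^sub>R D) \<le> \<bar>s - t\<bar> * e s"
    and e: "(e \<longlongrightarrow> 0) (at t within S)"
  shows "(f has_vector_derivative D) (at t within S)"
  unfolding has_vector_derivative_def has_derivative_within
proof
  show "bounded_linear (\<lambda>x. x *\<^sub>R D)" by (rule bounded_linear_scaleR_left)
  have "norm ((1 / norm (s - t)) *\<^sub>R (f s - (f t + (s - t) *\<^sub>R D))) \<le> e s" if "s \<in> S" "s \<noteq> t" for s
  proof -
    have "(1 / \<bar>s - t\<bar>) * norm (f s - f t - (s - t) *\<^sub>R D) \<le> (1 / \<bar>s - t\<bar>) * (\<bar>s - t\<bar> * e s)"
      using le[OF that(1)] by (intro mult_left_mono) auto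
    then show ?thesis using that(2) by (simp add: diff_diff_eq)
  qed
  then have "\<forall>\<^sub>F s in at t within S. norm ((1 / norm (s - t)) *\<^sub>R (f s - (f t + (s - t) *\<^sub>R D))) \<le> e s"
    unfolding eventually_at_filter by (intro always_eventually) blast
  then show "((\<lambda>s. (1 / norm (s - t)) *\<^sub>R (f s - (f t + (s - t) *\<^sub>R D))) \<longlongrightarrow> 0) (at t within S)"
    using e by (rule Lim_null_comparison)
qed

text \<open>A test function that is just smooth enough (\<open>C\<^sup>1\<close>); letting \<open>r\<close> vary and differentiating three
  times in \<open>r\<close> recovers the tested function.\<close>

definition cutoff :: "real \<Rightarrow> real \<Rightarrow> real" where
  "cutoff r s = (max 0 (r - s))\<^sup>2"

definition cutoff' :: "real \<Rightarrow> real \<Rightarrow> real" where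
  "cutoff' r s = - 2 * max 0 (r - s)"

text \<open>\<open>cutoff'\<close> is Lipschitz with constant 2, which keeps the remainder quadratic
  although the second derivative jumps at \<open>r\<close>.\<close>

lemma cutoff_taylor: "\<bar>cutoff r x - cutoff r y - (x - y) * cutoff' r y\<bar> \<le> (x - y)\<^sup>2"
proof -
  consider "x \<le> r" "y \<le> r" | "r < x" "y \<le> r" | "x \<le> r" "r < y" | "r < x" "r < y" by linarith
  then show ?thesis
  proof cases
    case 1
    then have "cutoff r x - cutoff r y - (x - y) * cutoff' r y = (x - y)\<^sup>2"
      by (simp add: cutoff_def cutoff'_def max_def power2_eq_square algebra_simps)
    then show ?thesis by simp
  next
    case 2
    then have eq: "cutoff r x - cutoff r y - (x - y) * cutoff' r y = (x - y)\<^sup>2 - (x - r)\<^sup>2"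
      by (simp add: cutoff_def cutoff'_def max_def power2_eq_square algebra_simps)
    have "(x - r)\<^sup>2 \<le> (x - y)\<^sup>2" using 2 by (intro power_mono) auto
    then show ?thesis unfolding eq by simp
  next
    case 3
    then have eq: "cutoff r x - cutoff r y - (x - y) * cutoff' r y = (r - x)\<^sup>2"
      by (simp add: cutoff_def cutoff'_def max_def)
    have "(r - x)\<^sup>2 \<le> (y - x)\<^sup>2" using 3 by (intro power_mono) auto
    then show ?thesis unfolding eq by (simp add: power2_commute)
  next
    case 4
    then show ?thesis by (simp add: cutoff_def cutoff'_def max_def)
  qed
qed

lemma cutoff_has_derivative: "(cutoff r has_real_derivative cutoff' r y) (at y)"
  unfolding has_real_derivative_iff_has_vector_derivative
proof (rule has_vector_derivative_boundI)
  show "norm (cutoff r s - cutoff r y - (s - y) *\<^sub>R cutoff' r y) \<le> \<bar>s - y\<bar> * \<bar>s - y\<bar>" for s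
    using cutoff_taylor[of r s y] by (simp add: power2_eq_square)
  have "((\<lambda>s. \<bar>s - y\<bar>) \<longlongrightarrow> \<bar>y - y\<bar>) (at y)" by (intro tendsto_intros)
  then show "((\<lambda>s. \<bar>s - y\<bar>) \<longlongrightarrow> 0) (at y)" by simp
qed

lemma cutoff_bounds:
  assumes "0 \<le> r" "0 \<le> s"
  shows "\<bar>cutoff r s\<bar> \<le> r\<^sup>2" "\<bar>cutoff' r s\<bar> \<le> 2 * r"
  using assms by (auto simp: cutoff_def cutoff'_def max_def intro: power_mono)

lemma cutoff_eq_0: "r \<le> s \<Longrightarrow> cutoff r s = 0"
  by (simp add: cutoff_def)

lemma continuous_on_cutoff [continuous_intros]:
  assumes "continuous_on A f" shows "continuous_on A (\<lambda>x. cutoff r (f x))" "continuous_on A (\<lambda>x. cutoff' r (f x))"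
  unfolding cutoff_def cutoff'_def by (intro continuous_intros assms)+

text \<open>A solution of \<open>z\<^sub>t = \<epsilon> (h z)\<^sub>\<xi>\<close> is tested with \<open>cutoff r (t + T \<xi>)\<close>, which solves the adjoint
  equation because \<open>T' = \<epsilon> / h\<close> and vanishes at time \<open>r\<close> because \<open>T \<ge> 0\<close>.\<close>

lemma transport_tested:
  fixes z dz g :: "real \<Rightarrow> real \<Rightarrow> 'v::euclidean_space" and h T :: "real \<Rightarrow> real"
  assumes ab: "a < b" and r: "0 \<le> r" and \<epsilon>: "\<epsilon> * \<epsilon> = 1"
    and z: "\<And>t. t \<ge> 0 \<Longrightarrow> integrable (lebesgue_on {a..b}) (z t)"
    and dz: "\<And>t. t \<ge> 0 \<Longrightarrow> integrable (lebesgue_on {a..b}) (dz t)"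
    and lim: "\<And>t. t \<ge> 0 \<Longrightarrow>
      ((\<lambda>s. LINT \<xi>|lebesgue_on {a..b}. norm ((1 / (s - t)) *\<^sub>R (z s \<xi> - z t \<xi>) - dz t \<xi>)) \<longlongrightarrow> 0) (at t within {0..})"
    and z0: "AE \<xi> in lebesgue_on {a..b}. z 0 \<xi> = 0"
    and g: "\<And>t \<xi>. t \<ge> 0 \<Longrightarrow> \<xi> \<in> {a..b} \<Longrightarrow> (dz t has_integral \<epsilon> *\<^sub>R (g t \<xi> - g t a)) {a..\<xi>}"
    and hz: "\<And>t. t \<ge> 0 \<Longrightarrow> AE \<xi> in lebesgue_on {a..b}. h \<xi> *\<^sub>R z t \<xi> = g t \<xi>"
    and h: "continuous_on {a..b} h" "\<And>\<xi>. \<xi> \<in> {a..b} \<Longrightarrow> 0 < h \<xi>"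
    and T: "\<And>\<xi>. \<xi> \<in> {a..b} \<Longrightarrow> (T has_real_derivative \<epsilon> / h \<xi>) (at \<xi> within {a..b})"
    and T0: "\<And>\<xi>. \<xi> \<in> {a..b} \<Longrightarrow> 0 \<le> T \<xi>"
  shows "((\<lambda>t. cutoff r (t + T b) *\<^sub>R g t b - cutoff r (t + T a) *\<^sub>R g t a) has_integral 0) {0..r}"
proof -
  let ?M = "lebesgue_on {a..b}"
  have Tc: "continuous_on {a..b} T" using T by (rule DERIV_continuous_on)
  have bb: "bounded_bilinear (scaleR :: real \<Rightarrow> 'v \<Rightarrow> 'v)" by (rule bounded_bilinear_scaleR)
  \<comment> \<open>The pairing of solution and weight: it vanishes at times 0 and \<open>r\<close>,
    and its derivative reduces to boundary terms.\<close>
  define J where "J t = (LINT \<xi>|?M. cutoff r (t + T \<xi>) *\<^sub>R z t \<xi>)" for t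
  define J' where "J' t = (LINT \<xi>|?M. cutoff' r (t + T \<xi>) *\<^sub>R z t \<xi> + cutoff r (t + T \<xi>) *\<^sub>R dz t \<xi>)" for t
  have i0: "integrable ?M (\<lambda>\<xi>. cutoff r (c + T \<xi>) *\<^sub>R f \<xi>)"
    and i1: "integrable ?M (\<lambda>\<xi>. cutoff' r (c + T \<xi>) *\<^sub>R f \<xi>)" if "integrable ?M f" for c and f :: "real \<Rightarrow> 'v"
    by (intro integrable_bounded_bilinear_continuous[OF bb _ that] continuous_intros Tc)+
  have J: "(J has_vector_derivative J' t) (at t within {0..})" if t: "t \<ge> 0" for t
  proof (rule has_vector_derivative_boundI)
    define q where "q s = (LINT \<xi>|?M. norm ((1 / (s - t)) *\<^sub>R (z s \<xi> - z t \<xi>) - dz t \<xi>))" for s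
    define Z where "Z = (LINT \<xi>|?M. norm (z t \<xi>))"
    define D where "D = (LINT \<xi>|?M. norm (dz t \<xi>))"
    \<comment> \<open>The bound from the three-term splitting below, divided by
      \<open>\<bar>s - t\<bar>\<close>. Here \<open>q\<close> is the error of the difference
      quotient of \<open>z\<close> in L1, while \<open>r\<^sup>2\<close> and \<open>2 * r\<close>
      bound the weight and its derivative.\<close>
    define e where "e s = \<bar>s - t\<bar> * (Z + \<bar>s - t\<bar> * q s + \<bar>s - t\<bar> * D) + 2 * r * (\<bar>s - t\<bar> * q s + \<bar>s - t\<bar> * D) + r\<^sup>2 * q s" for s
    have "((\<lambda>s. \<bar>s - t\<bar> * (Z + \<bar>s - t\<bar> * q s + \<bar>s - t\<bar> * D) + 2 * r * (\<bar>s - t\<bar> * q s + \<bar>s - t\<bar> * D) + r\<^sup>2 * q s)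
      \<longlongrightarrow> \<bar>t - t\<bar> * (Z + \<bar>t - t\<bar> * 0 + \<bar>t - t\<bar> * D) + 2 * r * (\<bar>t - t\<bar> * 0 + \<bar>t - t\<bar> * D) + r\<^sup>2 * 0) (at t within {0..})"
      using lim[OF t] unfolding q_def[symmetric] by (intro tendsto_intros)
    then show "(e \<longlongrightarrow> 0) (at t within {0..})" unfolding e_def by simp
    fix s :: real assume "s \<in> {0..}"
    then have s: "s \<ge> 0" by simp
    define Q where "Q \<xi> = norm (z s \<xi> - z t \<xi> - (s - t) *\<^sub>R dz t \<xi>)" for \<xi>
    have Qi: "integrable ?M Q" unfolding Q_def using z[OF s] z[OF t] dz[OF t] by auto
    have Q_int: "(LINT \<xi>|?M. Q \<xi>) = \<bar>s - t\<bar> * q s"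
    proof (cases "s = t")
      case True
      then show ?thesis by (simp add: Q_def)
    next
      case False
      have "Q \<xi> = \<bar>s - t\<bar> * norm ((1 / (s - t)) *\<^sub>R (z s \<xi> - z t \<xi>) - dz t \<xi>)" for \<xi>
      proof -
        have "z s \<xi> - z t \<xi> - (s - t) *\<^sub>R dz t \<xi> = (s - t) *\<^sub>R ((1 / (s - t)) *\<^sub>R (z s \<xi> - z t \<xi>) - dz t \<xi>)"
          using False by (simp add: scaleR_diff_right)
        then show ?thesis unfolding Q_def by (simp only: norm_scaleR)
      qed
      then show ?thesis by (simp add: q_def)
    qed
    have lin: "(LINT \<xi>|?M. c1 * (norm (z t \<xi>) + Q \<xi> + c * norm (dz t \<xi>)) + c2 * (Q \<xi> + c * norm (dz t \<xi>)) + c3 * Q \<xi>)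
      = c1 * (Z + (LINT \<xi>|?M. Q \<xi>) + c * D) + c2 * ((LINT \<xi>|?M. Q \<xi>) + c * D) + c3 * (LINT \<xi>|?M. Q \<xi>)" for c1 c2 c3 c
      unfolding Z_def D_def using Qi integrable_norm[OF z[OF t]] integrable_norm[OF dz[OF t]] by simp
    have J_diff: "J s - J t - (s - t) *\<^sub>R J' t = (LINT \<xi>|?M. cutoff r (s + T \<xi>) *\<^sub>R z s \<xi> - cutoff r (t + T \<xi>) *\<^sub>R z t \<xi>
       - (s - t) *\<^sub>R (cutoff' r (t + T \<xi>) *\<^sub>R z t \<xi> + cutoff r (t + T \<xi>) *\<^sub>R dz t \<xi>))"
      unfolding J_def J'_def using z[OF s] z[OF t] dz[OF t] by (simp add: i0 i1)
    have "norm (J s - J t - (s - t) *\<^sub>R J' t) \<le> (LINT \<xi>|?M. \<bar>s - t\<bar>\<^sup>2 * (norm (z t \<xi>) + Q \<xi> + \<bar>s - t\<bar> * norm (dz t \<xi>))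
       + 2 * r * \<bar>s - t\<bar> * (Q \<xi> + \<bar>s - t\<bar> * norm (dz t \<xi>)) + r\<^sup>2 * Q \<xi>)"
      unfolding J_diff
    proof (rule Bochner_Integration.integral_norm_bound_integral)
      show "integrable ?M (\<lambda>\<xi>. cutoff r (s + T \<xi>) *\<^sub>R z s \<xi> - cutoff r (t + T \<xi>) *\<^sub>R z t \<xi>
       - (s - t) *\<^sub>R (cutoff' r (t + T \<xi>) *\<^sub>R z t \<xi> + cutoff r (t + T \<xi>) *\<^sub>R dz t \<xi>))"
        by (intro Bochner_Integration.integrable_diff Bochner_Integration.integrable_add
            integrable_scaleR_right i0 i1 z dz s t)
      show "integrable ?M (\<lambda>\<xi>. \<bar>s - t\<bar>\<^sup>2 * (norm (z t \<xi>) + Q \<xi> + \<bar>s - t\<bar> * norm (dz t \<xi>))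
       + 2 * r * \<bar>s - t\<bar> * (Q \<xi> + \<bar>s - t\<bar> * norm (dz t \<xi>)) + r\<^sup>2 * Q \<xi>)"
        using Qi z[OF t] dz[OF t] by (intro Bochner_Integration.integrable_add integrable_mult_right integrable_norm) auto
      fix \<xi> assume "\<xi> \<in> space ?M"
      then have \<xi>: "\<xi> \<in> {a..b}" by simp
      define p p' p1 where "p = cutoff r (s + T \<xi>)" and "p' = cutoff r (t + T \<xi>)" and "p1 = cutoff' r (t + T \<xi>)"
      have pb: "\<bar>p'\<bar> \<le> r\<^sup>2" "\<bar>p1\<bar> \<le> 2 * r"
        unfolding p'_def p1_def by (intro cutoff_bounds r add_nonneg_nonneg t T0 \<xi>)+
      have pt: "\<bar>p - p' - (s - t) * p1\<bar> \<le> \<bar>s - t\<bar>\<^sup>2"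
        using cutoff_taylor[of r "s + T \<xi>" "t + T \<xi>"] by (simp add: p_def p'_def p1_def)
      have zd: "norm (z s \<xi> - z t \<xi>) \<le> Q \<xi> + \<bar>s - t\<bar> * norm (dz t \<xi>)"
        using norm_triangle_ineq[of "z s \<xi> - z t \<xi> - (s - t) *\<^sub>R dz t \<xi>" "(s - t) *\<^sub>R dz t \<xi>"] by (simp add: Q_def)
      have zs: "norm (z s \<xi>) \<le> norm (z t \<xi>) + Q \<xi> + \<bar>s - t\<bar> * norm (dz t \<xi>)"
        using norm_triangle_ineq[of "z s \<xi> - z t \<xi>" "z t \<xi>"] zd by simp
      \<comment> \<open>Discrete product rule: Taylor error of the weight, its derivative times the
        increment of \<open>z\<close>, and the weight times the linearisation error of
        \<open>z\<close>.\<close>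
      have "p *\<^sub>R z s \<xi> - p' *\<^sub>R z t \<xi> - (s - t) *\<^sub>R (p1 *\<^sub>R z t \<xi> + p' *\<^sub>R dz t \<xi>)
        = (p - p' - (s - t) * p1) *\<^sub>R z s \<xi> + ((s - t) * p1) *\<^sub>R (z s \<xi> - z t \<xi>) + p' *\<^sub>R (z s \<xi> - z t \<xi> - (s - t) *\<^sub>R dz t \<xi>)"
        by (simp add: algebra_simps)
      also have "norm \<dots> \<le> norm ((p - p' - (s - t) * p1) *\<^sub>R z s \<xi>) + norm (((s - t) * p1) *\<^sub>R (z s \<xi> - z t \<xi>))
         + norm (p' *\<^sub>R (z s \<xi> - z t \<xi> - (s - t) *\<^sub>R dz t \<xi>))"
        by (intro order_trans[OF norm_triangle_ineq] add_right_mono norm_triangle_ineq)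
      also have "\<dots> \<le> \<bar>s - t\<bar>\<^sup>2 * (norm (z t \<xi>) + Q \<xi> + \<bar>s - t\<bar> * norm (dz t \<xi>))
         + 2 * r * \<bar>s - t\<bar> * (Q \<xi> + \<bar>s - t\<bar> * norm (dz t \<xi>)) + r\<^sup>2 * Q \<xi>"
      proof (intro add_mono)
        show "norm ((p - p' - (s - t) * p1) *\<^sub>R z s \<xi>) \<le> \<bar>s - t\<bar>\<^sup>2 * (norm (z t \<xi>) + Q \<xi> + \<bar>s - t\<bar> * norm (dz t \<xi>))"
          unfolding norm_scaleR by (intro mult_mono pt zs) auto
        have "\<bar>s - t\<bar> * \<bar>p1\<bar> * norm (z s \<xi> - z t \<xi>) \<le> \<bar>s - t\<bar> * (2 * r) * (Q \<xi> + \<bar>s - t\<bar> * norm (dz t \<xi>))"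
          using r by (intro mult_mono pb zd mult_nonneg_nonneg) auto
        then show "norm (((s - t) * p1) *\<^sub>R (z s \<xi> - z t \<xi>)) \<le> 2 * r * \<bar>s - t\<bar> * (Q \<xi> + \<bar>s - t\<bar> * norm (dz t \<xi>))"
          by (simp add: abs_mult mult_ac)
        show "norm (p' *\<^sub>R (z s \<xi> - z t \<xi> - (s - t) *\<^sub>R dz t \<xi>)) \<le> r\<^sup>2 * Q \<xi>"
          unfolding norm_scaleR Q_def by (intro mult_right_mono pb) auto
      qed
      finally show "norm (cutoff r (s + T \<xi>) *\<^sub>R z s \<xi> - cutoff r (t + T \<xi>) *\<^sub>R z t \<xi>
         - (s - t) *\<^sub>R (cutoff' r (t + T \<xi>) *\<^sub>R z t \<xi> + cutoff r (t + T \<xi>) *\<^sub>R dz t \<xi>))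
         \<le> \<bar>s - t\<bar>\<^sup>2 * (norm (z t \<xi>) + Q \<xi> + \<bar>s - t\<bar> * norm (dz t \<xi>))
         + 2 * r * \<bar>s - t\<bar> * (Q \<xi> + \<bar>s - t\<bar> * norm (dz t \<xi>)) + r\<^sup>2 * Q \<xi>"
        by (simp only: p_def p'_def p1_def)
    qed
    also have "\<dots> = \<bar>s - t\<bar>\<^sup>2 * (Z + \<bar>s - t\<bar> * q s + \<bar>s - t\<bar> * D) + 2 * r * \<bar>s - t\<bar> * (\<bar>s - t\<bar> * q s + \<bar>s - t\<bar> * D) + r\<^sup>2 * (\<bar>s - t\<bar> * q s)"
      unfolding lin Q_int ..
    also have "\<dots> = \<bar>s - t\<bar> * e s"
      unfolding e_def power2_eq_square by (simp add: algebra_simps)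
    finally show "norm (J s - J t - (s - t) *\<^sub>R J' t) \<le> \<bar>s - t\<bar> * e s" .
  qed
  \<comment> \<open>As \<open>T' = \<epsilon> / h\<close> and \<open>h z = g\<close>, the term with
    \<open>cutoff'\<close> is the spatial derivative of the weight times
    \<open>\<epsilon> g\<close>; the integrand is thus the derivative of a product.\<close>
  have J': "J' t = \<epsilon> *\<^sub>R (cutoff r (t + T b) *\<^sub>R g t b - cutoff r (t + T a) *\<^sub>R g t a)" if t: "t \<ge> 0" for t
  proof -
    let ?\<phi> = "\<lambda>\<xi>. cutoff r (t + T \<xi>)" and ?\<phi>' = "\<lambda>\<xi>. cutoff' r (t + T \<xi>) * (\<epsilon> / h \<xi>)"
    have \<phi>: "(?\<phi> has_vector_derivative ?\<phi>' \<xi>) (at \<xi> within {a..b})" if "\<xi> \<in> {a..b}" for \<xi>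
    proof -
      have "((\<lambda>\<xi>. t + T \<xi>) has_real_derivative \<epsilon> / h \<xi>) (at \<xi> within {a..b})"
        using DERIV_add[OF DERIV_const[of t] T[OF that]] by simp
      from DERIV_chain2[OF cutoff_has_derivative this] show ?thesis
        by (simp add: has_real_derivative_iff_has_vector_derivative)
    qed
    have \<phi>': "continuous_on {a..b} ?\<phi>'"
      by (intro continuous_intros Tc h(1)) (use h(2) in \<open>auto simp: less_imp_neq[symmetric]\<close>)
    have gint: "(dz t has_integral (\<epsilon> *\<^sub>R g t \<xi> - \<epsilon> *\<^sub>R g t a)) {a..\<xi>}" if "\<xi> \<in> {a..b}" for \<xi>
      using g[OF t that] by (simp add: scaleR_diff_right)
    note ibp = integration_by_parts_absolutely_continuous[OF bb less_imp_le[OF ab] \<phi> \<phi>' dz[OF t] gint]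
    have ae: "AE \<xi> in ?M. cutoff' r (t + T \<xi>) *\<^sub>R z t \<xi> + cutoff r (t + T \<xi>) *\<^sub>R dz t \<xi>
        = ?\<phi>' \<xi> *\<^sub>R (\<epsilon> *\<^sub>R g t \<xi>) + ?\<phi> \<xi> *\<^sub>R dz t \<xi>"
      using hz[OF t] AE_space
    proof eventually_elim
      case (elim \<xi>)
      have "h \<xi> \<noteq> 0" using h(2)[of \<xi>] elim(2) by auto
      then have "?\<phi>' \<xi> *\<^sub>R (\<epsilon> *\<^sub>R g t \<xi>) = (cutoff' r (t + T \<xi>) * (\<epsilon> * \<epsilon>)) *\<^sub>R z t \<xi>"
        unfolding elim(1)[symmetric] by (simp add: mult_ac)
      then show ?case using \<epsilon> by simp
    qed
    have i: "integrable ?M (\<lambda>\<xi>. cutoff' r (t + T \<xi>) *\<^sub>R z t \<xi> + cutoff r (t + T \<xi>) *\<^sub>R dz t \<xi>)"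
      by (intro Bochner_Integration.integrable_add i0 i1 z dz t)
    have "AE \<xi> in lborel. \<xi> \<in> {a..b} \<longrightarrow> cutoff' r (t + T \<xi>) *\<^sub>R z t \<xi> + cutoff r (t + T \<xi>) *\<^sub>R dz t \<xi>
        = ?\<phi>' \<xi> *\<^sub>R (\<epsilon> *\<^sub>R g t \<xi>) + ?\<phi> \<xi> *\<^sub>R dz t \<xi>"
      using ae by (subst (asm) AE_restrict_space_iff) (auto simp: AE_completion_iff)
    from has_integral_AE[OF this] ibp
    have "((\<lambda>\<xi>. cutoff' r (t + T \<xi>) *\<^sub>R z t \<xi> + cutoff r (t + T \<xi>) *\<^sub>R dz t \<xi>) has_integral
      (?\<phi> b *\<^sub>R (\<epsilon> *\<^sub>R g t b) - ?\<phi> a *\<^sub>R (\<epsilon> *\<^sub>R g t a))) {a..b}" by blast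
    then have "J' t = ?\<phi> b *\<^sub>R (\<epsilon> *\<^sub>R g t b) - ?\<phi> a *\<^sub>R (\<epsilon> *\<^sub>R g t a)"
      unfolding J'_def by (rule integral_lebesgue_on_eq[OF i])
    then show ?thesis by (simp add: algebra_simps)
  qed
  have "(J' has_integral (J r - J 0)) {0..r}"
    by (rule fundamental_theorem_of_calculus[OF r]) (auto intro: has_vector_derivative_within_subset[OF J])
  moreover have "J r = 0"
    unfolding J_def by (rule integral_eq_zero_AE) (auto intro!: AE_I2 simp: cutoff_eq_0 T0)
  moreover have "J 0 = 0"
    unfolding J_def by (rule integral_eq_zero_AE) (use z0 in auto)
  ultimately have "(J' has_integral 0) {0..r}" by simp
  then have "((\<lambda>t. \<epsilon> *\<^sub>R J' t) has_integral (\<epsilon> *\<^sub>R 0)) {0..r}" by (rule has_integral_cmul)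
  then have "((\<lambda>t. \<epsilon> *\<^sub>R J' t) has_integral 0) {0..r}" by simp
  then show ?thesis
    by (rule has_integral_eq[rotated]) (use \<epsilon> in \<open>auto simp: J'\<close>)
qed

lemma cutoff_integrals_zero_imp_zero:
  fixes G :: "real \<Rightarrow> 'v::euclidean_space"
  assumes G: "continuous_on {0..} G"
    and int: "\<And>r. 0 \<le> r \<Longrightarrow> ((\<lambda>s. cutoff r s *\<^sub>R G s) has_integral 0) {0..r}"
    and r: "0 < r"
  shows "G r = 0"
proof -
  \<comment> \<open>Expanding \<open>(r - s)\<^sup>2\<close> turns the hypothesis into a relation
    between moments with upper limit \<open>r\<close>. In the first two differentiations the terms
    with \<open>G r\<close> cancel, which leaves \<open>A 0\<close> alone, whose derivative is
    \<open>G r\<close>.\<close>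
  define A where "A i r = integral {0..r} (\<lambda>s. s ^ i *\<^sub>R G s)" for i :: nat and r
  have cont: "continuous_on {0..c} (\<lambda>s. s ^ i *\<^sub>R G s)" for i c
    by (intro continuous_intros continuous_on_subset[OF G]) auto
  have A: "(A i has_vector_derivative (r ^ i *\<^sub>R G r)) (at r)" if "0 < r" for i r
  proof -
    have "(A i has_vector_derivative (r ^ i *\<^sub>R G r)) (at r within {0..r + 1})"
      unfolding A_def using integral_has_vector_derivative[OF cont, of r "r + 1" i] that by simp
    moreover have "at r within {0..r + 1} = at r" using that by (intro at_within_interior) auto
    ultimately show ?thesis by simp
  qed
  have Ai: "((\<lambda>s. s ^ i *\<^sub>R G s) has_integral A i r) {0..r}" for i r
    unfolding A_def by (intro integrable_integral integrable_continuous_real cont)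
  have e1: "r\<^sup>2 *\<^sub>R A 0 r - (2 * r) *\<^sub>R A 1 r + A 2 r = 0" if "0 < r" for r
  proof -
    have "((\<lambda>s. r\<^sup>2 *\<^sub>R (s ^ 0 *\<^sub>R G s) - (2 * r) *\<^sub>R (s ^ 1 *\<^sub>R G s) + s ^ 2 *\<^sub>R G s) has_integral
      (r\<^sup>2 *\<^sub>R A 0 r - (2 * r) *\<^sub>R A 1 r + A 2 r)) {0..r}"
      by (intro has_integral_add has_integral_diff has_integral_cmul Ai)
    moreover have "((\<lambda>s. r\<^sup>2 *\<^sub>R (s ^ 0 *\<^sub>R G s) - (2 * r) *\<^sub>R (s ^ 1 *\<^sub>R G s) + s ^ 2 *\<^sub>R G s) has_integral 0) {0..r}"
    proof (rule has_integral_eq[OF _ int])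
      fix s assume "s \<in> {0..r}"
      then have "cutoff r s = r\<^sup>2 - (2 * r) * s + s\<^sup>2"
        by (simp add: cutoff_def max_def power2_eq_square algebra_simps)
      then show "cutoff r s *\<^sub>R G s = r\<^sup>2 *\<^sub>R (s ^ 0 *\<^sub>R G s) - (2 * r) *\<^sub>R (s ^ 1 *\<^sub>R G s) + s ^ 2 *\<^sub>R G s"
        by (simp add: scaleR_add_left scaleR_diff_left)
    qed (use that in auto)
    ultimately show ?thesis by (rule has_integral_unique)
  qed
  have zero_deriv: "D = 0" if "(F has_vector_derivative D) (at r)" "\<And>r. 0 < r \<Longrightarrow> F r = 0" "0 < r"
    for F :: "real \<Rightarrow> 'v" and D r
  proof -
    have "(F has_vector_derivative 0) (at r)"
      by (rule has_vector_derivative_transform_within_open[of "\<lambda>_. 0" _ _ "{0<..}"]) (use that in auto)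
    then show ?thesis using that(1) vector_derivative_unique_at by blast
  qed
  have e2: "(2 * r) *\<^sub>R A 0 r - 2 *\<^sub>R A 1 r = 0" if "0 < r" for r
  proof (rule zero_deriv[OF _ e1 that])
    show "((\<lambda>r. r\<^sup>2 *\<^sub>R A 0 r - (2 * r) *\<^sub>R A 1 r + A 2 r) has_vector_derivative ((2 * r) *\<^sub>R A 0 r - 2 *\<^sub>R A 1 r)) (at r)"
    proof -
      have "((\<lambda>r. r\<^sup>2) has_real_derivative 2 * r) (at r)" by (auto intro!: derivative_eq_intros)
      moreover have "((\<lambda>r. 2 * r) has_real_derivative 2) (at r)" by (auto intro!: derivative_eq_intros)
      ultimately have "((\<lambda>r. r\<^sup>2 *\<^sub>R A 0 r - (2 * r) *\<^sub>R A 1 r + A 2 r) has_vector_derivative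
        (r\<^sup>2 *\<^sub>R (r ^ 0 *\<^sub>R G r) + (2 * r) *\<^sub>R A 0 r - ((2 * r) *\<^sub>R (r ^ 1 *\<^sub>R G r) + 2 *\<^sub>R A 1 r) + r ^ 2 *\<^sub>R G r)) (at r)"
        by (intro has_vector_derivative_add has_vector_derivative_diff has_vector_derivative_scaleR A that)
      moreover have "r\<^sup>2 *\<^sub>R (r ^ 0 *\<^sub>R G r) + (2 * r) *\<^sub>R A 0 r - ((2 * r) *\<^sub>R (r ^ 1 *\<^sub>R G r) + 2 *\<^sub>R A 1 r) + r ^ 2 *\<^sub>R G r
        = (2 * r) *\<^sub>R A 0 r - 2 *\<^sub>R A 1 r"
        by (simp add: power2_eq_square algebra_simps flip: scaleR_2)
      ultimately show ?thesis by (simp only:)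
    qed
  qed
  have e3: "2 *\<^sub>R A 0 r = 0" if "0 < r" for r
  proof (rule zero_deriv[OF _ e2 that])
    show "((\<lambda>r. (2 * r) *\<^sub>R A 0 r - 2 *\<^sub>R A 1 r) has_vector_derivative 2 *\<^sub>R A 0 r) (at r)"
    proof -
      have "((\<lambda>r. 2 * r) has_real_derivative 2) (at r)" by (auto intro!: derivative_eq_intros)
      then have "((\<lambda>r. (2 * r) *\<^sub>R A 0 r - 2 *\<^sub>R A 1 r) has_vector_derivative
        ((2 * r) *\<^sub>R (r ^ 0 *\<^sub>R G r) + 2 *\<^sub>R A 0 r - (2 *\<^sub>R (r ^ 1 *\<^sub>R G r) + 0 *\<^sub>R A 1 r))) (at r)"
        by (intro has_vector_derivative_diff has_vector_derivative_scaleR A that DERIV_const)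
      then show ?thesis by simp
    qed
  qed
  have "r ^ 0 *\<^sub>R G r = 0"
    by (rule zero_deriv[OF A _ r]) (use e3 r in auto)
  then show ?thesis by simp
qed

text \<open>Shifting time by \<open>l\<close> in the first term makes both terms carry
  \<open>cutoff r t\<close>, so \<open>gin (t - l) - gout t\<close> integrates to zero against every
  cutoff.\<close>

lemma delay_of_tested:
  fixes gin gout :: "real \<Rightarrow> 'v::euclidean_space"
  assumes l: "0 \<le> l" and gin: "continuous_on {0..} gin" "gin 0 = 0" and gout: "continuous_on {0..} gout" "gout 0 = 0"
    and int: "\<And>r. 0 \<le> r \<Longrightarrow> ((\<lambda>t. cutoff r (t + l) *\<^sub>R gin t - cutoff r t *\<^sub>R gout t) has_integral 0) {0..r}"
    and t: "0 \<le> t"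
  shows "gout t = (if l \<le> t then gin (t - l) else 0)"
proof -
  \<comment> \<open>The extension by zero is continuous because \<open>gin 0 = 0\<close>.\<close>
  define gi where "gi t = (if t \<le> 0 then 0 else gin t)" for t
  have gic: "continuous_on UNIV gi"
  proof -
    have "continuous_on ({..0} \<union> {0..}) (\<lambda>t. if t \<le> 0 then 0 else gin t)"
      by (rule continuous_on_If) (use gin in auto)
    moreover have "{..0} \<union> {0..} = (UNIV :: real set)" by auto
    ultimately show ?thesis unfolding gi_def by simp
  qed
  define G where "G t = gi (t - l) - gout t" for t
  have Gc: "continuous_on {0..} G"
    unfolding G_def by (intro continuous_intros continuous_on_compose2[OF gic] gout) auto
  have "((\<lambda>s. cutoff r s *\<^sub>R G s) has_integral 0) {0..r}" if r: "0 \<le> r" for r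
  proof -
    define k where "k s = cutoff r s *\<^sub>R gi (s - l)" for s
    have kc: "continuous_on A k" for A
      unfolding k_def by (intro continuous_intros continuous_on_compose2[OF gic]) auto
    \<comment> \<open>The support of \<open>k\<close> lies in both \<open>{0..r}\<close> and
      \<open>{l..r + l}\<close>, so the shift by \<open>l\<close> preserves the integral.\<close>
    have k0: "k s = 0" if "s \<notin> {l..r}" for s
      using that by (auto simp: k_def gi_def cutoff_eq_0)
    obtain I where I: "(k has_integral I) {0..r}"
      using integrable_continuous_real[OF kc] by blast
    have "(k has_integral I) UNIV" by (rule has_integral_on_superset[OF I]) (use l k0 in auto)
    moreover obtain I' where I': "(k has_integral I') {l..r + l}"
      using integrable_continuous_real[OF kc] by blast
    moreover have "(k has_integral I') UNIV" by (rule has_integral_on_superset[OF I']) (use l k0 in auto)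
    ultimately have "(k has_integral I) {l..r + l}" using has_integral_unique by blast
    from has_integral_affinity'[of k I l "r + l" 1 l] this
    have "((\<lambda>t. k (t + l)) has_integral I) {0..r}" by simp
    then have "((\<lambda>t. cutoff r (t + l) *\<^sub>R gin t) has_integral I) {0..r}"
      by (rule has_integral_eq[rotated]) (use gin(2) in \<open>auto simp: k_def gi_def\<close>)
    from has_integral_diff[OF this int[OF r]]
    have "((\<lambda>t. cutoff r t *\<^sub>R gout t) has_integral I) {0..r}" by simp
    from has_integral_diff[OF I this] show ?thesis by (simp add: k_def G_def scaleR_diff_right)
  qed
  then have "G t = 0" if "0 < t" using cutoff_integrals_zero_imp_zero[OF Gc _ that] by blast
  moreover have "G 0 = 0" using l gout(2) by (simp add: G_def gi_def)
  ultimately have "G t = 0" using t by (cases "t = 0") auto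
  then show ?thesis using gin(2) by (auto simp: G_def gi_def split: if_splits)
qed


section \<open>The state space and matrix calculus\<close>

lemma bounded_bilinear_matrix_vector_mult:
  "bounded_bilinear ((*v) :: 'k::rc_field^'m^'n \<Rightarrow> 'k^'m \<Rightarrow> 'k^'n)"
  unfolding bilinear_conv_bounded_bilinear[symmetric] bilinear_def
  by (intro conjI allI linearI)
    (simp_all add: vec_eq_iff matrix_vector_mult_def distrib_left distrib_right sum.distrib scaleR_sum_right)

lemma bounded_bilinear_matrix_matrix_mult:
  "bounded_bilinear ((**) :: 'k::rc_field^'m^'n \<Rightarrow> 'k^'l^'m \<Rightarrow> 'k^'l^'n)"
  unfolding bilinear_conv_bounded_bilinear[symmetric] bilinear_def
  by (intro conjI allI linearI)
    (simp_all add: vec_eq_iff matrix_matrix_mult_def distrib_left distrib_right sum.distrib scaleR_sum_right)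

lemma to_complex_diff: "to_complex (x - y) = to_complex x - to_complex (y :: 'k::rc_field)"
  using to_complex_add[of "x - y" y] by simp

lemma inj_to_complex: "inj (to_complex :: 'k::rc_field \<Rightarrow> complex)"
  by (rule injI) (metis norm_to_complex norm_eq_zero right_minus_eq to_complex_diff)

lemma linear_kcnj: "linear (kcnj :: 'k::rc_field \<Rightarrow> 'k)"
  by (intro linearI; rule injD[OF inj_to_complex])
    (simp_all add: to_complex_kcnj to_complex_add to_complex_scaleR)

lemma bounded_linear_kre: "bounded_linear (kre :: 'k::rc_field \<Rightarrow> real)"
  unfolding linear_conv_bounded_linear[symmetric]
  by (intro linearI) (simp_all add: kre_def to_complex_add to_complex_scaleR)

lemma bounded_bilinear_kdot: "bounded_bilinear (kdot :: 'k::rc_field^'n \<Rightarrow> 'k^'n \<Rightarrow> 'k)"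
  unfolding bilinear_conv_bounded_bilinear[symmetric] bilinear_def
  by (intro conjI allI linearI)
    (simp_all add: kdot_def linear_add[OF linear_kcnj] linear_scale[OF linear_kcnj] distrib_left
      distrib_right sum.distrib scaleR_sum_right)

lemma kre_kdot_self: "kre (kdot v v) = (norm (v :: 'k::rc_field^'n))\<^sup>2"
proof -
  have pointwise: "kre (kcnj x * x) = (norm x)\<^sup>2" for x :: 'k
    unfolding norm_to_complex[of x, symmetric] cmod_power2
    by (simp add: kre_def to_complex_mult to_complex_kcnj power2_eq_square)
  have "kre (kdot v v) = (\<Sum>i\<in>UNIV. kre (kcnj (v $ i) * v $ i))"
    unfolding kdot_def by (rule linear_sum[OF bounded_linear.linear[OF bounded_linear_kre]])
  also have "\<dots> = (norm v)\<^sup>2"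
    by (simp add: pointwise norm_vec_def L2_set_def sum_nonneg)
  finally show ?thesis .
qed

lemma L2_cmult_diff:
  assumes "f \<in> L2 a b" "g \<in> L2 a b"
  shows "(\<lambda>\<xi>. c *\<^sub>R f \<xi> - g \<xi>) \<in> L2 a b"
proof -
  have [measurable]: "f \<in> borel_measurable (lebesgue_on {a..b})" "g \<in> borel_measurable (lebesgue_on {a..b})"
    using assms by (auto simp: L2_def)
  have "integrable (lebesgue_on {a..b}) (\<lambda>\<xi>. (norm (c *\<^sub>R f \<xi> - g \<xi>))\<^sup>2)"
  proof (rule Bochner_Integration.integrable_bound)
    show "integrable (lebesgue_on {a..b}) (\<lambda>\<xi>. 2 * c\<^sup>2 * (norm (f \<xi>))\<^sup>2 + 2 * (norm (g \<xi>))\<^sup>2)"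
      using assms by (auto simp: L2_def)
    show "AE \<xi> in lebesgue_on {a..b}. norm ((norm (c *\<^sub>R f \<xi> - g \<xi>))\<^sup>2) \<le> norm (2 * c\<^sup>2 * (norm (f \<xi>))\<^sup>2 + 2 * (norm (g \<xi>))\<^sup>2)"
    proof (intro AE_I2)
      fix \<xi>
      have "(norm (c *\<^sub>R f \<xi> - g \<xi>))\<^sup>2 \<le> (\<bar>c\<bar> * norm (f \<xi>) + norm (g \<xi>))\<^sup>2"
        by (intro power_mono order_trans[OF norm_triangle_ineq4]) auto
      also have "\<dots> \<le> 2 * (\<bar>c\<bar> * norm (f \<xi>))\<^sup>2 + 2 * (norm (g \<xi>))\<^sup>2"
        using sum_squares_bound[of "\<bar>c\<bar> * norm (f \<xi>)" "norm (g \<xi>)"] by (simp add: power2_sum)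
      finally show "norm ((norm (c *\<^sub>R f \<xi> - g \<xi>))\<^sup>2) \<le> norm (2 * c\<^sup>2 * (norm (f \<xi>))\<^sup>2 + 2 * (norm (g \<xi>))\<^sup>2)"
        by (simp add: power_mult_distrib)
    qed
  qed measurable
  then show ?thesis by (simp add: L2_def)
qed

lemma L2_integrable:
  fixes f :: "real \<Rightarrow> 'v::euclidean_space"
  assumes "f \<in> L2 a b"
  shows "integrable (lebesgue_on {a..b}) f"
proof (rule Bochner_Integration.integrable_bound)
  show "integrable (lebesgue_on {a..b}) (\<lambda>\<xi>. 1 + (norm (f \<xi>))\<^sup>2)"
    using assms by (auto simp: L2_def)
  show "f \<in> borel_measurable (lebesgue_on {a..b})" using assms by (simp add: L2_def)
  show "AE \<xi> in lebesgue_on {a..b}. norm (f \<xi>) \<le> norm (1 + (norm (f \<xi>))\<^sup>2)"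
  proof (intro AE_I2)
    fix \<xi>
    have "0 \<le> (norm (f \<xi>) - 1)\<^sup>2 + 1" by simp
    then have "2 * norm (f \<xi>) \<le> 2 + (norm (f \<xi>))\<^sup>2" by (simp add: power2_diff)
    moreover have "norm (1 + (norm (f \<xi>))\<^sup>2) = 1 + (norm (f \<xi>))\<^sup>2" by simp
    ultimately show "norm (f \<xi>) \<le> norm (1 + (norm (f \<xi>))\<^sup>2)"
      using zero_le_power2[of "norm (f \<xi>)"] by linarith
  qed
qed

text \<open>Cauchy-Schwarz against the constant 1, obtained as nonnegativity of the variance about
  the mean \<open>c\<close>.\<close>

lemma L1_le_L2:
  fixes f :: "real \<Rightarrow> 'v::euclidean_space"
  assumes ab: "a < b" and f: "f \<in> L2 a b"
  shows "(LINT \<xi>|lebesgue_on {a..b}. norm (f \<xi>))\<^sup>2 \<le> (b - a) * (LINT \<xi>|lebesgue_on {a..b}. (norm (f \<xi>))\<^sup>2)"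
proof -
  let ?M = "lebesgue_on {a..b}"
  define c where "c = (LINT \<xi>|?M. norm (f \<xi>)) / (b - a)"
  have i1: "integrable ?M (\<lambda>\<xi>. norm (f \<xi>))" using L2_integrable[OF f] by simp
  have i2: "integrable ?M (\<lambda>\<xi>. (norm (f \<xi>))\<^sup>2)" using f by (simp add: L2_def)
  have meas: "measure ?M {a..b} = b - a"
    using ab by (simp add: measure_restrict_space)
  have "0 \<le> (LINT \<xi>|?M. (norm (f \<xi>) - c)\<^sup>2)" by simp
  also have "\<dots> = (LINT \<xi>|?M. (norm (f \<xi>))\<^sup>2 - 2 * c * norm (f \<xi>) + c\<^sup>2)"
    by (intro Bochner_Integration.integral_cong refl) (simp add: power2_diff)
  also have "\<dots> = (LINT \<xi>|?M. (norm (f \<xi>))\<^sup>2) - 2 * c * (LINT \<xi>|?M. norm (f \<xi>)) + c\<^sup>2 * (b - a)"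
    using i1 i2 meas by simp
  also have "\<dots> = (LINT \<xi>|?M. (norm (f \<xi>))\<^sup>2) - (LINT \<xi>|?M. norm (f \<xi>))\<^sup>2 / (b - a)"
  proof -
    have "c\<^sup>2 * (b - a) = c * (LINT \<xi>|?M. norm (f \<xi>))"
      using ab by (simp add: c_def power2_eq_square)
    moreover have "(LINT \<xi>|?M. norm (f \<xi>))\<^sup>2 / (b - a) = c * (LINT \<xi>|?M. norm (f \<xi>))"
      by (simp add: c_def power2_eq_square)
    ultimately show ?thesis by linarith
  qed
  finally show ?thesis using ab by (simp add: field_simps)
qed

text \<open>Solutions are differentiable in the norm of X, whereas the transport argument runs in L1
  for each component; coercivity of \<open>H\<close> on a bounded interval links the two.\<close>

lemma L1_le_X_norm:
  fixes H :: "real \<Rightarrow> 'k::rc_field^'n^'n"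
  assumes ab: "a < b" and H: "H \<in> Linf a b" and m0: "m0 > 0"
    and pos: "AE \<xi> in lebesgue_on {a..b}. loewner_le (mat (of_real m0)) (H \<xi>)"
  obtains C where "C \<ge> 0" "\<And>f. f \<in> L2 a b \<Longrightarrow> (LINT \<xi>|lebesgue_on {a..b}. norm (f \<xi>)) \<le> C * X_norm a b H f"
proof
  let ?M = "lebesgue_on {a..b}"
  \<comment> \<open>The 2 undoes the factor 1/2 in \<open>X_inner\<close>, \<open>b - a\<close>
    comes from Cauchy-Schwarz and \<open>m0\<close> from coercivity.\<close>
  define C where "C = sqrt (2 * (b - a) / m0)"
  show "C \<ge> 0" using ab m0 by (simp add: C_def)
  fix f :: "real \<Rightarrow> 'k^'n" assume f: "f \<in> L2 a b"
  interpret kd: bounded_bilinear "kdot :: 'k^'n \<Rightarrow> 'k^'n \<Rightarrow> 'k" by (rule bounded_bilinear_kdot)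
  interpret mv: bounded_bilinear "(*v) :: 'k^'n^'n \<Rightarrow> 'k^'n \<Rightarrow> 'k^'n" by (rule bounded_bilinear_matrix_vector_mult)
  interpret kr: bounded_linear "kre :: 'k \<Rightarrow> real" by (rule bounded_linear_kre)
  have fm: "f \<in> borel_measurable ?M" and f2: "integrable ?M (\<lambda>\<xi>. (norm (f \<xi>))\<^sup>2)" using f by (auto simp: L2_def)
  obtain CH where Hm: "H \<in> borel_measurable ?M" and CH: "AE \<xi> in ?M. norm (H \<xi>) \<le> CH"
    using H by (auto simp: Linf_def)
  have Hfm: "(\<lambda>\<xi>. H \<xi> *v f \<xi>) \<in> borel_measurable ?M"
    by (rule borel_measurable_continuous_Pair[OF Hm fm])
      (intro mv.continuous_on continuous_on_fst continuous_on_snd continuous_on_id)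
  have km: "(\<lambda>\<xi>. kdot (H \<xi> *v f \<xi>) (f \<xi>)) \<in> borel_measurable ?M"
    by (rule borel_measurable_continuous_Pair[OF Hfm fm])
      (intro kd.continuous_on continuous_on_fst continuous_on_snd continuous_on_id)
  obtain K1 where K1: "K1 > 0" "\<And>x y :: 'k^'n. norm (kdot x y) \<le> norm x * norm y * K1" using kd.pos_bounded by blast
  obtain K2 where K2: "K2 > 0" "\<And>(A::'k^'n^'n) y. norm (A *v y) \<le> norm A * norm y * K2" using mv.pos_bounded by blast
  \<comment> \<open>The integral of a non-integrable function is 0 by convention, and
    \<open>X_norm\<close> would then control nothing; the bound on \<open>H\<close> excludes
    this.\<close>
  have ki: "integrable ?M (\<lambda>\<xi>. kdot (H \<xi> *v f \<xi>) (f \<xi>))"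
  proof (rule Bochner_Integration.integrable_bound[OF _ km])
    show "integrable ?M (\<lambda>\<xi>. (K1 * K2 * CH) * (norm (f \<xi>))\<^sup>2)" using f2 by auto
    show "AE \<xi> in ?M. norm (kdot (H \<xi> *v f \<xi>) (f \<xi>)) \<le> norm ((K1 * K2 * CH) * (norm (f \<xi>))\<^sup>2)"
      using CH
    proof eventually_elim
      case (elim \<xi>)
      have "norm (kdot (H \<xi> *v f \<xi>) (f \<xi>)) \<le> norm (H \<xi> *v f \<xi>) * (norm (f \<xi>) * K1)"
        using K1(2)[of "H \<xi> *v f \<xi>" "f \<xi>"] by (simp add: mult_ac)
      also have "\<dots> \<le> (norm (H \<xi>) * (norm (f \<xi>) * K2)) * (norm (f \<xi>) * K1)"
        using K2(2)[of "H \<xi>" "f \<xi>"] K1(1) by (intro mult_right_mono) (auto simp: mult_ac)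
      also have "\<dots> \<le> (CH * (norm (f \<xi>) * K2)) * (norm (f \<xi>) * K1)"
        using elim K1(1) K2(1) by (intro mult_right_mono) auto
      also have "\<dots> = (K1 * K2 * CH) * (norm (f \<xi>))\<^sup>2" by (simp add: power2_eq_square mult_ac)
      also have "\<dots> \<le> norm ((K1 * K2 * CH) * (norm (f \<xi>))\<^sup>2)" by simp
      finally show ?case .
    qed
  qed
  have "X_norm a b H f = sqrt (kre ((1 / 2) * (LINT \<xi>|?M. kdot (H \<xi> *v f \<xi>) (f \<xi>))))"
    by (simp add: X_norm_def X_inner_def)
  also have "kre ((1 / 2) * (LINT \<xi>|?M. kdot (H \<xi> *v f \<xi>) (f \<xi>))) = (1 / 2) * (LINT \<xi>|?M. kre (kdot (H \<xi> *v f \<xi>) (f \<xi>)))"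
  proof -
    have "kre ((1 / 2 :: 'k) * c) = (1 / 2) * kre c" for c
      using kr.scaleR[of "1 / 2" c] by (simp add: scaleR_conv_of_real)
    then show ?thesis
      by (simp only: integral_bounded_linear[OF bounded_linear_kre ki])
  qed
  finally have X: "X_norm a b H f = sqrt ((1 / 2) * (LINT \<xi>|?M. kre (kdot (H \<xi> *v f \<xi>) (f \<xi>))))" .
  have "m0 * (LINT \<xi>|?M. (norm (f \<xi>))\<^sup>2) = (LINT \<xi>|?M. m0 * (norm (f \<xi>))\<^sup>2)" by simp
  also have "\<dots> \<le> (LINT \<xi>|?M. kre (kdot (H \<xi> *v f \<xi>) (f \<xi>)))"
  proof (rule integral_mono_AE)
    show "integrable ?M (\<lambda>\<xi>. m0 * (norm (f \<xi>))\<^sup>2)" using f2 by simp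
    show "integrable ?M (\<lambda>\<xi>. kre (kdot (H \<xi> *v f \<xi>) (f \<xi>)))"
      by (rule integrable_bounded_linear[OF bounded_linear_kre ki])
    show "AE \<xi> in ?M. m0 * (norm (f \<xi>))\<^sup>2 \<le> kre (kdot (H \<xi> *v f \<xi>) (f \<xi>))"
      using pos
    proof eventually_elim
      case (elim \<xi>)
      have "(mat (of_real m0) :: 'k^'n^'n) *v f \<xi> = m0 *\<^sub>R f \<xi>"
        by (simp add: vec_eq_iff matrix_vector_mult_def mat_def if_distrib[of "\<lambda>x. x * _"] sum.delta'
            cong: if_cong flip: scaleR_conv_of_real)
      then have "kdot ((H \<xi> - mat (of_real m0)) *v f \<xi>) (f \<xi>) = kdot (H \<xi> *v f \<xi>) (f \<xi>) - m0 *\<^sub>R kdot (f \<xi>) (f \<xi>)"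
        by (simp add: mv.diff_left kd.diff_left kd.scaleR_left)
      then have "0 \<le> kre (kdot (H \<xi> *v f \<xi>) (f \<xi>)) - m0 * (norm (f \<xi>))\<^sup>2"
        using elim unfolding loewner_le_def by (metis kr.diff kr.scaleR kre_kdot_self real_scaleR_def)
      then show ?case by simp
    qed
  qed
  finally have le: "(LINT \<xi>|?M. (norm (f \<xi>))\<^sup>2) \<le> (LINT \<xi>|?M. kre (kdot (H \<xi> *v f \<xi>) (f \<xi>))) / m0"
    using m0 by (simp add: field_simps)
  have "(LINT \<xi>|?M. norm (f \<xi>))\<^sup>2 \<le> (b - a) * (LINT \<xi>|?M. (norm (f \<xi>))\<^sup>2)"
    by (rule L1_le_L2[OF ab f])
  also have "\<dots> \<le> (b - a) * ((LINT \<xi>|?M. kre (kdot (H \<xi> *v f \<xi>) (f \<xi>))) / m0)"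
    using ab le by (intro mult_left_mono) auto
  also have "\<dots> = (2 * (b - a) / m0) * ((1 / 2) * (LINT \<xi>|?M. kre (kdot (H \<xi> *v f \<xi>) (f \<xi>))))"
    using m0 by (simp add: field_simps)
  finally have "(LINT \<xi>|?M. norm (f \<xi>)) \<le> sqrt ((2 * (b - a) / m0) * ((1 / 2) * (LINT \<xi>|?M. kre (kdot (H \<xi> *v f \<xi>) (f \<xi>)))))"
    by (rule real_le_rsqrt)
  then show "(LINT \<xi>|?M. norm (f \<xi>)) \<le> C * X_norm a b H f"
    unfolding X C_def real_sqrt_mult .
qed

lemma matrix_inv_mult:
  fixes A :: "'k::field^'n^'n"
  assumes "invertible A"
  shows "matrix_inv A ** A = mat 1" "A ** matrix_inv A = mat 1"
  using someI_ex[OF assms[unfolded invertible_def]] by (simp_all add: matrix_inv_def)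

lemma has_vector_derivative_iff_quotient:
  "(f has_vector_derivative D) (at t within A) \<longleftrightarrow> ((\<lambda>s. (1 / (s - t)) *\<^sub>R (f s - f t)) \<longlongrightarrow> D) (at t within A)"
proof -
  have "((\<lambda>s. (1 / norm (s - t)) *\<^sub>R (f s - (f t + (s - t) *\<^sub>R D))) \<longlongrightarrow> 0) (at t within A) \<longleftrightarrow>
    ((\<lambda>s. norm ((1 / norm (s - t)) *\<^sub>R (f s - (f t + (s - t) *\<^sub>R D)))) \<longlongrightarrow> 0) (at t within A)"
    by (rule tendsto_norm_zero_iff[symmetric])
  also have "\<dots> \<longleftrightarrow> ((\<lambda>s. norm ((1 / (s - t)) *\<^sub>R (f s - f t) - D)) \<longlongrightarrow> 0) (at t within A)"
  proof (rule filterlim_cong[OF refl refl])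
    have "norm ((1 / norm (s - t)) *\<^sub>R (f s - (f t + (s - t) *\<^sub>R D))) = norm ((1 / (s - t)) *\<^sub>R (f s - f t) - D)"
      if "s \<noteq> t" for s
    proof -
      have "(1 / (s - t)) *\<^sub>R (f s - f t) - D = (1 / (s - t)) *\<^sub>R (f s - (f t + (s - t) *\<^sub>R D))"
        using that by (simp add: scaleR_diff_right scaleR_add_right)
      then show ?thesis by simp
    qed
    then show "\<forall>\<^sub>F s in at t within A. norm ((1 / norm (s - t)) *\<^sub>R (f s - (f t + (s - t) *\<^sub>R D))) = norm ((1 / (s - t)) *\<^sub>R (f s - f t) - D)"
      unfolding eventually_at_filter by (intro always_eventually) blast
  qed
  also have "\<dots> \<longleftrightarrow> ((\<lambda>s. (1 / (s - t)) *\<^sub>R (f s - f t)) \<longlongrightarrow> D) (at t within A)"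
    by (simp add: tendsto_norm_zero_iff LIM_zero_iff)
  finally show ?thesis
    unfolding has_vector_derivative_def has_derivative_within by (simp add: bounded_linear_scaleR_left)
qed

text \<open>Divide \<open>R s - R t = - R s (S s - S t) R t\<close> by \<open>s - t\<close>, where
  \<open>R\<close> is the inverse. The limit needs continuity of \<open>R\<close>, which comes from
  the same identity by absorption.\<close>

lemma has_vector_derivative_matrix_inv:
  fixes S :: "real \<Rightarrow> 'k::rc_field^'n^'n"
  assumes S: "(S has_vector_derivative S') (at t within A)" and t: "t \<in> A"
    and inv: "\<And>s. s \<in> A \<Longrightarrow> invertible (S s)"
  shows "((\<lambda>s. matrix_inv (S s)) has_vector_derivative (- (matrix_inv (S t) ** S' ** matrix_inv (S t)))) (at t within A)"
proof -
  interpret mm: bounded_bilinear "(**) :: 'k^'n^'n \<Rightarrow> 'k^'n^'n \<Rightarrow> 'k^'n^'n" by (rule bounded_bilinear_matrix_matrix_mult)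
  obtain K where K: "K > 0" "\<And>(A::'k^'n^'n) (B::'k^'n^'n). norm (A ** B) \<le> norm A * norm B * K" using mm.pos_bounded by blast
  define R where "R s = matrix_inv (S s)" for s
  have RS: "R s ** S s = mat 1" "S s ** R s = mat 1" if "s \<in> A" for s
    using matrix_inv_mult[OF inv[OF that]] by (simp_all add: R_def)
  have diff: "R s - R t = - (R s ** (S s - S t) ** R t)" if s: "s \<in> A" for s
  proof -
    have "R s ** (S s - S t) ** R t = (R s ** S s) ** R t - R s ** (S t ** R t)"
      by (simp add: mm.diff_left mm.diff_right matrix_mul_assoc)
    then show ?thesis using RS[OF s] RS[OF t] by simp
  qed
  have Sc: "(S \<longlongrightarrow> S t) (at t within A)"
    using has_vector_derivative_continuous[OF S] by (simp add: continuous_within)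
  have "((\<lambda>s. K * (K * norm (S s - S t) * norm (R t))) \<longlongrightarrow> K * (K * norm (S t - S t) * norm (R t))) (at t within A)"
    by (intro tendsto_intros Sc)
  then have "((\<lambda>s. K * (K * norm (S s - S t) * norm (R t))) \<longlongrightarrow> 0) (at t within A)" by simp
  \<comment> \<open>Makes the coefficient of \<open>norm (R s)\<close> less than 1/2, whence
    \<open>norm (R s) \<le> 2 * norm (R t)\<close>.\<close>
  then have small: "\<forall>\<^sub>F s in at t within A. K * (K * norm (S s - S t) * norm (R t)) < 1 / 2"
    by (rule order_tendstoD) simp
  have in_A: "\<forall>\<^sub>F s in at t within A. s \<in> A"
    unfolding eventually_at_filter by (intro always_eventually) blast
  have nd: "norm (R s - R t) \<le> norm (R s) * (K * (K * norm (S s - S t) * norm (R t)))" if "s \<in> A" for s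
  proof -
    have "norm (R s - R t) \<le> norm (R s ** (S s - S t)) * norm (R t) * K"
      unfolding diff[OF that] norm_minus_cancel by (rule K)
    also have "\<dots> \<le> (norm (R s) * norm (S s - S t) * K) * norm (R t) * K"
      using K by (intro mult_right_mono) auto
    finally show ?thesis by (simp add: mult_ac)
  qed
  have "((\<lambda>s. R s - R t) \<longlongrightarrow> 0) (at t within A)"
  proof (rule Lim_null_comparison)
    show "\<forall>\<^sub>F s in at t within A. norm (R s - R t) \<le> 2 * norm (R t) * (K * (K * norm (S s - S t) * norm (R t)))"
      using small in_A
    proof eventually_elim
      case (elim s)
      have "norm (R s) \<le> norm (R t) + norm (R s - R t)" using norm_triangle_ineq[of "R t" "R s - R t"] by simp
      also have "\<dots> \<le> norm (R t) + norm (R s) * (1 / 2)"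
        using nd[OF elim(2)] elim(1) by (smt (verit, best) mult_left_mono norm_ge_zero)
      finally have "norm (R s) \<le> 2 * norm (R t)" by simp
      then show ?case using nd[OF elim(2)] K(1)
        by (elim order_trans) (intro mult_right_mono; auto)
    qed
    have "((\<lambda>s. 2 * norm (R t) * (K * (K * norm (S s - S t) * norm (R t)))) \<longlongrightarrow> 2 * norm (R t) * (K * (K * norm (S t - S t) * norm (R t)))) (at t within A)"
      by (intro tendsto_intros Sc)
    then show "((\<lambda>s. 2 * norm (R t) * (K * (K * norm (S s - S t) * norm (R t)))) \<longlongrightarrow> 0) (at t within A)" by simp
  qed
  then have Rc: "(R \<longlongrightarrow> R t) (at t within A)" by (simp add: LIM_zero_iff)
  have "((\<lambda>s. - (R s ** ((1 / (s - t)) *\<^sub>R (S s - S t)) ** R t)) \<longlongrightarrow> - (R t ** S' ** R t)) (at t within A)"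
    using S unfolding has_vector_derivative_iff_quotient
    by (intro tendsto_minus mm.tendsto Rc tendsto_const)
  then have "((\<lambda>s. (1 / (s - t)) *\<^sub>R (R s - R t)) \<longlongrightarrow> - (R t ** S' ** R t)) (at t within A)"
    by (rule Lim_transform_eventually)
      (rule eventually_mono[OF in_A], simp add: diff mm.scaleR_left mm.scaleR_right)
  then show ?thesis
    unfolding has_vector_derivative_iff_quotient R_def .
qed

text \<open>Serves to recover the boundary values of the state from input and output
  together.\<close>

lemma full_rank_left_inverse:
  fixes A :: "'k::field^'n^'n"
  assumes "rank A = CARD('n)"
  obtains B where "B ** A = mat 1"
proof -
  have "vec.dim (rows A) = vec.dimension TYPE('k) TYPE('n)"
    using assms by (simp add: row_rank_def_gen vec.dimension_def card_cart_basis)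
  then have "vec.span (rows A) = UNIV" by (simp add: vec.dim_eq_full)
  then show ?thesis using matrix_left_invertible_span_rows_gen[of A] that by blast
qed

text \<open>The exceptional points of the open interval form an open null set, so there are none;
  the end points follow by closure.\<close>

lemma continuous_AE_lebesgue_on_mem_closed:
  fixes f :: "real \<Rightarrow> 'v::topological_space"
  assumes ab: "a < b" and C: "closed C" and f: "continuous_on {a..b} f"
    and ae: "AE \<xi> in lebesgue_on {a..b}. f \<xi> \<in> C" and \<xi>: "\<xi> \<in> {a..b}"
  shows "f \<xi> \<in> C"
proof -
  have cl: "closure {a<..<b} = {a..b}" using ab by simp
  have "AE \<xi> in lebesgue. \<xi> \<in> {a..b} \<longrightarrow> f \<xi> \<in> C"
    using ae by (subst (asm) AE_restrict_space_iff) auto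
  then obtain N where N: "N \<in> null_sets lebesgue" "{\<xi>. \<not> (\<xi> \<in> {a..b} \<longrightarrow> f \<xi> \<in> C)} \<subseteq> N"
    unfolding eventually_ae_filter by auto
  define U where "U = {a<..<b} \<inter> f -` (- C)"
  have "open U" unfolding U_def
    by (rule continuous_open_preimage[OF continuous_on_subset[OF f]]) (use C in auto)
  moreover have "negligible U"
    using N by (intro negligible_subset[of N U]) (auto simp: U_def negligible_iff_null_sets)
  ultimately have "U = {}" using open_not_negligible by blast
  then have "f ` {a<..<b} \<subseteq> C" by (auto simp: U_def)
  then have "f ` closure {a<..<b} \<subseteq> C"
    by (intro image_closure_subset C) (use f cl in auto)
  then show ?thesis using \<xi> cl by auto
qed


section \<open>The diagonalised system\<close>

lemma sum_UNIV_sum: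
  fixes f :: "'a::finite + 'b::finite \<Rightarrow> 'c::comm_monoid_add"
  shows "(\<Sum>j\<in>UNIV. f j) = (\<Sum>i\<in>UNIV. f (Inl i)) + (\<Sum>i\<in>UNIV. f (Inr i))"
  unfolding UNIV_Plus_UNIV[symmetric] by (subst sum.Plus) simp_all

lemma vstack_nth [simp]: "vstack v w $ Inl i = v $ i" "vstack v w $ Inr i = w $ i"
  by (simp_all add: vstack_def)

lemma hcat_mult_vstack: "hcat A B *v vstack v w = A *v v + B *v w"
  by (simp add: vec_eq_iff hcat_def matrix_vector_mult_def sum_UNIV_sum)

lemma vcat_mult: "vcat A B *v q = vstack (A *v q) (B *v q)"
proof -
  have "(vcat A B *v q) $ j = vstack (A *v q) (B *v q) $ j" for j
    by (cases j) (simp_all add: vcat_def matrix_vector_mult_def)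
  then show ?thesis by (simp add: vec_eq_iff)
qed

lemma block_diag_mult_vstack: "block_diag A B *v vstack v w = vstack (A *v v) (B *v (w :: 'k::semiring_1^'n))"
  by (simp add: block_diag_def vcat_mult hcat_mult_vstack)

lemma diag_mat_mult_nth: "(diag_mat d *v v) $ i = d i * (v :: 'k::semiring_1^'n) $ i"
  by (simp add: diag_mat_def matrix_vector_mult_def if_distrib[of "\<lambda>x. x * _"] sum.delta cong: if_cong)

lemma P1D_P1D_mult: "P1D m *v (P1D m *v v) = v"
  by (simp add: vec_eq_iff P1D_def diag_mat_mult_nth)

lemma P1D_P1D: "P1D m ** P1D m = (mat 1 :: ('k::rc_field, 'n::{finite,linorder}) sq_matrix)"
  by (simp add: matrix_eq P1D_P1D_mult flip: matrix_vector_mul_assoc)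

text \<open>Here \<open>z\<close> is \<open>S x\<close>, and \<open>g\<close> is the absolutely
  continuous representative of \<open>HD z\<close>, whose end values are the traces. With
  \<open>w\<close> representing \<open>H x\<close>, the hypothesis on \<open>P0D\<close> makes
  \<open>S (P1 v + P0 w)\<close> the derivative of \<open>S P1 w\<close>: no zero-order term couples
  the components.\<close>

lemma diagonalised_solution:
  fixes P1 :: "('k::rc_field, 'n::{finite,linorder}) sq_matrix"
    and P0 H S HD :: "real \<Rightarrow> ('k, 'n) sq_matrix"
    and WB WC :: "('k, 'n) n_2n_matrix"
  assumes ab: "a < b"
    and sa: "standing_assumptions a b P1 P0 H WB WC"
    and dg: "diagonalisation a b P1 H m S HD"
    and P0D: "\<forall>\<xi>\<in>{a..b}. P0D a b P1 P0 m S \<xi> = 0"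
    and cs: "classical_solution a b P1 P0 H WB WC (\<lambda>_. 0) u x y"
  obtains g z dz :: "real \<Rightarrow> real \<Rightarrow> ('k, 'n) vec" where
    "\<And>t. t \<ge> 0 \<Longrightarrow> integrable (lebesgue_on {a..b}) (z t)"
    "\<And>t. t \<ge> 0 \<Longrightarrow> integrable (lebesgue_on {a..b}) (dz t)"
    "\<And>t k. t \<ge> 0 \<Longrightarrow> ((\<lambda>s. LINT \<xi>|lebesgue_on {a..b}.
        norm ((1 / (s - t)) *\<^sub>R (z s \<xi> $ k - z t \<xi> $ k) - dz t \<xi> $ k)) \<longlongrightarrow> 0) (at t within {0..})"
    "AE \<xi> in lebesgue_on {a..b}. z 0 \<xi> = 0"
    "\<And>t \<xi>. t \<ge> 0 \<Longrightarrow> \<xi> \<in> {a..b} \<Longrightarrow> (dz t has_integral P1D m *v (g t \<xi> - g t a)) {a..\<xi>}"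
    "\<And>t. t \<ge> 0 \<Longrightarrow> AE \<xi> in lebesgue_on {a..b}. HD \<xi> *v z t \<xi> = g t \<xi>"
    "\<And>t. t \<ge> 0 \<Longrightarrow> u t = WD a b P1 m S WB *v vstack (g t b) (g t a)"
    "\<And>t. t \<ge> 0 \<Longrightarrow> y t = WD a b P1 m S WC *v vstack (g t b) (g t a)"
    "continuous_on {0..} (\<lambda>t. g t a)" "continuous_on {0..} (\<lambda>t. g t b)"
    "g 0 a = 0" "g 0 b = 0"
proof -
  let ?M = "lebesgue_on {a..b}"
  interpret mv: bounded_bilinear "(*v) :: ('k, 'n) sq_matrix \<Rightarrow> ('k, 'n) vec \<Rightarrow> ('k, 'n) vec" by (rule bounded_bilinear_matrix_vector_mult)
  interpret mm: bounded_bilinear "(**) :: ('k, 'n) sq_matrix \<Rightarrow> ('k, 'n) sq_matrix \<Rightarrow> ('k, 'n) sq_matrix"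
    by (rule bounded_bilinear_matrix_matrix_mult)
  obtain m0 where m0: "m0 > 0" and H: "H \<in> Linf a b" and P1: "invertible P1"
    and pos: "AE \<xi> in ?M. loewner_le (mat (of_real m0)) (H \<xi>)"
    and rank: "rank (vcat WB WC) = 2 * CARD('n)"
    using sa unfolding standing_assumptions_def by (auto elim!: eventually_mono)
  obtain C where C: "C \<ge> 0" "\<And>f. f \<in> L2 a b \<Longrightarrow> (LINT \<xi>|?M. norm (f \<xi>)) \<le> C * X_norm a b H f"
    using L1_le_X_norm[OF ab H m0 pos] by blast
  obtain S' where S: "\<And>\<xi>. \<xi> \<in> {a..b} \<Longrightarrow> (S has_vector_derivative S' \<xi>) (at \<xi> within {a..b})"
    and S'c: "continuous_on {a..b} S'"
    using dg unfolding diagonalisation_def C1_interval_def by blast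
  have Sinv: "invertible (S \<xi>)" if "\<xi> \<in> {a..b}" for \<xi>
    using dg that unfolding diagonalisation_def by blast
  have fac: "AE \<xi> in ?M. P1 ** H \<xi> = matrix_inv (S \<xi>) ** P1D m ** HD \<xi> ** S \<xi>"
    using dg unfolding diagonalisation_def ae_eq_def by blast
  have Sc: "continuous_on {a..b} S"
    using S by (meson continuous_on_eq_continuous_within has_vector_derivative_continuous)
  obtain B where B: "\<And>\<xi>. \<xi> \<in> {a..b} \<Longrightarrow> norm (S \<xi>) \<le> B"
    using compact_imp_bounded[OF compact_continuous_image[OF Sc compact_Icc]] unfolding bounded_iff by blast
  have B0: "0 \<le> B" using B[of a] ab norm_ge_zero[of "S a"] by (meson atLeastAtMost_iff less_imp_le order_refl order_trans)
  obtain K where K: "K > 0" "\<And>(A::('k, 'n) sq_matrix) v. norm (A *v v) \<le> norm A * norm v * K" using mv.pos_bounded by blast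
  \<comment> \<open>What \<open>P0D = 0\<close> says once the derivative of the inverse is inserted
    and the invertible outer factors are cancelled.\<close>
  have SP0: "S \<xi> ** P0 \<xi> = S' \<xi> ** P1" if \<xi>: "\<xi> \<in> {a..b}" for \<xi>
  proof -
    define R where "R = matrix_inv (S \<xi>)"
    have R: "R ** S \<xi> = mat 1" "S \<xi> ** R = mat 1" using matrix_inv_mult[OF Sinv[OF \<xi>]] by (simp_all add: R_def)
    have vd: "vector_derivative (\<lambda>\<eta>. matrix_inv (S \<eta>)) (at \<xi> within {a..b}) = - (R ** S' \<xi> ** R)"
      unfolding R_def
      by (rule vector_derivative_within_closed_interval[OF ab \<xi> has_vector_derivative_matrix_inv[OF S[OF \<xi>] \<xi> Sinv]])
    have "S \<xi> ** (- (R ** S' \<xi> ** R) + P0 \<xi> ** matrix_inv P1 ** R) ** P1D m = 0"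
      using bspec[OF P0D \<xi>] unfolding P0D_def vd unfolding R_def .
    then have "R ** (S \<xi> ** (- (R ** S' \<xi> ** R) + P0 \<xi> ** matrix_inv P1 ** R) ** P1D m) ** P1D m ** S \<xi> ** P1 = 0"
      by simp
    then have "R ** S \<xi> ** (- (R ** S' \<xi> ** R) + P0 \<xi> ** matrix_inv P1 ** R) ** (P1D m ** P1D m) ** S \<xi> ** P1 = 0"
      by (simp add: matrix_mul_assoc)
    then have "(- (R ** S' \<xi> ** R) + P0 \<xi> ** matrix_inv P1 ** R) ** S \<xi> ** P1 = 0"
      by (simp add: R P1D_P1D)
    then have "- (R ** S' \<xi> ** (R ** S \<xi>) ** P1) + P0 \<xi> ** matrix_inv P1 ** (R ** S \<xi>) ** P1 = 0"
      by (simp only: matrix_mul_assoc mm.add_left mm.minus_left)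
    then have "- (R ** S' \<xi> ** P1) + P0 \<xi> ** (matrix_inv P1 ** P1) = 0"
      by (simp add: R matrix_mul_assoc)
    then have "P0 \<xi> = R ** S' \<xi> ** P1" by (simp add: matrix_inv_mult[OF P1])
    then show ?thesis using R by (simp add: matrix_mul_assoc)
  qed
  have x0: "ae_eq a b (x 0) (\<lambda>_. 0)" and uc: "continuous_on {0..} u" and yc: "continuous_on {0..} y"
    using cs unfolding classical_solution_def by blast+
  obtain dx where L: "\<forall>t\<ge>0. x t \<in> L2 a b \<and> dx t \<in> L2 a b"
    and lim: "\<forall>t\<ge>0. ((\<lambda>s. X_norm a b H (\<lambda>\<xi>. (1 / (s - t)) *\<^sub>R (x s \<xi> - x t \<xi>) - dx t \<xi>)) \<longlongrightarrow> 0) (at t within {0..})"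
    and wv: "\<forall>t\<ge>0. \<exists>w v. H1_rep a b (\<lambda>\<xi>. H \<xi> *v x t \<xi>) w v \<and>
                 ae_eq a b (dx t) (\<lambda>\<xi>. P1 *v v \<xi> + P0 \<xi> *v (H \<xi> *v x t \<xi>)) \<and>
                 u t = WB *v vstack (w b) (w a) \<and> y t = WC *v vstack (w b) (w a)"
    using cs unfolding classical_solution_def by (elim conjE exE) (rule that)
  have xL: "x t \<in> L2 a b" and dxL: "dx t \<in> L2 a b" if "t \<ge> 0" for t using L that by blast+
  have wv: "\<forall>t\<in>{0..}. \<exists>w v. H1_rep a b (\<lambda>\<xi>. H \<xi> *v x t \<xi>) w v \<and>
                 ae_eq a b (dx t) (\<lambda>\<xi>. P1 *v v \<xi> + P0 \<xi> *v (H \<xi> *v x t \<xi>)) \<and>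
                 u t = WB *v vstack (w b) (w a) \<and> y t = WC *v vstack (w b) (w a)"
    using wv unfolding Ball_def atLeast_iff .
  obtain w v where wv: "\<And>t. t \<ge> 0 \<Longrightarrow> H1_rep a b (\<lambda>\<xi>. H \<xi> *v x t \<xi>) (w t) (v t)"
    and dx_eq: "\<And>t. t \<ge> 0 \<Longrightarrow> ae_eq a b (dx t) (\<lambda>\<xi>. P1 *v v t \<xi> + P0 \<xi> *v (H \<xi> *v x t \<xi>))"
    and u_eq: "\<And>t. t \<ge> 0 \<Longrightarrow> u t = WB *v vstack (w t b) (w t a)"
    and y_eq: "\<And>t. t \<ge> 0 \<Longrightarrow> y t = WC *v vstack (w t b) (w t a)"
  proof -
    obtain w where "\<forall>t\<in>{0..}. \<exists>v. H1_rep a b (\<lambda>\<xi>. H \<xi> *v x t \<xi>) (w t) v \<and>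
                 ae_eq a b (dx t) (\<lambda>\<xi>. P1 *v v \<xi> + P0 \<xi> *v (H \<xi> *v x t \<xi>)) \<and>
                 u t = WB *v vstack (w t b) (w t a) \<and> y t = WC *v vstack (w t b) (w t a)"
      using bchoice[OF wv] by blast
    from bchoice[OF this] show ?thesis using that by auto
  qed
  have vL: "v t \<in> L2 a b" and w_int: "\<And>\<xi>. \<xi> \<in> {a..b} \<Longrightarrow> (v t has_integral (w t \<xi> - w t a)) {a..\<xi>}"
    and w_ae: "AE \<xi> in ?M. H \<xi> *v x t \<xi> = w t \<xi>" if "t \<ge> 0" for t
    using wv[OF that] unfolding H1_rep_def ae_eq_def by auto
  \<comment> \<open>Almost everywhere \<open>w = H x\<close> and
    \<open>P1 H = S^{-1} P1D HD S\<close>, so this equals \<open>HD S x\<close> there; unlike the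
    latter it has meaningful end values.\<close>
  define g where "g t \<xi> = P1D m *v (S \<xi> *v (P1 *v w t \<xi>))" for t \<xi>
  define z where "z t \<xi> = S \<xi> *v x t \<xi>" for t \<xi>
  define dz where "dz t \<xi> = S \<xi> *v dx t \<xi>" for t \<xi>
  show ?thesis
  proof (rule that)
    show "integrable ?M (z t)" if "t \<ge> 0" for t
      unfolding z_def by (rule integrable_bounded_bilinear_continuous[OF bounded_bilinear_matrix_vector_mult Sc L2_integrable[OF xL[OF that]]])
    show "integrable ?M (dz t)" if "t \<ge> 0" for t
      unfolding dz_def by (rule integrable_bounded_bilinear_continuous[OF bounded_bilinear_matrix_vector_mult Sc L2_integrable[OF dxL[OF that]]])
    show "((\<lambda>s. LINT \<xi>|?M. norm ((1 / (s - t)) *\<^sub>R (z s \<xi> $ k - z t \<xi> $ k) - dz t \<xi> $ k)) \<longlongrightarrow> 0) (at t within {0..})"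
      if t: "t \<ge> 0" for t k
    proof (rule Lim_null_comparison)
      have "((\<lambda>s. B * K * C * X_norm a b H (\<lambda>\<xi>. (1 / (s - t)) *\<^sub>R (x s \<xi> - x t \<xi>) - dx t \<xi>)) \<longlongrightarrow> B * K * C * 0) (at t within {0..})"
        by (intro tendsto_intros lim[rule_format] t)
      then show "((\<lambda>s. B * K * C * X_norm a b H (\<lambda>\<xi>. (1 / (s - t)) *\<^sub>R (x s \<xi> - x t \<xi>) - dx t \<xi>)) \<longlongrightarrow> 0) (at t within {0..})" by simp
      have "norm (LINT \<xi>|?M. norm ((1 / (s - t)) *\<^sub>R (z s \<xi> $ k - z t \<xi> $ k) - dz t \<xi> $ k))
          \<le> B * K * C * X_norm a b H (\<lambda>\<xi>. (1 / (s - t)) *\<^sub>R (x s \<xi> - x t \<xi>) - dx t \<xi>)" if s: "s \<ge> 0" for s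
      proof -
        define d where "d \<xi> = (1 / (s - t)) *\<^sub>R (x s \<xi> - x t \<xi>) - dx t \<xi>" for \<xi>
        have dL: "d \<in> L2 a b"
        proof -
          have "(\<lambda>\<xi>. 1 *\<^sub>R x s \<xi> - x t \<xi>) \<in> L2 a b" by (rule L2_cmult_diff[OF xL[OF s] xL[OF t]])
          from L2_cmult_diff[OF this dxL[OF t]] show ?thesis by (simp add: d_def[abs_def])
        qed
        have di: "integrable ?M d" by (rule L2_integrable[OF dL])
        have comp: "(1 / (s - t)) *\<^sub>R (z s \<xi> $ k - z t \<xi> $ k) - dz t \<xi> $ k = (S \<xi> *v d \<xi>) $ k" for \<xi>
          by (simp add: z_def dz_def d_def mv.diff_right mv.scaleR_right)
        have Sdi: "integrable ?M (\<lambda>\<xi>. S \<xi> *v d \<xi>)"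
          by (rule integrable_bounded_bilinear_continuous[OF bounded_bilinear_matrix_vector_mult Sc di])
        have "(LINT \<xi>|?M. norm ((S \<xi> *v d \<xi>) $ k)) \<le> (LINT \<xi>|?M. B * K * norm (d \<xi>))"
        proof (rule integral_mono)
          show "integrable ?M (\<lambda>\<xi>. norm ((S \<xi> *v d \<xi>) $ k))"
            by (intro integrable_norm integrable_bounded_linear[OF bounded_linear_vec_nth Sdi])
          show "integrable ?M (\<lambda>\<xi>. B * K * norm (d \<xi>))" using di by simp
          fix \<xi> assume "\<xi> \<in> space ?M"
          then have "norm (S \<xi>) * (norm (d \<xi>) * K) \<le> B * (norm (d \<xi>) * K)"
            using B[of \<xi>] K(1) by (intro mult_right_mono) auto
          then show "norm ((S \<xi> *v d \<xi>) $ k) \<le> B * K * norm (d \<xi>)"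
            using Finite_Cartesian_Product.norm_nth_le[of "S \<xi> *v d \<xi>" k] K(2)[of "S \<xi>" "d \<xi>"] by (simp only: mult_ac)
        qed
        also have "\<dots> \<le> B * K * (C * X_norm a b H d)"
          using C(2)[OF dL] B0 K(1) by (simp add: mult_left_mono)
        finally show ?thesis unfolding comp d_def[symmetric] by (simp add: mult_ac d_def[abs_def, symmetric])
      qed
      then show "\<forall>\<^sub>F s in at t within {0..}. norm (LINT \<xi>|?M. norm ((1 / (s - t)) *\<^sub>R (z s \<xi> $ k - z t \<xi> $ k) - dz t \<xi> $ k))
          \<le> B * K * C * X_norm a b H (\<lambda>\<xi>. (1 / (s - t)) *\<^sub>R (x s \<xi> - x t \<xi>) - dx t \<xi>)"
        unfolding eventually_at_filter by (intro always_eventually) auto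
    qed
    show "AE \<xi> in ?M. z 0 \<xi> = 0"
      using x0 unfolding ae_eq_def by eventually_elim (simp add: z_def)
    show "(dz t has_integral P1D m *v (g t \<xi> - g t a)) {a..\<xi>}" if t: "t \<ge> 0" and \<xi>: "\<xi> \<in> {a..b}" for t \<xi>
    proof -
      have ibp: "((\<lambda>\<eta>. S' \<eta> *v (P1 *v w t \<eta>) + S \<eta> *v (P1 *v v t \<eta>)) has_integral
         (S \<xi> *v (P1 *v w t \<xi>) - S a *v (P1 *v w t a))) {a..\<xi>}"
      proof (rule integration_by_parts_absolutely_continuous[OF bounded_bilinear_matrix_vector_mult])
        show "a \<le> \<xi>" using \<xi> by simp
        show "(S has_vector_derivative S' \<eta>) (at \<eta> within {a..\<xi>})" if "\<eta> \<in> {a..\<xi>}" for \<eta>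
          using S[of \<eta>] that \<xi> by (auto elim!: has_vector_derivative_within_subset)
        show "continuous_on {a..\<xi>} S'" by (rule continuous_on_subset[OF S'c]) (use \<xi> in auto)
        have "integrable ?M (\<lambda>\<eta>. P1 *v v t \<eta>)"
          by (rule integrable_bounded_linear[OF mv.bounded_linear_right L2_integrable[OF vL[OF t]]])
        then show "integrable (lebesgue_on {a..\<xi>}) (\<lambda>\<eta>. P1 *v v t \<eta>)"
          by (rule integrable_subinterval) (use \<xi> in auto)
        show "((\<lambda>\<eta>. P1 *v v t \<eta>) has_integral (P1 *v w t \<eta> - P1 *v w t a)) {a..\<eta>}" if "\<eta> \<in> {a..\<xi>}" for \<eta>
          using has_integral_linear[OF w_int[OF t] mv.bounded_linear_right[of P1], of \<eta>] that \<xi>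
          by (simp add: o_def mv.diff_right)
      qed
      have ae: "AE \<eta> in lborel. \<eta> \<in> {a..\<xi>} \<longrightarrow> dz t \<eta> = S' \<eta> *v (P1 *v w t \<eta>) + S \<eta> *v (P1 *v v t \<eta>)"
      proof -
        have "AE \<eta> in ?M. dz t \<eta> = S' \<eta> *v (P1 *v w t \<eta>) + S \<eta> *v (P1 *v v t \<eta>)"
          using dx_eq[OF t, unfolded ae_eq_def] w_ae[OF t] AE_space
        proof eventually_elim
          case (elim \<eta>)
          have "S \<eta> *v (P0 \<eta> *v w t \<eta>) = S' \<eta> *v (P1 *v w t \<eta>)"
            using SP0[of \<eta>] elim(3) by (simp add: matrix_vector_mul_assoc)
          then show ?case unfolding dz_def elim(1,2) by (simp add: mv.add_right)
        qed
        then have "AE \<eta> in lebesgue. \<eta> \<in> {a..b} \<longrightarrow> dz t \<eta> = S' \<eta> *v (P1 *v w t \<eta>) + S \<eta> *v (P1 *v v t \<eta>)"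
          by (subst (asm) AE_restrict_space_iff) auto
        then have "AE \<eta> in lborel. \<eta> \<in> {a..b} \<longrightarrow> dz t \<eta> = S' \<eta> *v (P1 *v w t \<eta>) + S \<eta> *v (P1 *v v t \<eta>)"
          by (simp add: AE_completion_iff)
        then show ?thesis by eventually_elim (use \<xi> in auto)
      qed
      have "(dz t has_integral (S \<xi> *v (P1 *v w t \<xi>) - S a *v (P1 *v w t a))) {a..\<xi>}"
        by (rule has_integral_AE[OF ae, THEN iffD2, OF ibp])
      then show ?thesis by (simp add: g_def mv.diff_right P1D_P1D_mult)
    qed
    show "AE \<xi> in ?M. HD \<xi> *v z t \<xi> = g t \<xi>" if t: "t \<ge> 0" for t
      using fac w_ae[OF t] AE_space
    proof eventually_elim
      case (elim \<xi>)
      have "S \<xi> ** matrix_inv (S \<xi>) = mat 1" using matrix_inv_mult Sinv elim(3) by auto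
      then have "S \<xi> *v (matrix_inv (S \<xi>) *v q) = q" for q by (simp add: matrix_vector_mul_assoc)
      moreover have "P1 *v w t \<xi> = matrix_inv (S \<xi>) *v (P1D m *v (HD \<xi> *v z t \<xi>))"
        unfolding elim(2)[symmetric] z_def by (simp add: matrix_vector_mul_assoc matrix_mul_assoc elim(1))
      ultimately show ?case by (simp add: g_def P1D_P1D_mult)
    qed
    have w_g: "w t \<xi> = (matrix_inv P1 ** matrix_inv (S \<xi>) ** P1D m) *v g t \<xi>" if "\<xi> \<in> {a..b}" for t \<xi>
    proof -
      have "matrix_inv (S \<xi>) *v (S \<xi> *v q) = q" for q
        using matrix_inv_mult[OF Sinv[OF that]] by (simp add: matrix_vector_mul_assoc)
      moreover have "matrix_inv P1 *v (P1 *v q) = q" for q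
        using matrix_inv_mult[OF P1] by (simp add: matrix_vector_mul_assoc)
      ultimately show ?thesis by (simp add: g_def P1D_P1D_mult flip: matrix_vector_mul_assoc)
    qed
    have vst: "vstack (w t b) (w t a) = block_diag (matrix_inv P1 ** matrix_inv (S b) ** P1D m)
                     (matrix_inv P1 ** matrix_inv (S a) ** P1D m) *v vstack (g t b) (g t a)" for t
      using ab by (simp add: block_diag_mult_vstack flip: w_g)
    show "u t = WD a b P1 m S WB *v vstack (g t b) (g t a)" if "t \<ge> 0" for t
      by (simp add: u_eq[OF that] vst WD_def matrix_vector_mul_assoc)
    show "y t = WD a b P1 m S WC *v vstack (g t b) (g t a)" if "t \<ge> 0" for t
      by (simp add: y_eq[OF that] vst WD_def matrix_vector_mul_assoc)
    \<comment> \<open>Continuity in time is given for \<open>u\<close> and \<open>y\<close> only; a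
      left inverse of the stacked matrix passes it on to the traces.\<close>
    have "rank (vcat WB WC) = CARD('n + 'n)" using rank by simp
    then obtain L where L: "L ** vcat WB WC = mat 1" using full_rank_left_inverse by blast
    have w_uy: "vstack (w t b) (w t a) = L *v vstack (u t) (y t)" if "t \<ge> 0" for t
      unfolding u_eq[OF that] y_eq[OF that] vcat_mult[symmetric] by (simp add: matrix_vector_mul_assoc L)
    have uyc: "continuous_on {0..} (\<lambda>t. vstack (u t) (y t))"
    proof -
      have "continuous_on {0..} (\<lambda>t. vstack (u t) (y t) $ j)" for j
        by (cases j) (auto intro!: continuous_intros uc yc)
      then show ?thesis
        using continuous_on_vec_lambda[of "{0..}" "\<lambda>j t. vstack (u t) (y t) $ j"] by simp
    qed
    have "continuous_on {0..} (\<lambda>t. L *v vstack (u t) (y t))"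
      by (rule bounded_linear.continuous_on[OF bounded_bilinear.bounded_linear_right[OF bounded_bilinear_matrix_vector_mult] uyc])
    then have wc: "continuous_on {0..} (\<lambda>t. vstack (w t b) (w t a))"
      by (rule continuous_on_eq) (simp add: w_uy)
    have "continuous_on {0..} (\<lambda>t. \<chi> i. vstack (w t b) (w t a) $ Inl i)" "continuous_on {0..} (\<lambda>t. \<chi> i. vstack (w t b) (w t a) $ Inr i)"
      by (intro continuous_on_vec_lambda continuous_intros wc)+
    then have "continuous_on {0..} (\<lambda>t. w t b)" "continuous_on {0..} (\<lambda>t. w t a)" by simp_all
    then show "continuous_on {0..} (\<lambda>t. g t a)" "continuous_on {0..} (\<lambda>t. g t b)"
      unfolding g_def by (auto intro!: mv.continuous_on continuous_on_const)
    have w0c: "continuous_on {a..b} (w 0)"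
    proof -
      have "v 0 integrable_on {a..b}" using w_int[of 0 b] ab by auto
      then have "continuous_on {a..b} (\<lambda>\<xi>. w 0 a + integral {a..\<xi>} (v 0))"
        by (intro continuous_intros indefinite_integral_continuous_1)
      moreover have "w 0 a + integral {a..\<xi>} (v 0) = w 0 \<xi>" if "\<xi> \<in> {a..b}" for \<xi>
        using integral_unique[OF w_int[OF _ that, of 0]] by simp
      ultimately show ?thesis by (rule continuous_on_eq)
    qed
    \<comment> \<open>The zero initial state fixes \<open>w 0\<close> almost everywhere; its
      continuity in space gives the end values.\<close>
    have "AE \<xi> in ?M. w 0 \<xi> \<in> {0}"
      using w_ae[of 0, simplified] x0[unfolded ae_eq_def] by eventually_elim simp
    from continuous_AE_lebesgue_on_mem_closed[OF ab closed_singleton w0c this]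
    have "w 0 \<xi> = 0" if "\<xi> \<in> {a..b}" for \<xi> using that by simp
    then show "g 0 a = 0" "g 0 b = 0" using ab by (simp_all add: g_def)
  qed
qed

section \<open>Delay along the characteristics\<close>

context
  fixes a b :: real and HD S H :: "real \<Rightarrow> ('k::rc_field, 'n::{finite,linorder}) sq_matrix" and P1 m
  assumes ab: "a < b" and dg: "diagonalisation a b P1 H m S HD"
begin

lemma diagonal_speed:
  shows "continuous_on {a..b} (\<lambda>\<xi>. kre (HD \<xi> $ k $ k))"
    and "\<xi> \<in> {a..b} \<Longrightarrow> 0 < kre (HD \<xi> $ k $ k)"
    and "\<xi> \<in> {a..b} \<Longrightarrow> (HD \<xi> *v v) $ k = kre (HD \<xi> $ k $ k) *\<^sub>R v $ k"
proof -
  have "continuous_on {a..b} HD"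
    using dg unfolding diagonalisation_def C1_interval_def
    by (meson continuous_on_eq_continuous_within has_vector_derivative_continuous)
  then show "continuous_on {a..b} (\<lambda>\<xi>. kre (HD \<xi> $ k $ k))"
    by (intro bounded_linear.continuous_on[OF bounded_linear_kre] continuous_intros)
  assume "\<xi> \<in> {a..b}"
  then obtain d where d: "\<And>i. 0 < d i" "HD \<xi> = diag_mat (\<lambda>i. of_real (d i))"
    using dg unfolding diagonalisation_def by blast
  have "kre (HD \<xi> $ k $ k) = d k" by (simp add: d(2) diag_mat_def kre_def to_complex_of_real)
  then show "0 < kre (HD \<xi> $ k $ k)" "(HD \<xi> *v v) $ k = kre (HD \<xi> $ k $ k) *\<^sub>R v $ k"
    using d by (simp_all add: diag_mat_mult_nth scaleR_conv_of_real)
qed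

lemma continuous_on_inverse_speed: "continuous_on {a..b} (\<lambda>\<xi>. 1 / kre (HD \<xi> $ k $ k))"
  by (intro continuous_intros diagonal_speed(1)) (use diagonal_speed(2)[of _ k] in \<open>auto simp: less_imp_neq[symmetric]\<close>)

lemma travel_time_pos: "0 < travel_time a b HD k"
proof -
  have "integral {a..b} (\<lambda>_. 0 :: real) < integral {a..b} (\<lambda>\<xi>. 1 / kre (HD \<xi> $ k $ k))"
    by (rule integral_less_real) (use ab diagonal_speed(2) continuous_on_inverse_speed in auto)
  then show ?thesis by (simp add: travel_time_def)
qed

text \<open>Components with \<open>among_first m k\<close> move left, entering at \<open>b\<close>
  and leaving at \<open>a\<close>; the others move right. The delay holds for \<open>g\<close>,
  since it is \<open>HD z\<close> and not \<open>z\<close> that is transported unchanged.\<close>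

lemma characteristic_delay:
  fixes g z dz :: "real \<Rightarrow> real \<Rightarrow> ('k, 'n) vec" and k :: 'n
  assumes z: "\<And>t. t \<ge> 0 \<Longrightarrow> integrable (lebesgue_on {a..b}) (z t)"
    and dz: "\<And>t. t \<ge> 0 \<Longrightarrow> integrable (lebesgue_on {a..b}) (dz t)"
    and lim: "\<And>t k. t \<ge> 0 \<Longrightarrow> ((\<lambda>s. LINT \<xi>|lebesgue_on {a..b}.
        norm ((1 / (s - t)) *\<^sub>R (z s \<xi> $ k - z t \<xi> $ k) - dz t \<xi> $ k)) \<longlongrightarrow> 0) (at t within {0..})"
    and z0: "AE \<xi> in lebesgue_on {a..b}. z 0 \<xi> = 0"
    and g: "\<And>t \<xi>. t \<ge> 0 \<Longrightarrow> \<xi> \<in> {a..b} \<Longrightarrow> (dz t has_integral P1D m *v (g t \<xi> - g t a)) {a..\<xi>}"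
    and hz: "\<And>t. t \<ge> 0 \<Longrightarrow> AE \<xi> in lebesgue_on {a..b}. HD \<xi> *v z t \<xi> = g t \<xi>"
    and gc: "continuous_on {0..} (\<lambda>t. g t a)" "continuous_on {0..} (\<lambda>t. g t b)"
    and g0: "g 0 a = 0" "g 0 b = 0"
    and t: "t \<ge> 0"
  defines "gin \<equiv> \<lambda>t. if among_first m k then g t b $ k else g t a $ k"
    and "gout \<equiv> \<lambda>t. if among_first m k then g t a $ k else g t b $ k"
  shows "gout t = (if travel_time a b HD k \<le> t then gin (t - travel_time a b HD k) else 0)"
proof -
  define \<epsilon> :: real where "\<epsilon> = (if among_first m k then 1 else - 1)"
  define h where "h \<xi> = kre (HD \<xi> $ k $ k)" for \<xi>
  define T0 where "T0 \<xi> = integral {a..\<xi>} (\<lambda>\<xi>. 1 / h \<xi>)" for \<xi>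
  define l where "l = travel_time a b HD k"
  \<comment> \<open>The travel time from \<open>\<xi>\<close> to the outflow end: 0 there and
    \<open>l\<close> at the inflow end.\<close>
  define T where "T \<xi> = (if among_first m k then T0 \<xi> else l - T0 \<xi>)" for \<xi>
  have hc: "continuous_on {a..b} (\<lambda>\<xi>. 1 / h \<xi>)" unfolding h_def by (rule continuous_on_inverse_speed)
  have hpos: "0 < h \<xi>" if "\<xi> \<in> {a..b}" for \<xi> using diagonal_speed(2)[OF that] by (simp add: h_def)
  have T0': "(T0 has_real_derivative 1 / h \<xi>) (at \<xi> within {a..b})" if "\<xi> \<in> {a..b}" for \<xi>
    unfolding T0_def using integral_has_real_derivative[OF hc that] .
  have hi: "(\<lambda>\<xi>. 1 / h \<xi>) integrable_on {c..d}" if "{c..d} \<subseteq> {a..b}" for c d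
    by (intro integrable_continuous_real continuous_on_subset[OF hc] that)
  have T0_bounds: "0 \<le> T0 \<xi>" "T0 \<xi> \<le> l" if "\<xi> \<in> {a..b}" for \<xi>
  proof -
    show "0 \<le> T0 \<xi>" unfolding T0_def using that hpos
      by (intro integral_nonneg hi) (auto simp: less_imp_le)
    show "T0 \<xi> \<le> l" unfolding T0_def l_def travel_time_def h_def[symmetric] using that hpos
      by (intro integral_subset_le hi) (auto simp: less_imp_le)
  qed
  have T0a: "T0 a = 0" and T0b: "T0 b = l" by (simp_all add: T0_def l_def travel_time_def h_def)
  have tested: "((\<lambda>t. cutoff r (t + T b) *\<^sub>R g t b $ k - cutoff r (t + T a) *\<^sub>R g t a $ k) has_integral 0) {0..r}" if r: "0 \<le> r" for r
  proof (rule transport_tested[OF ab r, where \<epsilon> = \<epsilon> and h = h and z = "\<lambda>t \<xi>. z t \<xi> $ k" and dz = "\<lambda>t \<xi>. dz t \<xi> $ k"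
        and g = "\<lambda>t \<xi>. g t \<xi> $ k"])
    show "\<epsilon> * \<epsilon> = 1" by (simp add: \<epsilon>_def)
    show "integrable (lebesgue_on {a..b}) (\<lambda>\<xi>. z t \<xi> $ k)" if "t \<ge> 0" for t
      by (rule integrable_bounded_linear[OF bounded_linear_vec_nth z[OF that]])
    show "integrable (lebesgue_on {a..b}) (\<lambda>\<xi>. dz t \<xi> $ k)" if "t \<ge> 0" for t
      by (rule integrable_bounded_linear[OF bounded_linear_vec_nth dz[OF that]])
    show "((\<lambda>s. LINT \<xi>|lebesgue_on {a..b}. norm ((1 / (s - t)) *\<^sub>R (z s \<xi> $ k - z t \<xi> $ k) - dz t \<xi> $ k)) \<longlongrightarrow> 0) (at t within {0..})"
      if "t \<ge> 0" for t by (rule lim[OF that])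
    show "AE \<xi> in lebesgue_on {a..b}. z 0 \<xi> $ k = 0" using z0 by eventually_elim simp
    show "((\<lambda>\<xi>. dz t \<xi> $ k) has_integral \<epsilon> *\<^sub>R (g t \<xi> $ k - g t a $ k)) {a..\<xi>}" if "t \<ge> 0" "\<xi> \<in> {a..b}" for t \<xi>
      using has_integral_linear[OF g[OF that] bounded_linear_vec_nth[of k]]
      by (simp add: o_def P1D_def diag_mat_mult_nth \<epsilon>_def split: if_splits)
    show "AE \<xi> in lebesgue_on {a..b}. h \<xi> *\<^sub>R z t \<xi> $ k = g t \<xi> $ k" if "t \<ge> 0" for t
      using hz[OF that] AE_space
    proof eventually_elim
      case (elim \<xi>)
      then show ?case using diagonal_speed(3)[of \<xi> "z t \<xi>" k] by (simp add: h_def)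
    qed
    show "continuous_on {a..b} h" unfolding h_def by (rule diagonal_speed(1))
    show "0 < h \<xi>" if "\<xi> \<in> {a..b}" for \<xi> by (rule hpos[OF that])
    show "(T has_real_derivative \<epsilon> / h \<xi>) (at \<xi> within {a..b})" if "\<xi> \<in> {a..b}" for \<xi>
      using T0'[OF that] DERIV_diff[OF DERIV_const[of l] T0'[OF that]]
      by (cases "among_first m k") (simp_all add: T_def[abs_def] \<epsilon>_def)
    show "0 \<le> T \<xi>" if "\<xi> \<in> {a..b}" for \<xi> using T0_bounds[OF that] by (simp add: T_def)
  qed
  show ?thesis unfolding l_def[symmetric]
  proof (rule delay_of_tested)
    show "0 \<le> l" using travel_time_pos[of k] by (simp add: l_def)
    show "continuous_on {0..} gin" "continuous_on {0..} gout"
      unfolding gin_def gout_def using gc by (cases "among_first m k"; auto intro!: continuous_intros)+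
    show "gin 0 = 0" "gout 0 = 0" using g0 by (simp_all add: gin_def gout_def)
    show "0 \<le> t" by (rule t)
    show "((\<lambda>t. cutoff r (t + l) *\<^sub>R gin t - cutoff r t *\<^sub>R gout t) has_integral 0) {0..r}" if "0 \<le> r" for r
      \<comment> \<open>For right-moving components the tested identity has the opposite
        sign.\<close>
      using tested[OF that] has_integral_neg[OF tested[OF that]] T0a T0b
      by (cases "among_first m k") (simp_all add: T_def gin_def gout_def)
  qed
qed

end

section \<open>From the traces to the output\<close>

lemma norm_vec_le_sum: "norm v \<le> (\<Sum>i\<in>UNIV. norm (v $ i))"
  unfolding norm_vec_def by (rule L2_set_le_sum) simp

text \<open>For continuous \<open>u\<close> the essential supremum bounds every value, so a
  pointwise estimate suffices; an infinite norm of \<open>u\<close> makes the claim trivial.\<close>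

lemma Linf_norm_le:
  fixes u y :: "real \<Rightarrow> 'v::euclidean_space"
  assumes c: "c > 0" and t: "t > 0" and u: "continuous_on {0..} u" and y: "continuous_on {0..} y"
    and bound: "\<And>B s. 0 \<le> s \<Longrightarrow> s \<le> t \<Longrightarrow> 0 \<le> B \<Longrightarrow> (\<And>r. 0 \<le> r \<Longrightarrow> r \<le> t \<Longrightarrow> norm (u r) \<le> B) \<Longrightarrow> norm (y s) \<le> c * B"
  shows "Linf_norm t y \<le> ennreal c * Linf_norm t u"
proof (cases "Linf_norm t u")
  case (real B)
  have uc: "continuous_on {0..t} u" and yc: "continuous_on {0..t} y"
    by (auto intro: continuous_on_subset[OF u] continuous_on_subset[OF y])
  have "AE s in lebesgue_on {0..t}. ennreal (norm (u s)) \<le> Linf_norm t u"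
    unfolding Linf_norm_def by (rule esssup_AE)
  then have "AE s in lebesgue_on {0..t}. u s \<in> cball 0 B"
    using real by (auto elim!: eventually_mono simp: ennreal_le_iff)
  then have uB: "norm (u r) \<le> B" if "0 \<le> r" "r \<le> t" for r
    using continuous_AE_lebesgue_on_mem_closed[OF t closed_cball uc, of 0 B r] that by simp
  have "y \<in> borel_measurable (lebesgue_on {0..t})"
    by (intro continuous_imp_measurable_on_sets_lebesgue yc) auto
  then have "Linf_norm t y \<le> ennreal (c * B)"
    unfolding Linf_norm_def using real
    by (intro esssup_I AE_I2 ennreal_leI bound uB) auto
  then show ?thesis using real c by (simp add: ennreal_mult)
next
  case top
  then show ?thesis using c by (simp add: ennreal_mult_top)
qed

lemma BIBO_stable_of_summable:
  fixes P1 K M :: "('k::rc_field, 'n::{finite,linorder}) sq_matrix"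
    and P0 H S HD :: "real \<Rightarrow> ('k, 'n) sq_matrix"
    and WB WC :: "('k, 'n) n_2n_matrix"
  assumes ab: "a < b"
    and sa: "standing_assumptions a b P1 P0 H WB WC"
    and dg: "diagonalisation a b P1 H m S HD"
    and P0D: "\<forall>\<xi>\<in>{a..b}. P0D a b P1 P0 m S \<xi> = 0"
    and K: "invertible K"
    and WBD: "WD a b P1 m S WB = K ** hcat (QplusD m - M ** QminusD m) (QminusD m - M ** QplusD m)"
    and sum: "\<And>p q. summable (\<lambda>k. pm_norm (mat_pow (delay_matrix (travel_time a b HD) M) k $ p $ q))"
  shows "BIBO_stable a b P1 P0 H WB WC"
proof -
  let ?l = "travel_time a b HD"
  have l: "0 < ?l k" for k by (rule travel_time_pos[OF ab dg])
  define Rp where "Rp p = (\<Sum>q\<in>UNIV. \<Sum>k. pm_norm (mat_pow (delay_matrix ?l M) k $ p $ q))" for p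
  have Rp0: "0 \<le> Rp p" for p unfolding Rp_def by (intro sum_nonneg suminf_nonneg sum) auto
  define R where "R = (\<Sum>p\<in>UNIV. Rp p)"
  have R: "Rp p \<le> R" for p unfolding R_def by (rule member_le_sum) (auto simp: Rp0)
  have R0: "0 \<le> R" unfolding R_def by (intro sum_nonneg Rp0)
  obtain CK where CK: "CK > 0" "\<And>v. norm (matrix_inv K *v v) \<le> norm v * CK"
    using bounded_linear.pos_bounded[OF bounded_bilinear.bounded_linear_right[OF bounded_bilinear_matrix_vector_mult]] by blast
  obtain CW where CW: "CW > 0" "\<And>v. norm (WD a b P1 m S WC *v v) \<le> norm v * CW"
    using bounded_linear.pos_bounded[OF bounded_bilinear.bounded_linear_right[OF bounded_bilinear_matrix_vector_mult]] by blast
  \<comment> \<open>\<open>CK\<close> bounds the inverse of \<open>K\<close>, \<open>R\<close> the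
    solution operator of the delay equation and \<open>CW\<close> the output matrix; the cardinality
    comes from bounding a norm by the sum over components, and \<open>+ 1\<close> secures
    positivity.\<close>
  define c where "c = real CARD('n + 'n) * (R * CK) * CW + 1"
  have c0: "c > 0" unfolding c_def using R0 CK(1) CW(1) by (intro add_nonneg_pos mult_nonneg_nonneg) auto
  have main: "norm (y s) \<le> c * B"
    if cs: "classical_solution a b P1 P0 H WB WC (\<lambda>_. 0) u x y"
      and s: "0 \<le> s" "s \<le> t" and B0: "0 \<le> B" and uB: "\<And>r. 0 \<le> r \<Longrightarrow> r \<le> t \<Longrightarrow> norm (u r) \<le> B"
    for u x y s t B
  proof -
    obtain g z dz :: "real \<Rightarrow> real \<Rightarrow> ('k, 'n) vec" where
      sol: "\<And>t. t \<ge> 0 \<Longrightarrow> integrable (lebesgue_on {a..b}) (z t)"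
        "\<And>t. t \<ge> 0 \<Longrightarrow> integrable (lebesgue_on {a..b}) (dz t)"
        "\<And>t k. t \<ge> 0 \<Longrightarrow> ((\<lambda>s. LINT \<xi>|lebesgue_on {a..b}.
            norm ((1 / (s - t)) *\<^sub>R (z s \<xi> $ k - z t \<xi> $ k) - dz t \<xi> $ k)) \<longlongrightarrow> 0) (at t within {0..})"
        "AE \<xi> in lebesgue_on {a..b}. z 0 \<xi> = 0"
        "\<And>t \<xi>. t \<ge> 0 \<Longrightarrow> \<xi> \<in> {a..b} \<Longrightarrow> (dz t has_integral P1D m *v (g t \<xi> - g t a)) {a..\<xi>}"
        "\<And>t. t \<ge> 0 \<Longrightarrow> AE \<xi> in lebesgue_on {a..b}. HD \<xi> *v z t \<xi> = g t \<xi>"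
      and u: "\<And>t. t \<ge> 0 \<Longrightarrow> u t = WD a b P1 m S WB *v vstack (g t b) (g t a)"
      and y: "\<And>t. t \<ge> 0 \<Longrightarrow> y t = WD a b P1 m S WC *v vstack (g t b) (g t a)"
      and tr: "continuous_on {0..} (\<lambda>t. g t a)" "continuous_on {0..} (\<lambda>t. g t b)" "g 0 a = 0" "g 0 b = 0"
      by (rule diagonalised_solution[OF ab sa dg P0D cs]) (rule that)
    define gin where "gin k t = (if among_first m k then g t b $ k else g t a $ k)" for k t
    define gout where "gout k t = (if among_first m k then g t a $ k else g t b $ k)" for k t
    \<comment> \<open>Extended by zero because the delay equation is posed for all real times and
      looks back beyond time 0.\<close>
    define f where "f k t = (if 0 \<le> t then gin k t else 0)" for k t
    define v where "v k t = (if 0 \<le> t then (matrix_inv K *v u t) $ k else 0)" for k t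
    have out: "gout k t = f k (t - ?l k)" if "0 \<le> t" for k t
      using characteristic_delay[OF ab dg sol tr that, of k] by (simp add: gin_def gout_def f_def)
    \<comment> \<open>The blocks of \<open>WD\<close> regroup the traces into inflow and outflow, so
      that applying the inverse of \<open>K\<close> to \<open>u\<close> gives inflow minus
      \<open>M\<close> times outflow.\<close>
    have boundary: "gin p t = (matrix_inv K *v u t) $ p + (\<Sum>q\<in>UNIV. M $ p $ q * gout q t)" if "0 \<le> t" for p t
    proof -
      define vin where "vin = (\<chi> k. gin k t)"
      define vout where "vout = (\<chi> k. gout k t)"
      have vin: "QplusD m *v g t b + QminusD m *v g t a = vin"
        by (simp add: vec_eq_iff vin_def gin_def QplusD_def QminusD_def diag_mat_mult_nth)
      have vout: "QminusD m *v g t b + QplusD m *v g t a = vout"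
        by (simp add: vec_eq_iff vout_def gout_def QplusD_def QminusD_def diag_mat_mult_nth)
      have "u t = K *v ((QplusD m - M ** QminusD m) *v g t b + (QminusD m - M ** QplusD m) *v g t a)"
        unfolding u[OF that] WBD by (simp add: hcat_mult_vstack flip: matrix_vector_mul_assoc)
      also have "(QplusD m - M ** QminusD m) *v g t b + (QminusD m - M ** QplusD m) *v g t a
        = (QplusD m *v g t b + QminusD m *v g t a) - M *v (QminusD m *v g t b + QplusD m *v g t a)"
        by (simp add: matrix_vector_mult_diff_rdistrib matrix_vector_right_distrib matrix_vector_mul_assoc)
      finally have "matrix_inv K *v u t = vin - M *v vout"
        unfolding vin vout by (simp add: matrix_vector_mul_assoc matrix_inv_mult[OF K])
      then have "vin = matrix_inv K *v u t + M *v vout" by simp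
      then have "vin $ p = (matrix_inv K *v u t) $ p + (M *v vout) $ p" by simp
      then show ?thesis by (simp add: vin_def vout_def matrix_vector_mult_def)
    qed
    have eq: "f p t = v p t + (\<Sum>q\<in>UNIV. M $ p $ q * f q (t - ?l q))" for p t
    proof (cases "0 \<le> t")
      case True
      then show ?thesis using boundary[OF True] by (simp add: out[OF True] f_def[of p t] v_def)
    next
      case False
      have "\<not> 0 \<le> t - ?l q" for q using False l[of q] by linarith
      then have "f q (t - ?l q) = 0" for q unfolding f_def by (rule if_not_P)
      then show ?thesis using False by (simp add: f_def[of p t] v_def)
    qed
    have vB: "norm (v q r) \<le> CK * B" if "r \<le> t" for q r
    proof (cases "0 \<le> r")
      case True
      have "norm (v q r) \<le> norm (matrix_inv K *v u r)"
        using True Finite_Cartesian_Product.norm_nth_le[of "matrix_inv K *v u r" q] by (simp add: v_def)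
      also have "\<dots> \<le> norm (u r) * CK" by (rule CK)
      also have "\<dots> \<le> B * CK" using uB[OF True that] CK(1) by (intro mult_right_mono) auto
      finally show ?thesis by (simp add: mult.commute)
    next
      case False
      then show ?thesis using CK(1) B0 by (simp add: v_def)
    qed
    have fB: "norm (f p r) \<le> R * (CK * B)" if "r \<le> t" for p r
    proof -
      have "norm (f p r) \<le> Rp p * (CK * B)"
        unfolding Rp_def
        by (rule delay_system_bound[where v = v]) (use l eq sum vB that in \<open>auto simp: f_def\<close>)
      also have "\<dots> \<le> R * (CK * B)" using R[of p] CK(1) B0 by (intro mult_right_mono) auto
      finally show ?thesis .
    qed
    have inB: "norm (gin k s) \<le> R * (CK * B)" for k using fB[of s k] s by (simp add: f_def)
    \<comment> \<open>Outflow is delayed inflow, so the inflow bound at an earlier time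
      applies.\<close>
    have outB: "norm (gout k s) \<le> R * (CK * B)" for k
      unfolding out[OF s(1)] using l[of k] s by (intro fB) linarith
    have comp: "norm (vstack (g s b) (g s a) $ j) \<le> R * (CK * B)" for j
    proof (cases j)
      case (Inl k)
      then show ?thesis using inB[of k] outB[of k] by (cases "among_first m k") (simp_all add: gin_def gout_def)
    next
      case (Inr k)
      then show ?thesis using inB[of k] outB[of k] by (cases "among_first m k") (simp_all add: gin_def gout_def)
    qed
    have "norm (y s) \<le> norm (vstack (g s b) (g s a)) * CW" unfolding y[OF s(1)] by (rule CW)
    also have "\<dots> \<le> (\<Sum>j\<in>(UNIV :: ('n + 'n) set). R * (CK * B)) * CW"
      using CW(1) by (intro mult_right_mono order_trans[OF norm_vec_le_sum] sum_mono comp) auto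
    also have "\<dots> = (real CARD('n + 'n) * (R * CK) * CW) * B" by (simp add: mult_ac)
    also have "\<dots> \<le> c * B" using B0 by (intro mult_right_mono) (simp_all add: c_def)
    finally show ?thesis .
  qed
  show ?thesis
    unfolding BIBO_stable_def
  proof (intro exI[of _ c] conjI allI impI)
    show "0 < c" by (rule c0)
    fix u x y and t :: real
    assume "classical_solution a b P1 P0 H WB WC (\<lambda>_. 0) u x y \<and> test_function u" and t: "0 < t"
    then have cs: "classical_solution a b P1 P0 H WB WC (\<lambda>_. 0) u x y" by blast
    then have "continuous_on {0..} u" "continuous_on {0..} y" by (auto simp: classical_solution_def)
    then show "Linf_norm t y \<le> ennreal c * Linf_norm t u"
      by (rule Linf_norm_le[OF c0 t]) (rule main[OF cs])
  qed
qed

text \<open>The first conjunct is the remark within condition 2. \<open>K\<close> and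
  \<open>M\<close> range over all factorisations of \<open>WD\<close>, which includes the matrices
  of the diagonalised form.\<close>

theorem theorem29:
  fixes a b :: real
    and P1 K M :: "('k::rc_field, 'n::{finite,linorder}) sq_matrix"
    and P0 H S HD :: "real \<Rightarrow> ('k, 'n) sq_matrix"
    and WB WC :: "('k, 'n) n_2n_matrix"
    and m :: nat
  assumes "a < b"
    and "standing_assumptions a b P1 P0 H WB WC"
    and "diagonalisation a b P1 H m S HD"
    and "\<forall>\<xi>\<in>{a..b}. P0D a b P1 P0 m S \<xi> = 0"
    and "invertible K"
    and "WD a b P1 m S WB = K ** hcat (QplusD m - M ** QminusD m) (QminusD m - M ** QplusD m)"
  shows "(\<forall>N. submultiplicative_matrix_norm N \<and> N (abs_matrix M) < 1 \<longrightarrow>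
            summable (mat_pow (abs_matrix M))) \<and>
         (linf_matrix_norm M < 1 \<or>
          summable (mat_pow (abs_matrix M)) \<or>
          (\<exists>k0>0. \<forall>p. (\<Sum>r\<in>UNIV. M_norm (\<lambda>s. mat_pow (MU a b HD M s) k0 $ p $ r)) < 1) \<longrightarrow>
            (\<forall>p q. (\<Sum>k. M_norm (\<lambda>s. mat_pow (MU a b HD M s) k $ p $ q)) < \<infinity>) \<and>
            BIBO_stable a b P1 P0 H WB WC)"
proof (intro conjI allI impI)
  fix N
  assume "submultiplicative_matrix_norm N \<and> N (abs_matrix M) < 1"
  then show "summable (mat_pow (abs_matrix M))"
    using summable_mat_pow_of_submultiplicative_norm by blast
next
  let ?l = "travel_time a b HD"
  let ?A = "delay_matrix ?l M"
  \<comment> \<open>As travel times are positive, all norms are finite and real summability decides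
    the extended series.\<close>
  have M_norm: "M_norm (\<lambda>s. mat_pow (MU a b HD M s) k $ p $ q) = ennreal (pm_norm (mat_pow ?A k $ p $ q))" for k p q
    by (rule M_norm_mat_pow_MU) (rule less_imp_le[OF travel_time_pos[OF assms(1,3)]])
  assume cond: "linf_matrix_norm M < 1 \<or> summable (mat_pow (abs_matrix M)) \<or>
    (\<exists>k0>0. \<forall>p. (\<Sum>r\<in>UNIV. M_norm (\<lambda>s. mat_pow (MU a b HD M s) k0 $ p $ r)) < 1)"
  have sum: "summable (\<lambda>k. pm_norm (mat_pow ?A k $ p $ q))" for p q
    using cond
  proof (elim disjE exE conjE)
    assume "linf_matrix_norm M < 1"
    then show ?thesis by (rule summable_pm_norm_of_linf_matrix_norm)
  next
    assume "summable (mat_pow (abs_matrix M))"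
    then show ?thesis by (rule summable_pm_norm_of_summable_abs)
  next
    fix k0 :: nat
    assume k0: "0 < k0" "\<forall>p. (\<Sum>r\<in>UNIV. M_norm (\<lambda>s. mat_pow (MU a b HD M s) k0 $ p $ r)) < 1"
    show ?thesis
      by (rule summable_pm_norm_of_row_sums[OF k0(1)])
        (use k0(2) in \<open>simp add: M_norm sum_ennreal ennreal_less_one_iff\<close>)
  qed
  show "(\<Sum>k. M_norm (\<lambda>s. mat_pow (MU a b HD M s) k $ p $ q)) < \<infinity>" for p q
    unfolding M_norm using sum[of p q] by (simp add: suminf_ennreal2 less_top[symmetric])
  show "BIBO_stable a b P1 P0 H WB WC"
    by (rule BIBO_stable_of_summable[OF assms sum])
qed

end
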